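(* Let $d,k\ge 1$, let $\Omega\subseteq\mathbb{R}^d$ be a compact convex set, and let $\mu_1,\dots,\mu_k$ be probability measures on $\Omega$. Suppose that one of the following holds. (i) $p=\delta_0$, where $0\in\Omega^k$ is assumed, and $L:\mathbb{R}^{kd}\to\mathbb{R}$ is convex. (ii) $L:\mathbb{R}^{kd}\to\mathbb{R}$ is a convex function such that $$L(x_1-\xi,\dots,x_k-\xi)=L(x_1,\dots,x_k)\quad\text{for all }x_1,\dots,x_k\in\Omega\text{ and }\xi\in\mathbb{R}^d,$$ and $p=\mathrm{Law}(\xi,\dots,\xi)$ with $\xi\sim\nu$ for some probability measure $\nu$ on $\Omega$. (iii) $E\subseteq\mathbb{R}^{kd}$ is a linear subspace, $\mathrm{Proj}_E$ is the orthogonal projection onto $E$, $L:\mathbb{R}^{kd}\to\mathbb{R}$ is of the form $L(x)=\tilde L(\mathrm{Proj}_E(x))$ for a convex function $\tilde L:E\to\mathbb{R}$, and $p$ is a probability measure on $\Omega^k$ such that $\mathrm{supp}(p)\subseteq E^\perp$. Then, in each of the cases (i), (ii), (iii), $$\min_{\gamma\in\Pi(\mu_1,\dots,\mu_k)}\Gamma(\gamma)=\min_{(\pi,m)\in\mathcal{C}(p,\mu_1,\dots,\mu_k)}B(\pi,m),$$ and the minimum on both sides is attained. Further, in each of these cases: (1) For any minimizer $\gamma_{\mathrm{opt}}\in\Pi(\mu_1,\dots,\mu_k)$ of the left-hand side there is a flow $(\pi_{\mathrm{opt}},m_{\mathrm{opt}})\in\mathcal{C}(p,\mu_1,\dots,\mu_k)$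 (induced by $\gamma_{\mathrm{opt}}$) which is a minimizer of the right-hand side and satisfies $\pi_{\mathrm{opt}}(1,\cdot)=\gamma_{\mathrm{opt}}$. (2) For any minimizer $(\pi_{\mathrm{opt}},m_{\mathrm{opt}})\in\mathcal{C}(p,\mu_1,\dots,\mu_k)$ of the right-hand side, $\pi_{\mathrm{opt}}(1,\cdot)$ is a minimizer of the left-hand side.
   Context: Identify $(\mathbb{R}^d)^k\cong\mathbb{R}^{kd}$ and write $x=(x_1,\dots,x_k)$ with $x_l\in\mathbb{R}^d$; $[k]=\{1,\dots,k\}$. Static problem: $\Pi(\mu_1,\dots,\mu_k)$ is the set of probability measures on $\Omega^k$ whose respective marginals on the $k$ factors are $\mu_1,\dots,\mu_k$, and for a probability measure $\gamma$ on $\Omega^k$, $$\Gamma(\gamma)=\int_{\Omega^k}L(x_1,\dots,x_k)\,d\gamma(x_1,\dots,x_k).$$ Dynamical problem: $\mathcal{P}(\Omega^k)$ is the set of probability measures on $\Omega^k$ with the weak convergence topology, $C([0,1];\mathcal{P}(\Omega^k))$ is the set of continuous maps $[0,1]\to\mathcal{P}(\Omega^k)$, and $\mathcal{M}([0,1]\times\Omega^k;\mathbb{R}^{kd})$ is the set of $\mathbb{R}^{kd}$-valued measures on $[0,1]\times\Omega^k$. Such vector measures are understood to be of the form $dm(t,x)\,dt$, with $m(t,\cdot)$ an $\mathbb{R}^{kd}$-valued measure on $\Omega^k$. The set $\mathcal{C}(p,\mu_1,\dots,\mu_k)$ consists of all pairs $(\pi,m)\in C([0,1];\mathcal{P}(\Omega^k))\times\mathcal{M}([0,1]\times\Omega^k;\mathbb{R}^{kd})$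 such that: - $m\ll\pi$, meaning that $m(t,\cdot)$ is absolutely continuous with respect to $\pi(t,\cdot)$ for all $t\in[0,1]$; - $\int_0^1\int_{\Omega^k}\left|\frac{dm(t,x)}{d\pi(t,x)}\right|^{r}d\pi(t,x)\,dt<+\infty$ for some exponent $r>1$; - $\partial_t\pi+\nabla\cdot m=0$ in the weak sense: for every continuously differentiable $\eta\in C^1([0,1]\times\Omega^k;\mathbb{R})$, $$\int_0^1\!\int_{\Omega^k}\partial_t\eta\,d\pi(t,x)\,dt+\int_0^1\!\int_{\Omega^k}\langle\nabla\eta(t,x),dm(t,x)\rangle\,dt=\int_{\Omega^k}\eta(1,x)\,d\pi(1,x)-\int_{\Omega^k}\eta(0,x)\,d\pi(0,x);$$ - $\pi(0,\cdot)=p$ and, for all $l\in[k]$, the $l$-th marginal $\pi_l(1,\cdot)$ of $\pi(1,\cdot)$ equals $\mu_l$. For $(\pi,m)\in\mathcal{C}(p,\mu_1,\dots,\mu_k)$ the dynamical cost is $$B(\pi,m)=\int_0^1\int_{\Omega^k}L\!\left(\frac{dm(t,x)}{d\pi(t,x)}\right)d\pi(t,x)\,dt .$$ *)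

theory Defs
  imports "HOL-Probability.Probability"
begin

text \<open>
  A measure on \<open>S\<close> has underlying space \<open>S\<close> itself, with the Borel sets of the subspace topology.
\<close>

abbreviation borel_on :: "'a::topological_space set \<Rightarrow> 'a measure" where
  "borel_on S \<equiv> restrict_space borel S"

definition prob_measures :: "'a::topological_space set \<Rightarrow> 'a measure set" where
  "prob_measures S = {M. prob_space M \<and> sets M = sets (borel_on S)}"

definition weak_topology :: "'a::topological_space set \<Rightarrow> 'a measure topology" where
  "weak_topology S = topology_generated_by
     {{M \<in> prob_measures S. (\<integral>x. f x \<partial>M) \<in> U} | (f :: 'a \<Rightarrow> real) U.
        continuous_on S f \<and> bounded (f ` S) \<and> open U}"

definition measure_support :: "'a::topological_space set \<Rightarrow> 'a measure \<Rightarrow> 'a set" where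
  "measure_support S M = {x \<in> S. \<forall>U. open U \<and> x \<in> U \<longrightarrow> 0 < emeasure M (U \<inter> S)}"

definition orth_proj :: "'a::euclidean_space set \<Rightarrow> 'a \<Rightarrow> 'a" where
  "orth_proj E x = (THE y. y \<in> E \<and> x - y \<in> E\<^sup>\<bottom>)"

definition power_set :: "(real^'d) set \<Rightarrow> (real^'d^'k) set" where
  "power_set \<Omega> = {x. \<forall>l. x $ l \<in> \<Omega>}"

definition marginal :: "(real^'d) set \<Rightarrow> 'k \<Rightarrow> (real^'d^'k) measure \<Rightarrow> (real^'d) measure" where
  "marginal \<Omega> l M = distr M (borel_on \<Omega>) (\<lambda>x. x $ l)"

definition couplings :: "(real^'d) set \<Rightarrow> ('k \<Rightarrow> (real^'d) measure) \<Rightarrow> (real^'d^'k) measure set" where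
  "couplings \<Omega> \<mu> = {\<gamma> \<in> prob_measures (power_set \<Omega>). \<forall>l. marginal \<Omega> l \<gamma> = \<mu> l}"

definition static_cost :: "('a \<Rightarrow> real) \<Rightarrow> 'a measure \<Rightarrow> real" where
  "static_cost L \<gamma> = (\<integral>x. L x \<partial>\<gamma>)"

text \<open>
  Countable additivity; taking all \<open>A i\<close> empty, it includes \<open>m {} = 0\<close>. Only the \<open>\<sigma>\<close>-algebra of \<open>M\<close>
  matters.
\<close>

definition vector_measure :: "'a measure \<Rightarrow> ('a set \<Rightarrow> 'v::euclidean_space) \<Rightarrow> bool" where
  "vector_measure M m \<longleftrightarrow>
     (\<forall>A :: nat \<Rightarrow> 'a set. range A \<subseteq> sets M \<longrightarrow> disjoint_family A \<longrightarrow> (\<lambda>i. m (A i)) sums m (\<Union>i. A i))"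

definition vm_absolutely_continuous ::
    "'a measure \<Rightarrow> ('a set \<Rightarrow> 'v::euclidean_space) \<Rightarrow> bool" where
  "vm_absolutely_continuous M m \<longleftrightarrow> (\<forall>A \<in> null_sets M. m A = 0)"

definition vm_RN_deriv ::
    "'a measure \<Rightarrow> ('a set \<Rightarrow> 'v::euclidean_space) \<Rightarrow> 'a \<Rightarrow> 'v" where
  "vm_RN_deriv M m = (SOME f. integrable M f \<and> (\<forall>A \<in> sets M. m A = (LINT x:A|M. f x)))"

text \<open>
  Families \<open>m\<close> of vector measures on \<open>S\<close> for which \<open>dm(t,x) dt\<close>, that is
  \<open>B \<mapsto> \<integral>\<^sub>0\<^sup>1 m t B\<^sub>t dt\<close> with slices \<open>B\<^sub>t = {x. (t, x) \<in> B}\<close>, is a vector measure on \<open>[0,1] \<times> S\<close>.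
  The values of \<open>m\<close> outside \<open>[0,1]\<close> are irrelevant.
\<close>

definition time_vector_measure ::
    "'a::euclidean_space set \<Rightarrow> (real \<Rightarrow> 'a set \<Rightarrow> 'a) \<Rightarrow> bool" where
  "time_vector_measure S m \<longleftrightarrow>
     (\<forall>t \<in> {0..1}. vector_measure (borel_on S) (m t)) \<and>
     (\<forall>B \<in> sets (borel_on ({0..1} \<times> S)). set_integrable lborel {0..1} (\<lambda>t. m t (Pair t -` B))) \<and>
     vector_measure (borel_on ({0..1} \<times> S)) (\<lambda>B. LINT t:{0..1}|lborel. m t (Pair t -` B))"

text \<open>
  \<open>\<eta>\<close> is continuously differentiable on the closed set \<open>[0,1] \<times> S\<close>, with time derivative \<open>\<eta>t\<close> and
  spatial gradient \<open>\<eta>x\<close>. Derivatives are taken within that set. If \<open>S\<close> is convex with empty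
  interior, the gradient is determined only up to vectors normal to the affine hull of \<open>S\<close>, and every
  continuous choice of it is allowed; the weak equation below then forces \<open>m\<close> to be tangential.
\<close>

definition C1_on_cylinder ::
    "'a::euclidean_space set \<Rightarrow> (real \<times> 'a \<Rightarrow> real) \<Rightarrow> (real \<times> 'a \<Rightarrow> real) \<Rightarrow> (real \<times> 'a \<Rightarrow> 'a) \<Rightarrow> bool" where
  "C1_on_cylinder S \<eta> \<eta>t \<eta>x \<longleftrightarrow>
     continuous_on ({0..1} \<times> S) \<eta>t \<and> continuous_on ({0..1} \<times> S) \<eta>x \<and>
     (\<forall>z \<in> {0..1} \<times> S.
        (\<eta> has_derivative (\<lambda>(s, y). s * \<eta>t z + \<eta>x z \<bullet> y)) (at z within {0..1} \<times> S))"

text \<open>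
  The integral of a vector field against \<open>m t\<close> is written with the density of \<open>m t\<close> with respect to
  \<open>\<pi> t\<close>; it is only used when \<open>m t\<close> is absolutely continuous with respect to \<open>\<pi> t\<close>.
\<close>

definition continuity_equation ::
    "'a::euclidean_space set \<Rightarrow> (real \<Rightarrow> 'a measure) \<Rightarrow> (real \<Rightarrow> 'a set \<Rightarrow> 'a) \<Rightarrow> bool" where
  "continuity_equation S \<pi> m \<longleftrightarrow>
     (\<forall>\<eta> \<eta>t \<eta>x. C1_on_cylinder S \<eta> \<eta>t \<eta>x \<longrightarrow>
        (LINT t:{0..1}|lborel. (\<integral>x. \<eta>t (t, x) \<partial>\<pi> t)) +
        (LINT t:{0..1}|lborel. (\<integral>x. \<eta>x (t, x) \<bullet> vm_RN_deriv (\<pi> t) (m t) x \<partial>\<pi> t)) =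
        (\<integral>x. \<eta> (1, x) \<partial>\<pi> 1) - (\<integral>x. \<eta> (0, x) \<partial>\<pi> 0))"

definition flows ::
    "(real^'d) set \<Rightarrow> (real^'d^'k) measure \<Rightarrow> ('k \<Rightarrow> (real^'d) measure) \<Rightarrow>
     ((real \<Rightarrow> (real^'d^'k) measure) \<times> (real \<Rightarrow> (real^'d^'k) set \<Rightarrow> real^'d^'k)) set" where
  "flows \<Omega> p \<mu> = {(\<pi>, m).
     continuous_map (top_of_set {0..1}) (weak_topology (power_set \<Omega>)) \<pi> \<and>
     time_vector_measure (power_set \<Omega>) m \<and>
     (\<forall>t \<in> {0..1}. vm_absolutely_continuous (\<pi> t) (m t)) \<and>
     (\<exists>r > 1. (\<integral>\<^sup>+t\<in>{0..1}.
        (\<integral>\<^sup>+x. ennreal (norm (vm_RN_deriv (\<pi> t) (m t) x) powr r) \<partial>\<pi> t) \<partial>lborel) < \<infinity>) \<and>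
     continuity_equation (power_set \<Omega>) \<pi> m \<and>
     \<pi> 0 = p \<and>
     (\<forall>l. marginal \<Omega> l (\<pi> 1) = \<mu> l)}"

text \<open>
  The cost may be \<open>+\<infinity>\<close>, as \<open>L\<close> can grow faster than the power \<open>r\<close> above, so it is extended-real valued:
  the integral of the positive part minus that of the negative part (\<open>ennreal\<close> truncates negative
  numbers to \<open>0\<close>). For \<open>(\<pi>, m)\<close> in \<open>flows\<close> and convex \<open>L\<close> the subtrahend is finite, since \<open>L\<close> has an
  affine lower bound.
\<close>

definition dynamical_cost ::
    "('a::euclidean_space \<Rightarrow> real) \<Rightarrow> (real \<Rightarrow> 'a measure) \<times> (real \<Rightarrow> 'a set \<Rightarrow> 'a) \<Rightarrow> ereal" where
  "dynamical_cost L = (\<lambda>(\<pi>, m).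
     enn2ereal (\<integral>\<^sup>+t\<in>{0..1}.
        (\<integral>\<^sup>+x. ennreal (L (vm_RN_deriv (\<pi> t) (m t) x)) \<partial>\<pi> t) \<partial>lborel) -
     enn2ereal (\<integral>\<^sup>+t\<in>{0..1}.
        (\<integral>\<^sup>+x. ennreal (- L (vm_RN_deriv (\<pi> t) (m t) x)) \<partial>\<pi> t) \<partial>lborel))"

end

theory Submission
  imports Defs
begin

text \<open>
  In all three cases \<open>L\<close> is convex and for \<open>p\<close>-almost every \<open>x\<^sub>0\<close> one has \<open>L (c x\<^sub>0) = L 0\<close> for all \<open>c\<close>
  and \<open>L (x - x\<^sub>0) = L x\<close> on \<open>\<Omega>\<^sup>k\<close>; nothing else about \<open>p\<close> matters.

  The dynamical cost dominates the static cost of the final marginal: if \<open>G\<close> is \<open>C\<^sup>1\<close> with all tangents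
  below \<open>L\<close>, then \<open>\<eta>(t, x) = (t + \<epsilon>) G(x / (t + \<epsilon>))\<close> satisfies
  \<open>\<partial>\<^sub>t\<eta> + \<nabla>\<eta> \<bullet> v \<le> L v\<close> for every \<open>v\<close>, so the continuity equation bounds the cost below by
  \<open>\<integral> \<eta>(1, x) d\<pi>\<^sub>1 - \<integral> \<eta>(0, x) dp\<close>. Let \<open>G\<close> increase to \<open>L\<close> and \<open>\<epsilon>\<close> tend to 0. No representation of
  the flow by random curves is needed.

  Conversely, a coupling \<open>\<gamma>\<close> is reached from \<open>p\<close> by the displacement interpolation of the product
  \<open>p \<otimes> \<gamma>\<close>. Its velocity at time \<open>t\<close> is the conditional expectation of \<open>x - x\<^sub>0\<close> given the position, so by
  Jensen the cost is at most \<open>\<integral> L (x - x\<^sub>0) = \<integral> L d\<gamma>\<close>. A static minimizer exists by weak compactness.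
\<close>

section \<open>Integrals of non-measurable functions and vector-valued Radon--Nikodym derivatives\<close>

text \<open>The dual potential behind the lower bound is \<open>t L(x / t)\<close>, the Hopf--Lax
  solution started at the origin. It is not an admissible test function: the continuity equation
  only accepts functions that are continuously differentiable up to time 0, and \<open>L\<close> may
  have kinks. This is why both \<open>G\<close> and \<open>\<epsilon>\<close> are there. At time 0 a
  term bounded by \<open>\<epsilon> L(x / \<epsilon>)\<close> is left over. In general this tends to
  the recession function of \<open>L\<close>, not to 0; constancy of \<open>L\<close> on the lines
  through 0 and \<open>p\<close>-almost every point is what removes it.

  The other obstacle is measurability. The density of \<open>m t\<close> is picked separately at
  each time, so the inner integrals of the cost may be non-measurable in \<open>t\<close>, and lower
  integrals are not additive. Estimates are therefore kept in the shape
  \<open>P + f\<^sup>+ \<le> Q + f\<^sup>-\<close> with \<open>f\<close> integrable. That shape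
  survives a lower integral, so it can be integrated first in space and then in time, and it
  tolerates infinite costs. Only the flux term needs true measurability in time, which comes from
  the values of \<open>m\<close> on sets.\<close>

text \<open>
  The integral of a non-measurable function is its lower integral. This makes the joint measurability
  in \<open>(t, x)\<close> of the densities \<open>dm(t, x) / d\<pi>(t, x)\<close> irrelevant.
\<close>

lemma nn_integral_add_mono_nonmeasurable:
  fixes F G u w :: "'a \<Rightarrow> ennreal"
  assumes u: "u \<in> borel_measurable M" and w: "w \<in> borel_measurable M"
    and fin: "\<And>x. x \<in> space M \<Longrightarrow> w x < \<infinity>"
    and le: "\<And>x. x \<in> space M \<Longrightarrow> F x + u x \<le> G x + w x"
  shows "(\<integral>\<^sup>+x. F x \<partial>M) + (\<integral>\<^sup>+x. u x \<partial>M) \<le> (\<integral>\<^sup>+x. G x \<partial>M) + (\<integral>\<^sup>+x. w x \<partial>M)"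
proof -
  let ?S = "{g. simple_function M g \<and> g \<le> F}"
  have ne: "?S \<noteq> {}"
    by (auto intro!: exI[of _ "\<lambda>_. 0"] simp: le_fun_def)
  have step: "integral\<^sup>S M s + (\<integral>\<^sup>+x. u x \<partial>M) \<le> (\<integral>\<^sup>+x. G x \<partial>M) + (\<integral>\<^sup>+x. w x \<partial>M)" if "s \<in> ?S" for s
  proof -
    have s: "simple_function M s" "\<And>x. s x \<le> F x"
      using that by (auto simp: le_fun_def)
    have [measurable]: "s \<in> borel_measurable M" "u \<in> borel_measurable M" "w \<in> borel_measurable M"
      using s(1) u w borel_measurable_simple_function by auto
    have le1: "s x + u x \<le> w x + G x" if "x \<in> space M" for x
      using order_trans[OF add_right_mono[OF s(2)[of x], of "u x"] le[OF that]] by (simp add: add.commute)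
    have "integral\<^sup>S M s + (\<integral>\<^sup>+x. u x \<partial>M) = (\<integral>\<^sup>+x. s x + u x \<partial>M)"
      using s(1) by (simp add: nn_integral_add nn_integral_eq_simple_integral)
    \<comment> \<open>The truncated difference \<open>s + u - w\<close> is measurable and lies below
      \<open>G\<close>, so its integral bounds the lower integral of \<open>G\<close> from below.
      Additivity is only used among measurable functions.\<close>
    also have "\<dots> \<le> (\<integral>\<^sup>+x. (s x + u x - w x) + w x \<partial>M)"
      by (intro nn_integral_mono) (metis ennreal_minus_le_iff order_refl add.commute)
    also have "\<dots> = (\<integral>\<^sup>+x. (s x + u x - w x) \<partial>M) + (\<integral>\<^sup>+x. w x \<partial>M)"
      by (intro nn_integral_add) auto
    also have "\<dots> \<le> (\<integral>\<^sup>+x. G x \<partial>M) + (\<integral>\<^sup>+x. w x \<partial>M)"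
      using fin le1 by (intro add_right_mono nn_integral_mono) (fastforce simp: ennreal_minus_le_iff)
    finally show ?thesis .
  qed
  have "(\<integral>\<^sup>+x. F x \<partial>M) + (\<integral>\<^sup>+x. u x \<partial>M) = (SUP s\<in>?S. integral\<^sup>S M s + (\<integral>\<^sup>+x. u x \<partial>M))"
    unfolding nn_integral_def[of M F] using ne by (rule ennreal_SUP_add_left[symmetric])
  also have "\<dots> \<le> (\<integral>\<^sup>+x. G x \<partial>M) + (\<integral>\<^sup>+x. w x \<partial>M)"
    by (rule SUP_least) (rule step)
  finally show ?thesis .
qed

section \<open>Positive variation and Radon--Nikodym densities of vector measures\<close>

lemma vector_measure_empty:
  assumes "vector_measure M m"
  shows "m {} = 0"
proof -
  have "(\<lambda>i::nat. m {}) sums m (\<Union>i::nat. {})"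
    using assms[unfolded vector_measure_def, rule_format, of "\<lambda>_. {}"] by (simp add: disjoint_family_on_def)
  then have "(\<lambda>i::nat. m {}) \<longlonglongrightarrow> 0"
    using summable_LIMSEQ_zero sums_summable by blast
  then show ?thesis by (simp add: LIMSEQ_const_iff)
qed

lemma vector_measure_Un:
  assumes m: "vector_measure M m" and "A \<in> sets M" "B \<in> sets M" "A \<inter> B = {}"
  shows "m (A \<union> B) = m A + m B"
proof -
  have "(\<lambda>i. m (binaryset A B i)) sums m (\<Union>i. binaryset A B i)"
    using m unfolding vector_measure_def
    by (rule allE[of _ "binaryset A B"])
       (use assms in \<open>auto simp: disjoint_family_on_def binaryset_def range_binaryset_eq split: if_splits\<close>)
  moreover have "(\<lambda>i. m (binaryset A B i)) sums (m A + m B)"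
    by (rule binaryset_sums) (rule vector_measure_empty[OF m])
  ultimately show ?thesis
    by (simp add: UN_binaryset_eq sums_unique2)
qed

lemma vector_measure_Diff:
  assumes m: "vector_measure M m" and "A \<in> sets M" "B \<in> sets M" "B \<subseteq> A"
  shows "m (A - B) = m A - m B"
  using vector_measure_Un[OF m, of B "A - B"] assms by (simp add: Un_absorb1)

text \<open>The terms may be negative, and \<open>ennreal\<close> truncates them to 0, which only
  enlarges the partial sums; hence an inequality.\<close>

lemma ennreal_sums_le:
  assumes "f sums s"
  shows "ennreal s \<le> (\<Sum>i. ennreal (f i))"
proof (rule LIMSEQ_le_const2)
  show "(\<lambda>n. ennreal (\<Sum>i<n. f i)) \<longlonglongrightarrow> ennreal s"
    using assms by (intro tendsto_ennrealI) (simp add: sums_def)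
  have "ennreal (\<Sum>i<n. f i) \<le> (\<Sum>i. ennreal (f i))" for n
  proof -
    have "ennreal (\<Sum>i<n. f i) \<le> ennreal (\<Sum>i<n. max 0 (f i))"
      by (intro ennreal_leI sum_mono) auto
    also have "\<dots> = (\<Sum>i<n. ennreal (max 0 (f i)))"
      by (subst sum_ennreal) auto
    also have "\<dots> = (\<Sum>i<n. ennreal (f i))"
      by (intro sum.cong) (auto simp: max_def ennreal_neg not_le)
    also have "\<dots> \<le> (\<Sum>i. ennreal (f i))"
      by (rule sum_le_suminf) auto
    finally show ?thesis .
  qed
  then show "\<exists>N. \<forall>n\<ge>N. ennreal (\<Sum>i<n. f i) \<le> (\<Sum>i. ennreal (f i))" by auto
qed

text \<open>The positive part of the Jordan decomposition, obtained as a supremum instead of from a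
  Hahn set. For a vector measure the truncation by \<open>ennreal\<close> changes nothing, since the
  empty subset already contributes 0.\<close>

definition positive_variation :: "'a measure \<Rightarrow> ('a set \<Rightarrow> real) \<Rightarrow> 'a set \<Rightarrow> ennreal" where
  "positive_variation M m A = (SUP B\<in>{B \<in> sets M. B \<subseteq> A}. ennreal (m B))"

lemma positive_variation_mono:
  "A \<subseteq> B \<Longrightarrow> positive_variation M m A \<le> positive_variation M m B"
  unfolding positive_variation_def by (rule SUP_subset_mono) auto

lemma positive_variation_superadditive:
  assumes m: "vector_measure M m" and disj: "A \<inter> A' = {}"
  shows "positive_variation M m A + positive_variation M m A' \<le> positive_variation M m (A \<union> A')"
proof -
  let ?P = "positive_variation M m"
  have upper: "ennreal (m D) \<le> ?P (A \<union> A')" if "D \<in> sets M" "D \<subseteq> A \<union> A'" for D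
    unfolding positive_variation_def using that by (intro SUP_upper) auto
  have le: "ennreal (m B) + ennreal (m C) \<le> ?P (A \<union> A')"
    if B: "B \<in> sets M" "B \<subseteq> A" and C: "C \<in> sets M" "C \<subseteq> A'" for B C
  proof -
    \<comment> \<open>Because of the truncation, the values add up only when both are nonnegative; a
      piece of negative measure is dropped, and the other one alone is a competitor.\<close>
    consider "m B < 0" | "m C < 0" | "0 \<le> m B" "0 \<le> m C" by linarith
    then show ?thesis
    proof cases
      case 1 then show ?thesis using upper[of C] C by (auto simp: ennreal_neg)
    next
      case 2 then show ?thesis using upper[of B] B by (auto simp: ennreal_neg)
    next
      case 3
      have "m (B \<union> C) = m B + m C"
        using B C disj by (intro vector_measure_Un[OF m]) auto
      then show ?thesis
        using upper[of "B \<union> C"] B C 3 by (simp add: ennreal_plus[symmetric] le_supI1 le_supI2 del: ennreal_plus)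
    qed
  qed
  have ne: "{B \<in> sets M. B \<subseteq> A} \<noteq> {}" "{B \<in> sets M. B \<subseteq> A'} \<noteq> {}" by auto
  have "?P A + ?P A' = (SUP B\<in>{B \<in> sets M. B \<subseteq> A}. ennreal (m B) + ?P A')"
    unfolding positive_variation_def by (rule ennreal_SUP_add_left[OF ne(1), symmetric])
  also have "\<dots> \<le> ?P (A \<union> A')"
  proof (rule SUP_least)
    fix B assume B: "B \<in> {B \<in> sets M. B \<subseteq> A}"
    have "ennreal (m B) + ?P A' = (SUP C\<in>{C \<in> sets M. C \<subseteq> A'}. ennreal (m B) + ennreal (m C))"
      unfolding positive_variation_def by (subst ennreal_SUP_add_right) auto
    also have "\<dots> \<le> ?P (A \<union> A')"
      using B by (intro SUP_least le) auto
    finally show "ennreal (m B) + ?P A' \<le> ?P (A \<union> A')" .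
  qed
  finally show ?thesis .
qed

lemma countably_additive_positive_variation:
  assumes m: "vector_measure M m"
  shows "countably_additive (sets M) (positive_variation M m)"
  unfolding countably_additive_def
proof (intro allI impI antisym)
  fix A :: "nat \<Rightarrow> 'a set"
  assume A: "range A \<subseteq> sets M" "disjoint_family A"
  let ?P = "positive_variation M m"
  show "(\<Sum>i. ?P (A i)) \<le> ?P (\<Union>i. A i)"
  proof (rule suminf_le_const)
    fix n
    have "(\<Sum>i<n. ?P (A i)) \<le> ?P (\<Union>i<n. A i)"
    proof (induction n)
      case (Suc n)
      have "(\<Union>i<n. A i) \<inter> A n = {}"
        using A(2)[unfolded disjoint_family_on_def] by (metis (no_types, lifting) UNIV_I UN_extend_simps(4) less_irrefl SUP_bot_conv(2) lessThan_iff)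
      from positive_variation_superadditive[OF m this] Suc
      have "(\<Sum>i<n. ?P (A i)) + ?P (A n) \<le> ?P ((\<Union>i<n. A i) \<union> A n)"
        by (meson add_right_mono order_trans)
      then show ?case by (simp add: lessThan_Suc Un_commute add.commute)
    qed simp
    also have "\<dots> \<le> ?P (\<Union>i. A i)"
      by (intro positive_variation_mono) auto
    finally show "(\<Sum>i<n. ?P (A i)) \<le> ?P (\<Union>i. A i)" .
  qed auto
  show "?P (\<Union>i. A i) \<le> (\<Sum>i. ?P (A i))"
    unfolding positive_variation_def[of M m "\<Union>i. A i"]
  proof (rule SUP_least)
    fix B assume "B \<in> {B \<in> sets M. B \<subseteq> (\<Union>i. A i)}"
    then have B: "B \<in> sets M" "B \<subseteq> (\<Union>i. A i)" by auto
    have "(\<lambda>i. m (B \<inter> A i)) sums m (\<Union>i. B \<inter> A i)"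
      using m unfolding vector_measure_def
      by (rule allE[of _ "\<lambda>i. B \<inter> A i"]) (use A B in \<open>auto simp: disjoint_family_on_def image_subset_iff\<close>)
    moreover have "(\<Union>i. B \<inter> A i) = B" using B by auto
    ultimately have "ennreal (m B) \<le> (\<Sum>i. ennreal (m (B \<inter> A i)))"
      by (intro ennreal_sums_le) simp
    also have "\<dots> \<le> (\<Sum>i. ?P (A i))"
      using A B unfolding positive_variation_def
      by (intro suminf_le SUP_upper) (auto simp: image_subset_iff)
    finally show "ennreal (m B) \<le> (\<Sum>i. ?P (A i))" .
  qed
qed

lemma emeasure_positive_variation:
  assumes m: "vector_measure M m" and A: "A \<in> sets M"
  shows "emeasure (measure_of (space M) (sets M) (positive_variation M m)) A = positive_variation M m A"
proof (rule emeasure_measure_of_sigma)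
  show "sigma_algebra (space M) (sets M)" ..
  show "positive (sets M) (positive_variation M m)"
    by (auto simp: positive_def positive_variation_def vector_measure_empty[OF m])
qed (use assms countably_additive_positive_variation in auto)

lemma positive_variation_split:
  assumes m: "vector_measure M m" and A: "A \<in> sets M" "B \<in> sets M" "B \<subseteq> A"
  shows "positive_variation M m A = positive_variation M m B + positive_variation M m (A - B)"
proof -
  let ?N = "measure_of (space M) (sets M) (positive_variation M m)"
  have "emeasure ?N B + emeasure ?N (A - B) = emeasure ?N (B \<union> (A - B))"
    using A by (intro plus_emeasure) auto
  moreover have "B \<union> (A - B) = A" using A by auto
  ultimately show ?thesis using A by (simp add: emeasure_positive_variation[OF m])
qed

text \<open>
  If the positive variation were infinite, each set of infinite variation would split into two pieces
  of measure at least 1 in absolute value, one of them again of infinite variation; the pieces left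
  over would be disjoint.
\<close>

lemma positive_variation_finite:
  assumes m: "vector_measure M m"
  shows "positive_variation M m (space M) < \<infinity>"
proof (rule ccontr)
  let ?P = "positive_variation M m"
  assume "\<not> ?P (space M) < \<infinity>"
  then have top: "?P (space M) = \<infinity>" by (simp add: less_top[symmetric])
  have "\<exists>X. (X 0 \<in> sets M \<and> ?P (X 0) = \<infinity>) \<and>
     (\<forall>n::nat. (X (Suc n) \<in> sets M \<and> ?P (X (Suc n)) = \<infinity>) \<and> (X (Suc n) \<subseteq> X n \<and> 1 \<le> \<bar>m (X n - X (Suc n))\<bar>))"
  proof -
    have "\<exists>X. \<forall>n::nat. (X n \<in> sets M \<and> ?P (X n) = \<infinity>) \<and> (X (Suc n) \<subseteq> X n \<and> 1 \<le> \<bar>m (X n - X (Suc n))\<bar>)"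
    proof (rule dependent_nat_choice)
      show "\<exists>x. x \<in> sets M \<and> ?P x = \<infinity>" using top by auto
      fix X and n :: nat assume X: "X \<in> sets M \<and> ?P X = \<infinity>"
      \<comment> \<open>The margin \<open>\<bar>m X\<bar> + 1\<close> makes both \<open>m B\<close>
        and \<open>m X - m B\<close> at least 1 in absolute value, so whichever piece has infinite
        variation can be kept and the other one discarded.\<close>
      then have "ennreal (\<bar>m X\<bar> + 1) < ?P X" by simp
      then obtain B where B: "B \<in> sets M" "B \<subseteq> X" "ennreal (\<bar>m X\<bar> + 1) < ennreal (m B)"
        unfolding positive_variation_def less_SUP_iff by blast
      have big: "\<bar>m X\<bar> + 1 < m B"
        using B(3) by (subst (asm) ennreal_less_iff) auto
      have diff: "m (X - B) = m X - m B"
        using X B by (intro vector_measure_Diff[OF m]) auto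
      have "X - (X - B) = B" using B by auto
      have "?P B = \<infinity> \<or> ?P (X - B) = \<infinity>"
        using positive_variation_split[OF m _ B(1,2)] X by (metis ennreal_add_eq_top infinity_ennreal_def)
      then show "\<exists>Y. (Y \<in> sets M \<and> ?P Y = \<infinity>) \<and> Y \<subseteq> X \<and> 1 \<le> \<bar>m (X - Y)\<bar>"
      proof
        assume "?P B = \<infinity>"
        moreover have "1 \<le> \<bar>m (X - B)\<bar>" using big diff by linarith
        ultimately show ?thesis using B by blast
      next
        assume "?P (X - B) = \<infinity>"
        moreover have "1 \<le> \<bar>m (X - (X - B))\<bar>"
          using big \<open>X - (X - B) = B\<close> by simp
        ultimately show ?thesis using X B by (intro exI[of _ "X - B"]) auto
      qed
    qed
    then show ?thesis by blast
  qed
  then obtain X :: "nat \<Rightarrow> 'a set" where X: "\<And>n. X n \<in> sets M" "\<And>n. X (Suc n) \<subseteq> X n"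
      "\<And>n. 1 \<le> \<bar>m (X n - X (Suc n))\<bar>"
    by (metis not0_implies_Suc)
  define D where "D n = X n - X (Suc n)" for n
  have anti: "X j \<subseteq> X i" if "i \<le> j" for i j
    using X(2) that by (rule lift_Suc_antimono_le)
  have "D i \<inter> D j = {}" if "i < j" for i j
    using anti[of "Suc i" j] that by (auto simp: D_def)
  then have disj: "disjoint_family D"
    unfolding disjoint_family_on_def by (metis Int_commute linorder_neq_iff)
  \<comment> \<open>Countable additivity makes the series over the discarded pieces converge,
    although no term is smaller than 1 in absolute value.\<close>
  have "(\<lambda>n. m (D n)) sums m (\<Union>n. D n)"
    using m disj X(1) unfolding vector_measure_def by (auto simp: D_def[abs_def] image_subset_iff)
  then have "(\<lambda>n. m (D n)) \<longlonglongrightarrow> 0"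
    using summable_LIMSEQ_zero sums_summable by blast
  then obtain n where "\<bar>m (D n)\<bar> < 1"
    by (metis LIMSEQ_D diff_zero order_refl real_norm_def zero_less_one)
  with X(3)[of n] show False by (simp add: D_def)
qed

lemma real_Radon_Nikodym_finite:
  assumes "finite_measure M" "finite_measure N" "sets N = sets M"
    and ac: "absolutely_continuous M N"
  shows "\<exists>f :: 'a \<Rightarrow> real. integrable M f \<and> (\<forall>A\<in>sets M. measure N A = (LINT x:A|M. f x))"
proof -
  interpret M: finite_measure M by fact
  interpret N: finite_measure N by fact
  obtain D where D: "D \<in> borel_measurable M" "AE x in M. RN_deriv M N x = ennreal (D x)" "\<And>x. 0 \<le> D x"
    using M.real_RN_deriv[OF assms(2) ac assms(3)] by metis
  note [measurable] = D(1)
  have em: "emeasure N A = (\<integral>\<^sup>+x. ennreal (indicator A x * D x) \<partial>M)" if A: "A \<in> sets M" for A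
  proof -
    have "emeasure N A = emeasure (density M (RN_deriv M N)) A"
      by (subst M.density_RN_deriv[OF ac assms(3)]) simp
    also have "\<dots> = (\<integral>\<^sup>+x. RN_deriv M N x * indicator A x \<partial>M)"
      using A by (simp add: emeasure_density)
    also have "\<dots> = (\<integral>\<^sup>+x. ennreal (indicator A x * D x) \<partial>M)"
      using D(2) by (intro nn_integral_cong_AE) (auto split: split_indicator)
    finally show ?thesis .
  qed
  have int: "integrable M D"
  proof (rule integrableI_bounded)
    have "(\<integral>\<^sup>+x. ennreal (norm (D x)) \<partial>M) = emeasure N (space M)"
      using D(3) by (subst em) (auto intro!: nn_integral_cong)
    then show "(\<integral>\<^sup>+x. ennreal (norm (D x)) \<partial>M) < \<infinity>"
      using N.emeasure_finite[of "space M"] by (simp add: less_top[symmetric])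
  qed (rule D(1))
  have "measure N A = (LINT x:A|M. D x)" if A: "A \<in> sets M" for A
    unfolding set_lebesgue_integral_def measure_def em[OF A]
    using A D(3) by (subst integral_eq_nn_integral) auto
  with int show ?thesis by blast
qed

text \<open>Both the positive variation \<open>N\<close> and \<open>N - m\<close> are finite
  measures. They vanish on null sets of \<open>M\<close>, as every measurable subset of a null set
  is null; the density of \<open>m\<close> is the difference of theirs.\<close>

lemma signed_Radon_Nikodym:
  fixes m :: "'a set \<Rightarrow> real"
  assumes fin: "finite_measure M" and m: "vector_measure M m"
    and ac: "vm_absolutely_continuous M m"
  shows "\<exists>f. integrable M f \<and> (\<forall>A\<in>sets M. m A = (LINT x:A|M. f x))"
proof -
  define N where "N = measure_of (space M) (sets M) (positive_variation M m)"
  have sets_N: "sets N = sets M" by (simp add: N_def)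
  have space_N: "space N = space M" by (simp add: N_def)
  have em_N: "emeasure N A = positive_variation M m A" if "A \<in> sets M" for A
    unfolding N_def by (rule emeasure_positive_variation[OF m that])
  have fin_N: "finite_measure N"
    using positive_variation_finite[OF m] by (intro finite_measureI) (simp add: space_N em_N less_top)
  interpret N: finite_measure N by fact
  have "vector_measure N m"
    using m by (simp add: vector_measure_def sets_N)
  have le: "m A \<le> measure N A" if "A \<in> sets M" for A
  proof -
    have "ennreal (m A) \<le> emeasure N A"
      unfolding em_N[OF that] positive_variation_def using that by (intro SUP_upper) auto
    then show ?thesis
      by (simp add: N.emeasure_eq_measure ennreal_le_iff)
  qed
  have null: "B \<in> null_sets M" if "A \<in> null_sets M" "B \<in> sets M" "B \<subseteq> A" for A B
    using that null_sets_subset by blast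
  have ac_N: "absolutely_continuous M N"
    unfolding absolutely_continuous_def
  proof
    fix A assume A: "A \<in> null_sets M"
    have "m B = 0" if "B \<in> sets M" "B \<subseteq> A" for B
      using ac null[OF A that] by (auto simp: vm_absolutely_continuous_def)
    then have "positive_variation M m A = 0"
      unfolding positive_variation_def by (intro antisym SUP_least) auto
    then show "A \<in> null_sets N" using A by (auto simp: null_sets_def sets_N em_N)
  qed
  \<comment> \<open>The negative variation. Taken as a difference, it inherits countable additivity
    from \<open>N\<close> and \<open>m\<close>, and it is nonnegative because \<open>m A\<close> is
    a competitor in the supremum defining \<open>N A\<close>.\<close>
  define N' where "N' = measure_of (space M) (sets M) (\<lambda>A. ennreal (measure N A - m A))"
  have em_N': "emeasure N' A = ennreal (measure N A - m A)" if A: "A \<in> sets M" for A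
    unfolding N'_def
  proof (rule emeasure_measure_of_sigma)
    show "sigma_algebra (space M) (sets M)" ..
    show "positive (sets M) (\<lambda>A. ennreal (measure N A - m A))"
      by (auto simp: positive_def vector_measure_empty[OF m])
    show "countably_additive (sets M) (\<lambda>A. ennreal (measure N A - m A))"
      unfolding countably_additive_def
    proof (intro allI impI)
      fix A :: "nat \<Rightarrow> 'a set"
      assume A: "range A \<subseteq> sets M" "disjoint_family A"
      have "(\<lambda>i. measure N (A i)) sums measure N (\<Union>i. A i)"
        using A by (intro N.finite_measure_UNION) (auto simp: sets_N)
      moreover have "(\<lambda>i. m (A i)) sums m (\<Union>i. A i)"
        using m A by (auto simp: vector_measure_def)
      ultimately have "(\<lambda>i. measure N (A i) - m (A i)) sums (measure N (\<Union>i. A i) - m (\<Union>i. A i))"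
        by (rule sums_diff)
      then show "(\<Sum>i. ennreal (measure N (A i) - m (A i))) = ennreal (measure N (\<Union>i. A i) - m (\<Union>i. A i))"
        using le A by (intro suminf_ennreal_eq) (auto simp: image_subset_iff)
    qed
  qed (rule A)
  have sets_N': "sets N' = sets M" by (simp add: N'_def)
  have fin_N': "finite_measure N'"
    by (intro finite_measureI) (simp add: em_N' sets_eq_imp_space_eq[OF sets_N'])
  have ac_N': "absolutely_continuous M N'"
    unfolding absolutely_continuous_def
  proof
    fix A assume A: "A \<in> null_sets M"
    then have "A \<in> null_sets N" using ac_N by (auto simp: absolutely_continuous_def)
    then have "measure N A = 0" by (simp add: measure_eq_emeasure_eq_ennreal null_sets_def measure_def)
    moreover have "m A = 0" using ac A by (auto simp: vm_absolutely_continuous_def)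
    ultimately show "A \<in> null_sets N'" using A by (auto simp: null_sets_def sets_N' em_N')
  qed
  obtain f where f: "integrable M f" "\<And>A. A \<in> sets M \<Longrightarrow> measure N A = (LINT x:A|M. f x)"
    using real_Radon_Nikodym_finite[OF fin fin_N sets_N ac_N] by blast
  obtain f' where f': "integrable M f'" "\<And>A. A \<in> sets M \<Longrightarrow> measure N' A = (LINT x:A|M. f' x)"
    using real_Radon_Nikodym_finite[OF fin fin_N' sets_N' ac_N'] by blast
  have "m A = (LINT x:A|M. f x - f' x)" if A: "A \<in> sets M" for A
  proof -
    have "measure N' A = measure N A - m A"
      using le[OF A] em_N'[OF A] by (simp add: measure_def)
    moreover have "(LINT x:A|M. f x - f' x) = (LINT x:A|M. f x) - (LINT x:A|M. f' x)"
      using integrable_mult_indicator[OF A f(1)] integrable_mult_indicator[OF A f'(1)]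
      by (intro set_integral_diff) (simp_all add: set_integrable_def)
    ultimately show ?thesis using f(2)[OF A] f'(2)[OF A] by simp
  qed
  moreover have "integrable M (\<lambda>x. f x - f' x)"
    using f(1) f'(1) by (rule Bochner_Integration.integrable_diff)
  ultimately show ?thesis by blast
qed

lemma vector_Radon_Nikodym:
  fixes m :: "'a set \<Rightarrow> 'v::euclidean_space"
  assumes fin: "finite_measure M" and m: "vector_measure M m"
    and ac: "vm_absolutely_continuous M m"
  shows "\<exists>f. integrable M f \<and> (\<forall>A\<in>sets M. m A = (LINT x:A|M. f x))"
proof -
  have "\<forall>b. \<exists>f. integrable M f \<and> (\<forall>A\<in>sets M. m A \<bullet> b = (LINT x:A|M. f x))"
  proof
    fix b :: 'v
    show "\<exists>f. integrable M f \<and> (\<forall>A\<in>sets M. m A \<bullet> b = (LINT x:A|M. f x))"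
    proof (rule signed_Radon_Nikodym[OF fin])
      show "vector_measure M (\<lambda>A. m A \<bullet> b)"
        using m by (auto simp: vector_measure_def intro: bounded_linear.sums[OF bounded_linear_inner_left])
      show "vm_absolutely_continuous M (\<lambda>A. m A \<bullet> b)"
        using ac by (auto simp: vm_absolutely_continuous_def)
    qed
  qed
  then obtain f where f: "\<And>b. integrable M (f b)"
      "\<And>b A. A \<in> sets M \<Longrightarrow> m A \<bullet> b = (LINT x:A|M. f b x)"
    by metis
  define g where "g x = (\<Sum>b\<in>Basis. f b x *\<^sub>R b)" for x
  have int: "integrable M g"
    unfolding g_def using f(1) by (intro Bochner_Integration.integrable_sum integrable_scaleR_left) auto
  have "m A = (LINT x:A|M. g x)" if A: "A \<in> sets M" for A
  proof (rule euclidean_eqI)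
    fix b :: 'v assume b: "b \<in> Basis"
    have "(LINT x:A|M. g x) \<bullet> b = (LINT x:A|M. g x \<bullet> b)"
      unfolding set_lebesgue_integral_def using integrable_mult_indicator[OF A int]
      by (subst integral_inner_left[symmetric]) auto
    also have "\<dots> = (LINT x:A|M. f b x)"
      using b by (simp add: g_def inner_sum_left inner_Basis if_distrib cong: if_cong)
    finally show "m A \<bullet> b = (LINT x:A|M. g x) \<bullet> b" using f(2)[OF A] by simp
  qed
  with int show ?thesis by blast
qed

text \<open>These two facts are all that is ever used about the density chosen by
  \<open>SOME\<close>. They say nothing about how densities at different times are related.\<close>

lemma vm_RN_deriv:
  assumes "finite_measure M" "vector_measure M m" "vm_absolutely_continuous M m"
  shows integrable_vm_RN_deriv: "integrable M (vm_RN_deriv M m)"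
    and set_integral_vm_RN_deriv: "A \<in> sets M \<Longrightarrow> (LINT x:A|M. vm_RN_deriv M m x) = m A"
proof -
  have "integrable M (vm_RN_deriv M m) \<and> (\<forall>A\<in>sets M. m A = (LINT x:A|M. vm_RN_deriv M m x))"
    unfolding vm_RN_deriv_def by (rule someI_ex[OF vector_Radon_Nikodym[OF assms]])
  then show "integrable M (vm_RN_deriv M m)"
    and "A \<in> sets M \<Longrightarrow> (LINT x:A|M. vm_RN_deriv M m x) = m A" by auto
qed

section \<open>Integrals against vector measures as limits of sums over sets\<close>

lemma bounded_simple_approx:
  fixes g :: "'b \<Rightarrow> 'v::euclidean_space"
  assumes g: "g \<in> borel_measurable M" and bd: "\<And>x. x \<in> space M \<Longrightarrow> norm (g x) \<le> C"
  obtains s where "\<And>n :: nat. simple_function M (s n)" "\<And>x. x \<in> space M \<Longrightarrow> (\<lambda>n. s n x) \<longlonglongrightarrow> g x"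
    "\<And>n x. x \<in> space M \<Longrightarrow> norm (s n x) \<le> 2 * C"
proof -
  obtain s where s: "\<And>i. simple_function M (s i)" "\<And>x. x \<in> space M \<Longrightarrow> (\<lambda>i. s i x) \<longlonglongrightarrow> g x"
      "\<And>i x. x \<in> space M \<Longrightarrow> norm (s i x) \<le> 2 * norm (g x)"
    using borel_measurable_implies_sequence_metric[OF g, of 0] by (simp only: dist_0_norm dist_norm diff_zero) blast
  show ?thesis
  proof (rule that[OF s(1,2)])
    show "norm (s n x) \<le> 2 * C" if "x \<in> space M" for n x
      using s(3)[OF that, of n] bd[OF that] by linarith
  qed
qed

text \<open>
  The left-hand side depends on \<open>f\<close> only through the vector measure \<open>A \<mapsto> \<integral> f\<close> over \<open>T -` A\<close>, and
  the approximants \<open>s\<close> depend on \<open>g\<close> alone; so integrals of \<open>g\<close> against two vector measures, or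
  against a family of them, can be compared through their values on sets.
\<close>

lemma integral_simple_approx_tendsto:
  fixes s :: "nat \<Rightarrow> 'b \<Rightarrow> 'v::euclidean_space"
  assumes s: "\<And>n. simple_function M (s n)" and lim: "\<And>x. x \<in> space M \<Longrightarrow> (\<lambda>n. s n x) \<longlonglongrightarrow> g x"
    and bd: "\<And>n x. x \<in> space M \<Longrightarrow> norm (s n x) \<le> C"
    and T[measurable]: "T \<in> measurable N M" and f: "integrable N f"
  shows "(\<lambda>n. \<Sum>c\<in>s n ` space M. c \<bullet> (LINT w:T -` (s n -` {c} \<inter> space M) \<inter> space N|N. f w))
    \<longlonglongrightarrow> (\<integral>w. g (T w) \<bullet> f w \<partial>N)"
proof -
  define S where "S n = s n ` space M" for n
  define B where "B n c = s n -` {c} \<inter> space M" for n c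
  have fin: "finite (S n)" for n
    using s[of n] by (simp add: S_def simple_function_def)
  have B: "B n c \<in> sets M" for n c
    unfolding B_def using s[of n] by (rule simple_functionD)
  have sm[measurable]: "s n \<in> borel_measurable M" for n
    using s borel_measurable_simple_function by auto
  have g: "g \<in> borel_measurable M"
    by (rule borel_measurable_LIMSEQ_metric[OF sm lim])
  have [measurable]: "f \<in> borel_measurable N" using f by auto
  have sp: "T w \<in> space M" if "w \<in> space N" for w
    using measurable_space[OF T that] .
  have eq: "s n (T w) \<bullet> f w = (\<Sum>c\<in>S n. c \<bullet> (indicator (T -` B n c \<inter> space N) w *\<^sub>R f w))"
    if w: "w \<in> space N" for n w
  proof -
    have "(\<Sum>c\<in>S n. c \<bullet> (indicator (T -` B n c \<inter> space N) w *\<^sub>R f w))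
        = (\<Sum>c\<in>S n. if c = s n (T w) then c \<bullet> f w else 0)"
      using w sp by (intro sum.cong) (auto simp: B_def split: split_indicator)
    also have "\<dots> = s n (T w) \<bullet> f w"
      using fin[of n] sp[OF w] by (simp add: S_def)
    finally show ?thesis by simp
  qed
  have "(\<integral>w. s n (T w) \<bullet> f w \<partial>N) = (\<Sum>c\<in>S n. c \<bullet> (LINT w:T -` B n c \<inter> space N|N. f w))" for n
  proof -
    have i: "integrable N (\<lambda>w. indicator (T -` B n c \<inter> space N) w *\<^sub>R f w)" for c
      using measurable_sets[OF T B] f by (rule integrable_mult_indicator)
    have "(\<integral>w. s n (T w) \<bullet> f w \<partial>N) = (\<integral>w. (\<Sum>c\<in>S n. c \<bullet> (indicator (T -` B n c \<inter> space N) w *\<^sub>R f w)) \<partial>N)"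
      using eq by (intro Bochner_Integration.integral_cong) auto
    also have "\<dots> = (\<Sum>c\<in>S n. c \<bullet> (LINT w:T -` B n c \<inter> space N|N. f w))"
      unfolding set_lebesgue_integral_def using i
      by (subst Bochner_Integration.integral_sum)
         (simp_all only: integral_inner_right integrable_inner_right)
    finally show ?thesis .
  qed
  moreover have "(\<lambda>n. \<integral>w. s n (T w) \<bullet> f w \<partial>N) \<longlonglongrightarrow> (\<integral>w. g (T w) \<bullet> f w \<partial>N)"
  proof (rule integral_dominated_convergence[where w="\<lambda>w. C * norm (f w)"])
    show "(\<lambda>w. g (T w) \<bullet> f w) \<in> borel_measurable N"
      using measurable_compose[OF T g] by measurable
    show "integrable N (\<lambda>w. C * norm (f w))" using f by auto
    show "AE w in N. (\<lambda>n. s n (T w) \<bullet> f w) \<longlonglongrightarrow> g (T w) \<bullet> f w"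
      using sp lim by (auto intro!: tendsto_intros)
    show "AE w in N. norm (s n (T w) \<bullet> f w) \<le> C * norm (f w)" for n
    proof (rule AE_I2)
      fix w assume w: "w \<in> space N"
      have "norm (s n (T w)) \<le> C"
        using bd[OF sp[OF w], of n] .
      then show "norm (s n (T w) \<bullet> f w) \<le> C * norm (f w)"
        using Cauchy_Schwarz_ineq2[of "s n (T w)" "f w"] mult_right_mono[of "norm (s n (T w))" "C" "norm (f w)"]
        by (simp add: real_norm_def) 
    qed
  qed measurable
  ultimately have "(\<lambda>n. \<Sum>c\<in>S n. c \<bullet> (LINT w:T -` B n c \<inter> space N|N. f w)) \<longlonglongrightarrow> (\<integral>w. g (T w) \<bullet> f w \<partial>N)"
    by simp
  then show ?thesis by (simp only: S_def B_def)
qed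

section \<open>Affine and smooth minorants of convex functions\<close>

text \<open>Hahn--Banach separation of \<open>(y, c)\<close> from the epigraph, which is closed
  because a finite convex function on the whole space is continuous.\<close>

lemma convex_affine_minorant:
  fixes L :: "'a::euclidean_space \<Rightarrow> real"
  assumes L: "convex_on UNIV L" and c: "c < L y"
  obtains a b where "\<And>x. a \<bullet> x + b \<le> L x" "c < a \<bullet> y + b"
proof -
  have cont: "continuous_on UNIV L"
    using L by (intro convex_on_continuous) auto
  have "closed (epigraph UNIV L)"
    unfolding epigraph_def
    by (simp, rule closed_Collect_le)
       (auto intro!: continuous_intros continuous_on_compose2[OF cont])
  moreover have "convex (epigraph UNIV L)" using L by (simp add: convex_epigraph)
  moreover have "(y, c) \<notin> epigraph UNIV L" using c by (simp add: epigraph_def)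
  ultimately obtain p t where pt: "p \<bullet> (y, c) < t" "\<And>z. z \<in> epigraph UNIV L \<Longrightarrow> p \<bullet> z > t"
    using separating_hyperplane_closed_point[of "epigraph UNIV L" "(y, c)"] by blast
  obtain q s where p: "p = (q, s)" by (cases p)
  have le: "q \<bullet> x + s * L x > t" for x
    using pt(2)[of "(x, L x)"] by (simp add: p epigraph_def)
  have lt: "q \<bullet> y + s * c < t" using pt(1) by (simp add: p)
  \<comment> \<open>The separating hyperplane is not vertical: it separates two points on the same
    vertical line, \<open>(y, L y)\<close> and \<open>(y, c)\<close>.\<close>
  have "s * (L y - c) > 0" using le[of y] lt by (simp add: right_diff_distrib)
  then have s: "s > 0" using c by (simp add: zero_less_mult_iff)
  show ?thesis
  proof
    show "(- (1 / s)) *\<^sub>R q \<bullet> x + t / s \<le> L x" for x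
      using le[of x] s by (simp add: field_simps)
    show "c < (- (1 / s)) *\<^sub>R q \<bullet> y + t / s"
      using lt s by (simp add: field_simps)
  qed
qed

text \<open>An affine minorant that is closer than \<open>\<delta>\<close> at one point stays so on
  a neighbourhood, and finitely many neighbourhoods cover \<open>K\<close>.\<close>

lemma convex_finite_minorants:
  fixes L :: "'a::euclidean_space \<Rightarrow> real"
  assumes L: "convex_on UNIV L" and K: "compact K" and d: "\<delta> > 0"
  obtains F where "finite F" "F \<noteq> {}" "\<And>a b x. (a, b) \<in> F \<Longrightarrow> a \<bullet> x + b \<le> L x"
    "\<And>x. x \<in> K \<Longrightarrow> \<exists>(a, b)\<in>F. L x - \<delta> < a \<bullet> x + b"
proof -
  have cont: "continuous_on UNIV L"
    using L by (intro convex_on_continuous) auto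
  have "\<forall>y. \<exists>p. (\<forall>x. fst p \<bullet> x + snd p \<le> L x) \<and> L y - \<delta> < fst p \<bullet> y + snd p"
  proof
    fix y
    show "\<exists>p. (\<forall>x. fst p \<bullet> x + snd p \<le> L x) \<and> L y - \<delta> < fst p \<bullet> y + snd p"
      using convex_affine_minorant[OF L, of "L y - \<delta>" y] d by (metis diff_less_eq fst_conv less_add_same_cancel1 snd_conv)
  qed
  then obtain p where p: "\<And>y x. fst (p y) \<bullet> x + snd (p y) \<le> L x"
      "\<And>y. L y - \<delta> < fst (p y) \<bullet> y + snd (p y)"
    by metis
  define U where "U y = {x. L x - \<delta> < fst (p y) \<bullet> x + snd (p y)}" for y
  have "open (U y)" for y
    unfolding U_def by (intro open_Collect_less continuous_intros cont)
  moreover have "K \<subseteq> (\<Union>y\<in>K. U y)" using p(2) by (auto simp: U_def)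
  ultimately obtain C where C: "C \<subseteq> K" "finite C" "K \<subseteq> (\<Union>y\<in>C. U y)"
    using compactE_image[OF K, of K U] by metis
  show ?thesis
  proof
    \<comment> \<open>The extra index 0 keeps the family nonempty when \<open>K\<close> is empty;
      the soft maximum built from it takes a logarithm of its sum.\<close>
    show "finite (p ` insert 0 C)" "p ` insert 0 C \<noteq> {}" using C by auto
    show "a \<bullet> x + b \<le> L x" if "(a, b) \<in> p ` insert 0 C" for a b x
      using that p(1) by (metis fst_conv imageE snd_conv)
    show "\<exists>(a, b)\<in>p ` insert 0 C. L x - \<delta> < a \<bullet> x + b" if "x \<in> K" for x
      using that C(3) by (force simp: U_def case_prod_beta)
  qed
qed

text \<open>Needed for Jensen's inequality under conditional expectation: one null set per affine
  function, and countably many of them can be united. The family collects finite ones that are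
  \<open>1 / Suc n\<close>-accurate on the ball of radius \<open>n\<close>.\<close>

lemma convex_countable_minorants:
  fixes L :: "'a::euclidean_space \<Rightarrow> real"
  assumes L: "convex_on UNIV L"
  obtains F where "countable F" "\<And>a b x. (a, b) \<in> F \<Longrightarrow> a \<bullet> x + b \<le> L x"
    "\<And>x u. \<forall>(a, b)\<in>F. a \<bullet> x + b \<le> u \<Longrightarrow> L x \<le> u"
proof -
  have "\<forall>n. \<exists>F. finite F \<and> (\<forall>a b x. (a, b) \<in> F \<longrightarrow> a \<bullet> x + b \<le> L x) \<and>
      (\<forall>x\<in>cball 0 (real n). \<exists>(a, b)\<in>F. L x - 1 / Suc n < a \<bullet> x + b)"
  proof
    fix n
    show "\<exists>F. finite F \<and> (\<forall>a b x. (a, b) \<in> F \<longrightarrow> a \<bullet> x + b \<le> L x) \<and>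
        (\<forall>x\<in>cball 0 (real n). \<exists>(a, b)\<in>F. L x - 1 / Suc n < a \<bullet> x + b)"
    proof -
      obtain F where "finite F" "\<And>a b x. (a, b) \<in> F \<Longrightarrow> a \<bullet> x + b \<le> L x"
          "\<And>x. x \<in> cball 0 (real n) \<Longrightarrow> \<exists>(a, b)\<in>F. L x - 1 / Suc n < a \<bullet> x + b"
        using convex_finite_minorants[OF L compact_cball, of "1 / Suc n" 0 "real n"]
        by (metis of_nat_0_less_iff zero_less_Suc zero_less_divide_1_iff)
      then show ?thesis by (intro exI[of _ F] conjI allI impI ballI)
    qed
  qed
  from choice[OF this] obtain F where
    "\<forall>n. finite (F n) \<and> (\<forall>a b x. (a, b) \<in> F n \<longrightarrow> a \<bullet> x + b \<le> L x) \<and>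
      (\<forall>x\<in>cball 0 (real n). \<exists>(a, b)\<in>F n. L x - 1 / Suc n < a \<bullet> x + b)" ..
  then have F: "\<And>n. finite (F n)" "\<And>n a b x. (a, b) \<in> F n \<Longrightarrow> a \<bullet> x + b \<le> L x"
      "\<And>n x. x \<in> cball 0 (real n) \<Longrightarrow> \<exists>(a, b)\<in>F n. L x - 1 / Suc n < a \<bullet> x + b"
    by blast+
  show ?thesis
  proof (rule that[of "\<Union>n. F n"])
    show "countable (\<Union>n. F n)" using F(1) by (simp add: countable_finite)
    show "a \<bullet> x + b \<le> L x" if "(a, b) \<in> (\<Union>n. F n)" for a b x using that F(2) by auto
    fix x u assume u: "\<forall>(a, b)\<in>(\<Union>n. F n). a \<bullet> x + b \<le> u"
    show "L x \<le> u"
    proof (rule field_le_epsilon)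
      fix e :: real assume "e > 0"
      obtain k where k: "1 / Suc k < e" using \<open>e > 0\<close> nat_approx_posE by blast
      \<comment> \<open>Large enough both for the accuracy \<open>e\<close> and for the ball to
        contain \<open>x\<close>.\<close>
      define n where "n = max k (nat \<lceil>norm x\<rceil>)"
      have "1 / real (Suc n) \<le> 1 / Suc k" by (intro divide_left_mono) (auto simp: n_def)
      with k have n: "1 / real (Suc n) < e" by linarith
      have "norm x \<le> real (nat \<lceil>norm x\<rceil>)" by linarith
      also have "\<dots> \<le> real n" by (simp add: n_def)
      finally have "norm x \<le> real n" .
      then obtain a b where ab: "(a, b) \<in> F n" "L x - 1 / Suc n < a \<bullet> x + b"
        using F(3)[of x n] by auto
      have "a \<bullet> x + b \<le> u" using u ab(1) by blast
      then show "L x \<le> u + e" using ab(2) n by linarith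
    qed
  qed
qed

text \<open>
  \<open>G\<close> is a soft maximum of finitely many affine minorants. The tangent inequality compares \<open>L\<close>
  with the softmax average of the minorants; the entropy defect is absorbed by the \<open>1 / n\<close> inside the
  logarithm.
\<close>

lemma convex_C1_minorant:
  fixes L :: "'a::euclidean_space \<Rightarrow> real"
  assumes L: "convex_on UNIV L" and K: "compact K" and d: "\<delta> > 0"
  obtains G D where "\<And>x. (G has_derivative (\<lambda>h. D x \<bullet> h)) (at x)" "continuous_on UNIV D"
    "\<And>y v. G y + D y \<bullet> (v - y) \<le> L v" "\<And>x. x \<in> K \<Longrightarrow> L x - \<delta> \<le> G x"
proof -
  obtain F where F: "finite F" "F \<noteq> {}" "\<And>a b x. (a, b) \<in> F \<Longrightarrow> a \<bullet> x + b \<le> L x"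
    "\<And>x. x \<in> K \<Longrightarrow> \<exists>(a, b)\<in>F. L x - \<delta> / 2 < a \<bullet> x + b"
    using convex_finite_minorants[OF L K, of "\<delta> / 2"] d by auto
  define n where "n = real (card F)"
  have n: "n \<ge> 1" using F(1,2) by (simp add: n_def Suc_le_eq card_gt_0_iff)
  \<comment> \<open>Normalising by \<open>n\<close> puts the soft maximum at most
    \<open>ln n / \<beta>\<close> below the true maximum. This choice makes the loss at most half of
    \<open>\<delta>\<close>, the other half being spent on the affine approximation; the summand 1
    keeps \<open>\<beta>\<close> positive when \<open>n = 1\<close>.\<close>
  define \<beta> where "\<beta> = 2 * ln n / \<delta> + 1"
  have \<beta>: "\<beta> > 0" "ln n / \<beta> \<le> \<delta> / 2"
  proof -
    have ln: "ln n \<ge> 0" using n by simp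
    then have q: "2 * ln n / \<delta> \<ge> 0" using d by simp
    then show "\<beta> > 0" by (simp add: \<beta>_def)
    have "ln n = (2 * ln n / \<delta>) * (\<delta> / 2)" using d by simp
    also have "\<dots> \<le> \<beta> * (\<delta> / 2)" using d by (intro mult_right_mono) (auto simp: \<beta>_def)
    finally show "ln n / \<beta> \<le> \<delta> / 2" using \<open>\<beta> > 0\<close> by (simp add: field_simps)
  qed
  define e where "e p x = exp (\<beta> * (fst p \<bullet> x + snd p))" for p :: "'a \<times> real" and x
  define S where "S x = (\<Sum>p\<in>F. e p x)" for x
  define G where "G x = ln (S x / n) / \<beta>" for x
  define D where "D x = (1 / S x) *\<^sub>R (\<Sum>p\<in>F. e p x *\<^sub>R fst p)" for x
  have e: "e p x > 0" for p x by (simp add: e_def)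
  have S: "S x > 0" for x unfolding S_def using F(1,2) e by (intro sum_pos) auto
  show ?thesis
  proof (rule that[of G D])
    show "continuous_on UNIV D"
      unfolding D_def S_def e_def using S unfolding S_def e_def
      by (intro continuous_intros) (auto simp: less_imp_neq[symmetric] order_less_imp_not_eq2)
    show "(G has_derivative (\<lambda>h. D x \<bullet> h)) (at x)" for x
    proof -
      have dS: "(S has_derivative (\<lambda>h. \<Sum>p\<in>F. e p x * (\<beta> * (fst p \<bullet> h)))) (at x)"
        unfolding S_def[abs_def] e_def
        by (auto intro!: derivative_eq_intros simp: mult_ac)
      have "(G has_derivative (\<lambda>h. (inverse (S x / n) * ((\<Sum>p\<in>F. e p x * (\<beta> * (fst p \<bullet> h))) / n)) / \<beta>)) (at x)"
        unfolding G_def[abs_def]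
        using S[of x] n \<beta>(1) by (auto intro!: derivative_eq_intros dS simp: field_simps)
      moreover have "(inverse (S x / n) * ((\<Sum>p\<in>F. e p x * (\<beta> * (fst p \<bullet> h))) / n)) / \<beta> = D x \<bullet> h" for h
        using S[of x] n \<beta>(1)
        by (simp add: D_def inner_sum_left sum_distrib_left sum_divide_distrib field_simps)
      ultimately show ?thesis by simp
    qed
    show "G y + D y \<bullet> (v - y) \<le> L v" for y v
    proof -
      \<comment> \<open>From \<open>ln z \<le> z - 1\<close>. Weighted by \<open>e p y\<close>, the
        right-hand sides sum to zero over \<open>F\<close>, because the \<open>e p y\<close> sum to
        \<open>S y\<close> and \<open>n\<close> is the number of summands.\<close>
      have le: "e p y * (G y + fst p \<bullet> (v - y) - L v) \<le> (S y / n - e p y) / \<beta>" if p: "p \<in> F" for p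
      proof -
        have "G y - (fst p \<bullet> y + snd p) = ln (S y / n / e p y) / \<beta>"
        proof -
          have "ln (S y / n / e p y) = ln (S y / n) - \<beta> * (fst p \<bullet> y + snd p)"
            using S[of y] n e[of p y] by (subst ln_div) (auto simp: e_def)
          then show ?thesis using \<beta>(1) by (simp add: G_def field_simps)
        qed
        also have "\<dots> \<le> (S y / n / e p y - 1) / \<beta>"
          using S[of y] n e[of p y] \<beta>(1) by (intro divide_right_mono ln_le_minus_one) auto
        finally have "G y - (fst p \<bullet> y + snd p) \<le> (S y / n / e p y - 1) / \<beta>" .
        moreover have "fst p \<bullet> v + snd p \<le> L v" using F(3)[of "fst p" "snd p"] p by simp
        ultimately have "G y + fst p \<bullet> (v - y) - L v \<le> (S y / n / e p y - 1) / \<beta>"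
          by (simp add: inner_diff_right)
        then have "e p y * (G y + fst p \<bullet> (v - y) - L v) \<le> e p y * ((S y / n / e p y - 1) / \<beta>)"
          using e[of p y] by (intro mult_left_mono) auto
        also have "\<dots> = (S y / n - e p y) / \<beta>"
          using e[of p y] by (simp add: field_simps)
        finally show ?thesis .
      qed
      have "S y * (G y + D y \<bullet> (v - y) - L v) = (\<Sum>p\<in>F. e p y * (G y + fst p \<bullet> (v - y) - L v))"
      proof -
        have "S y * (D y \<bullet> (v - y)) = (\<Sum>p\<in>F. e p y * (fst p \<bullet> (v - y)))"
          using S[of y] by (simp add: D_def inner_sum_left)
        moreover have "S y * c = (\<Sum>p\<in>F. e p y * c)" for c by (simp add: S_def sum_distrib_right)
        ultimately have "S y * (G y - L v) + S y * (D y \<bullet> (v - y))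
            = (\<Sum>p\<in>F. e p y * (G y - L v) + e p y * (fst p \<bullet> (v - y)))"
          by (simp only: sum.distrib)
        then show ?thesis by (simp only: distrib_left[symmetric] diff_add_eq)
      qed
      also have "\<dots> \<le> (\<Sum>p\<in>F. (S y / n - e p y) / \<beta>)" by (intro sum_mono le)
      also have "\<dots> = 0"
        using n by (simp add: sum_divide_distrib[symmetric] sum_subtractf S_def[symmetric] n_def[symmetric])
      finally show ?thesis using S[of y] by (simp add: mult_le_0_iff)
    qed
    show "L x - \<delta> \<le> G x" if x: "x \<in> K" for x
    proof -
      obtain p where p: "p \<in> F" "L x - \<delta> / 2 < fst p \<bullet> x + snd p" using F(4)[OF x] by auto
      have "e p x \<le> S x" unfolding S_def using p(1) F(1) e by (intro member_le_sum) (auto simp: less_imp_le)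
      then have "ln (e p x / n) \<le> ln (S x / n)"
        using e[of p x] n S[of x] by (subst ln_le_cancel_iff) (auto simp: divide_right_mono)
      then have "ln (e p x / n) / \<beta> \<le> G x" unfolding G_def using \<beta>(1) by (intro divide_right_mono) auto
      moreover have "ln (e p x / n) / \<beta> = fst p \<bullet> x + snd p - ln n / \<beta>"
        using n \<beta>(1) e[of p x] by (simp add: ln_div e_def field_simps)
      ultimately show ?thesis using p(2) \<beta>(2) by linarith
    qed
  qed
qed

section \<open>Weak compactness and optimal couplings\<close>

lemma prob_measuresD:
  assumes "M \<in> prob_measures S"
  shows "prob_space M" "sets M = sets (borel_on S)" "space M = S"
  using assms by (auto simp: prob_measures_def space_restrict_space dest: sets_eq_imp_space_eq)

lemma borel_measurable_prob_measures:
  fixes f :: "'a::topological_space \<Rightarrow> 'b::topological_space"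
  assumes "M \<in> prob_measures S" "continuous_on S f"
  shows "f \<in> borel_measurable M"
  using assms(2) by (subst measurable_cong_sets[OF prob_measuresD(2)[OF assms(1)] refl])
    (rule borel_measurable_continuous_on_restrict)

lemma integrable_prob_measures:
  fixes f :: "'a::topological_space \<Rightarrow> 'b::{banach, second_countable_topology}"
  assumes M: "M \<in> prob_measures S" and f: "continuous_on S f" and S: "compact S"
  shows "integrable M f"
proof -
  interpret prob_space M using prob_measuresD(1)[OF M] .
  obtain C where "\<And>x. x \<in> S \<Longrightarrow> norm (f x) \<le> C"
    using compact_imp_bounded[OF compact_continuous_image[OF f S]] by (auto simp: bounded_iff)
  then show ?thesis
    using borel_measurable_prob_measures[OF M f] prob_measuresD(3)[OF M]
    by (intro integrable_const_bound[where B=C] AE_I2) auto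
qed

lemma distr_in_prob_measures:
  assumes "prob_space M" "T \<in> measurable M (borel_on S)"
  shows "distr M (borel_on S) T \<in> prob_measures S"
  using assms by (simp add: prob_measures_def prob_space.prob_space_distr)

lemma prob_measures_eqI:
  fixes S :: "'a::metric_space set"
  assumes M: "M \<in> prob_measures S" and N: "N \<in> prob_measures S" and S: "closed S"
    and eq: "\<And>f :: 'a \<Rightarrow> real. continuous_on UNIV f \<Longrightarrow> bounded (range f) \<Longrightarrow> (\<integral>x. f x \<partial>M) = (\<integral>x. f x \<partial>N)"
  shows "M = N"
proof -
  have id[measurable]: "(\<lambda>x. x) \<in> measurable M borel" "(\<lambda>x. x) \<in> measurable N borel"
    using M N by (auto intro!: borel_measurable_prob_measures)
  \<comment> \<open>Pushed forward to the whole space, both measures live on the Borel sets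
    generated by the intersection-stable family of closed sets.\<close>
  let ?M = "distr M borel (\<lambda>x. x)" and ?N = "distr N borel (\<lambda>x. x)"
  have closed: "emeasure ?M C = emeasure ?N C" if C: "closed C" for C
  proof (cases "C = {}")
    case False
    \<comment> \<open>Continuous approximations of the indicator of \<open>C\<close> from above. The
      empty set is excluded because \<open>infdist x {}\<close> is 0 by convention and
      \<open>f n\<close> would be constantly 1.\<close>
    define f where "f n x = max 0 (1 - real n * infdist x C)" for n x
    have cont: "continuous_on UNIV (f n)" for n
      unfolding f_def by (intro continuous_intros)
    have bd: "\<bar>f n x\<bar> \<le> 1" for n x
      using infdist_nonneg[of x C] by (auto simp: f_def)
    have lim: "(\<lambda>n. f n x) \<longlonglongrightarrow> indicator C x" for x
    proof (cases "x \<in> C")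
      case True
      then show ?thesis by (simp add: f_def)
    next
      case x: False
      then have pos: "infdist x C > 0"
        using C False in_closed_iff_infdist_zero[of C x] infdist_nonneg[of x C] by fastforce
      obtain n0 where "1 / infdist x C < real n0" using reals_Archimedean2 by blast
      then have n0: "1 < real n0 * infdist x C" using pos by (simp add: field_simps)
      have "f n x = 0" if "n \<ge> n0" for n
      proof -
        have "real n0 * infdist x C \<le> real n * infdist x C"
          using that pos by (intro mult_right_mono) auto
        then show ?thesis using n0 by (simp add: f_def)
      qed
      then have "eventually (\<lambda>n. f n x = 0) sequentially"
        unfolding eventually_sequentially by blast
      then show ?thesis using x by (simp add: tendsto_eventually)
    qed
    have to: "(\<lambda>n. \<integral>x. f n x \<partial>Q) \<longlonglongrightarrow> measure (distr Q borel (\<lambda>x. x)) C" if Q: "Q \<in> prob_measures S" for Q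
    proof -
      interpret Q: prob_space Q using prob_measuresD(1)[OF Q] .
      have [measurable]: "(\<lambda>x. x) \<in> measurable Q borel" "\<And>n. f n \<in> borel_measurable Q"
        using Q cont continuous_on_subset[OF cont subset_UNIV] by (auto intro!: borel_measurable_prob_measures)
      have [measurable]: "C \<in> sets borel" using C by simp
      have "(\<lambda>n. \<integral>x. f n x \<partial>Q) \<longlonglongrightarrow> (\<integral>x. indicat_real C x \<partial>Q)"
        by (rule integral_dominated_convergence[where w="\<lambda>_. 1"])
           (use lim bd in \<open>auto intro!: AE_I2\<close>)
      also have "(\<integral>x. indicat_real C x \<partial>Q) = (\<integral>x. indicat_real C x \<partial>distr Q borel (\<lambda>x. x))"
        by (subst integral_distr) auto
      also have "\<dots> = measure (distr Q borel (\<lambda>x. x)) C" by simp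
      finally show ?thesis .
    qed
    have "bounded (range (f n))" for n
      using bd by (auto simp: bounded_iff intro!: exI[of _ 1])
    with cont have "(\<lambda>n. \<integral>x. f n x \<partial>M) = (\<lambda>n. \<integral>x. f n x \<partial>N)" by (intro ext eq)
    with to[OF M] to[OF N] have "measure ?M C = measure ?N C" by (metis LIMSEQ_unique)
    moreover interpret M: prob_space ?M using prob_measuresD(1)[OF M] by (simp add: prob_space.prob_space_distr)
    interpret N: prob_space ?N using prob_measuresD(1)[OF N] by (simp add: prob_space.prob_space_distr)
    show ?thesis using calculation by (simp add: M.emeasure_eq_measure N.emeasure_eq_measure)
  qed simp
  have MN: "?M = ?N"
  proof (rule measure_eqI_generator_eq[where E="Collect closed" and \<Omega>=UNIV and A="\<lambda>_. UNIV"])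
    show "Int_stable (Collect (closed :: 'a set \<Rightarrow> bool))" by (auto simp: Int_stable_def)
    interpret M: prob_space ?M using prob_measuresD(1)[OF M] by (simp add: prob_space.prob_space_distr)
    show "emeasure ?M UNIV \<noteq> \<infinity>" for i :: nat by simp
    show "sets ?M = sigma_sets UNIV (Collect closed)" "sets ?N = sigma_sets UNIV (Collect closed)"
      by (simp_all add: borel_eq_closed)
  qed (use closed in auto)
  show ?thesis
  proof (rule measure_eqI)
    show "sets M = sets N" using M N by (simp add: prob_measuresD(2))
    fix A assume "A \<in> sets M"
    then have A: "A \<in> sets borel" "A \<subseteq> S"
      using S by (auto simp: prob_measuresD(2)[OF M] sets_restrict_space)
    have "emeasure M A = emeasure ?M A" "emeasure N A = emeasure ?N A"
      using A prob_measuresD(3)[OF M] prob_measuresD(3)[OF N]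
      by (simp_all add: emeasure_distr Int_absorb2)
    then show "emeasure M A = emeasure N A" using MN by simp
  qed
qed

section \<open>Prokhorov's theorem on a compact set\<close>

text \<open>In base 3 with digits 0 and 1, everything after the first disagreement \<open>k\<close>
  amounts to at most half of \<open>(1/3) ^ k\<close>, so the two sums differ by at least the other
  half. In base 2 the tail could cancel the disagreement.\<close>

lemma ternary_series_eq_prefix:
  fixes a b :: "nat \<Rightarrow> bool"
  assumes "\<bar>(\<Sum>n. of_bool (a n) * (1/3) ^ n) - (\<Sum>n. of_bool (b n) * (1/3::real) ^ n)\<bar> < (1/2) * (1/3) ^ M"
    and "n < M"
  shows "a n = b n"
proof (rule ccontr)
  assume "a n \<noteq> b n"
  define k where "k = (LEAST n. a n \<noteq> b n)"
  have k: "a k \<noteq> b k" unfolding k_def using \<open>a n \<noteq> b n\<close> by (rule LeastI)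
  have kn: "k \<le> n" unfolding k_def using \<open>a n \<noteq> b n\<close> by (rule Least_le)
  have eq: "a i = b i" if "i < k" for i using not_less_Least[of i "\<lambda>n. a n \<noteq> b n"] that by (auto simp: k_def)
  define c :: "nat \<Rightarrow> real" where "c i = of_bool (a i) - of_bool (b i)" for i
  have geo: "summable (\<lambda>n. (1/3::real) ^ n)" by (rule summable_geometric) simp
  have sm: "summable (\<lambda>n. of_bool (d n) * (1/3::real) ^ n)" for d :: "nat \<Rightarrow> bool"
    by (rule summable_comparison_test'[OF geo, of 0]) auto
  have smc: "summable (\<lambda>n. c n * (1/3) ^ n)"
    using summable_diff[OF sm[of a] sm[of b]] by (simp add: c_def left_diff_distrib)
  have diff: "(\<Sum>n. of_bool (a n) * (1/3) ^ n) - (\<Sum>n. of_bool (b n) * (1/3::real) ^ n) = (\<Sum>n. c n * (1/3) ^ n)"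
    using suminf_diff[OF sm[of a] sm[of b]] by (simp add: c_def left_diff_distrib)
  have "(\<Sum>n. c n * (1/3) ^ n) = (\<Sum>n. c (n + Suc k) * (1/3) ^ (n + Suc k)) + (\<Sum>i<Suc k. c i * (1/3) ^ i)"
    by (rule suminf_split_initial_segment[OF smc])
  moreover have "(\<Sum>i<Suc k. c i * (1/3) ^ i) = c k * (1/3) ^ k"
    using eq by (simp add: c_def)
  moreover have "\<bar>\<Sum>n. c (n + Suc k) * (1/3) ^ (n + Suc k)\<bar> \<le> (1/2) * (1/3) ^ k"
  proof -
    have g: "summable (\<lambda>n. (1/3::real) ^ n * (1/3) ^ Suc k)" using geo by (rule summable_mult2)
    have "\<bar>\<Sum>n. c (n + Suc k) * (1/3) ^ (n + Suc k)\<bar> \<le> (\<Sum>n. (1/3) ^ n * (1/3) ^ Suc k)"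
    proof (rule norm_suminf_le[of "\<lambda>n. c (n + Suc k) * (1/3) ^ (n + Suc k)", unfolded real_norm_def])
      show "\<bar>c (n + Suc k) * (1/3) ^ (n + Suc k)\<bar> \<le> (1/3) ^ n * (1/3) ^ Suc k" for n
        by (auto simp: c_def abs_mult power_add)
    qed (rule g)
    also have "\<dots> = (1/2) * (1/3) ^ k"
      by (subst suminf_mult2[OF geo, symmetric]) (simp add: suminf_geometric)
    finally show ?thesis .
  qed
  moreover have "\<bar>c k * (1/3) ^ k\<bar> = (1/3) ^ k" using k by (auto simp: c_def abs_mult)
  ultimately have "(1/2) * (1/3) ^ k \<le> \<bar>\<Sum>n. c n * (1/3) ^ n\<bar>" by linarith
  moreover have "(1/3::real) ^ M \<le> (1/3) ^ k" using kn assms(2) by (intro power_decreasing) auto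
  ultimately show False using assms(1) diff by linarith
qed

text \<open>
  Prokhorov's theorem on a compact set is reduced to Helly's theorem on the line: membership in the
  sets of a countable base, read as ternary digits, is a Borel injection of \<open>K\<close> into the reals whose
  inverse is uniformly continuous and hence extends to the closure of the image.
\<close>

lemma compact_real_code:
  fixes K :: "'a::{metric_space, second_countable_topology} set"
  assumes K: "compact K"
  obtains s :: "'a \<Rightarrow> real" and h where "s \<in> borel_measurable borel" "\<And>x. s x \<in> {0..3/2::real}"
    "\<And>x. x \<in> K \<Longrightarrow> h (s x) = x" "uniformly_continuous_on (s ` K) h"
proof -
  obtain B :: "'a set set" where B: "countable B" "topological_basis B"
    using ex_countable_basis by blast
  have "B \<noteq> {}" using topological_basisE[OF B(2), of UNIV undefined] by blast
  define U where "U = from_nat_into B"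
  have U: "range U = B" using B(1) \<open>B \<noteq> {}\<close> by (simp add: U_def range_from_nat_into)
  have open_U: "open (U n)" for n using U B(2) topological_basis_open by blast
  define s where "s x = (\<Sum>n. of_bool (x \<in> U n) * (1/3::real) ^ n)" for x
  have geo: "summable (\<lambda>n. (1/3::real) ^ n)" by (rule summable_geometric) simp
  have sm: "summable (\<lambda>n. of_bool (x \<in> U n) * (1/3::real) ^ n)" for x
    by (rule summable_comparison_test'[OF geo, of 0]) auto
  have code: "x \<in> U n \<longleftrightarrow> y \<in> U n" if "\<bar>s x - s y\<bar> < (1/2) * (1/3) ^ M" "n < M" for x y n M
    using ternary_series_eq_prefix[of "\<lambda>n. x \<in> U n" "\<lambda>n. y \<in> U n" M n] that by (simp add: s_def)
  have close: "\<exists>d>0. \<forall>x\<in>K. \<forall>y\<in>K. \<bar>s x - s y\<bar> < d \<longrightarrow> dist x y < \<epsilon>" if "\<epsilon> > 0" for \<epsilon>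
  proof -
    have "\<exists>n. x \<in> U n \<and> U n \<subseteq> ball x (\<epsilon> / 2)" for x
    proof -
      obtain V where "V \<in> B" "x \<in> V" "V \<subseteq> ball x (\<epsilon> / 2)"
        using topological_basisE[OF B(2), of "ball x (\<epsilon> / 2)" x] \<open>\<epsilon> > 0\<close> by auto
      then show ?thesis using U by (metis imageE)
    qed
    then obtain N where N: "\<And>x. x \<in> U (N x)" "\<And>x. U (N x) \<subseteq> ball x (\<epsilon> / 2)" by metis
    obtain C where C: "C \<subseteq> K" "finite C" "K \<subseteq> (\<Union>x\<in>C. U (N x))"
      using compactE_image[OF K, of K "\<lambda>x. U (N x)"] open_U N(1) by (metis UN_I subsetI)
    \<comment> \<open>Beyond all indices of the finite cover: agreement of the first
      \<open>M\<close> digits puts both points into a common basic set, which lies in a ball of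
      radius \<open>\<epsilon> / 2\<close>.\<close>
    define M where "M = Suc (Max (insert 0 (N ` C)))"
    have M: "N x < M" if "x \<in> C" for x using that C(2) by (simp add: M_def le_imp_less_Suc)
    have "dist x y < \<epsilon>" if "x \<in> K" "y \<in> K" "\<bar>s x - s y\<bar> < (1/2) * (1/3) ^ M" for x y
    proof -
      obtain z where z: "z \<in> C" "x \<in> U (N z)" using C(3) \<open>x \<in> K\<close> by auto
      then have "y \<in> U (N z)" using code[OF that(3) M[OF z(1)]] by simp
      then have "dist z x < \<epsilon> / 2" "dist z y < \<epsilon> / 2" using N(2)[of z] z(2) by auto
      then show ?thesis by (metis dist_commute dist_triangle_half_l)
    qed
    then show ?thesis by (intro exI[of _ "(1/2) * (1/3) ^ M"]) auto
  qed
  have inj: "inj_on s K"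
  proof (rule inj_onI)
    fix x y assume xy: "x \<in> K" "y \<in> K" "s x = s y"
    have "dist x y < \<epsilon>" if "\<epsilon> > 0" for \<epsilon>
      using close[OF that] xy by auto
    then show "x = y" by (metis dist_eq_0_iff less_irrefl zero_less_dist_iff)
  qed
  define h where "h = the_inv_into K s"
  have h: "h (s x) = x" if "x \<in> K" for x
    unfolding h_def using inj that by (rule the_inv_into_f_f)
  show ?thesis
  proof (rule that[of s h])
    have [measurable]: "U n \<in> sets borel" for n using open_U by simp
    have eq: "s = (\<lambda>x. \<Sum>n. indicator (U n) x * (1/3::real) ^ n)"
      by (simp add: s_def[abs_def] indicator_def of_bool_def)
    show "s \<in> borel_measurable borel" unfolding eq by measurable
    show "s x \<in> {0..3/2}" for x
    proof -
      have "s x \<le> (\<Sum>n. (1/3::real) ^ n)" unfolding s_def using sm geo by (intro suminf_le) auto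
      moreover have "s x \<ge> 0" unfolding s_def using sm by (intro suminf_nonneg) auto
      ultimately show ?thesis by (simp add: suminf_geometric)
    qed
    show "h (s x) = x" if "x \<in> K" for x using h[OF that] .
    show "uniformly_continuous_on (s ` K) h"
      unfolding uniformly_continuous_on_def
    proof (intro allI impI)
      fix \<epsilon> :: real assume "\<epsilon> > 0"
      from close[OF this] obtain d where d: "d > 0"
        "\<And>x y. x \<in> K \<Longrightarrow> y \<in> K \<Longrightarrow> \<bar>s x - s y\<bar> < d \<Longrightarrow> dist x y < \<epsilon>" by blast
      have "dist (h v) (h u) < \<epsilon>" if "u \<in> s ` K" "v \<in> s ` K" "dist v u < d" for u v
        using that d(2) h by (metis (no_types, lifting) dist_real_def imageE)
      with d(1) show "\<exists>d>0. \<forall>x\<in>s ` K. \<forall>x'\<in>s ` K. dist x' x < d \<longrightarrow> dist (h x') (h x) < \<epsilon>" by blast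
    qed
  qed
qed

lemma prob_measures_sequentially_compact:
  fixes K :: "'a::{complete_space, second_countable_topology} set" and \<gamma> :: "nat \<Rightarrow> 'a measure"
  assumes K: "compact K" and \<gamma>: "\<And>n. \<gamma> n \<in> prob_measures K"
  obtains r \<gamma>' where "strict_mono (r :: nat \<Rightarrow> nat)" "\<gamma>' \<in> prob_measures K"
    "\<And>f :: 'a \<Rightarrow> real. continuous_on K f \<Longrightarrow> (\<lambda>n. \<integral>x. f x \<partial>\<gamma> (r n)) \<longlonglongrightarrow> (\<integral>x. f x \<partial>\<gamma>')"
proof -
  obtain s h0 where s[measurable]: "s \<in> borel_measurable borel" and s_bd: "\<And>x. s x \<in> {0..3/2::real}"
    and h0: "\<And>x. x \<in> K \<Longrightarrow> h0 (s x) = x" and uc: "uniformly_continuous_on (s ` K) h0"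
    by (rule compact_real_code[OF K]) (rule that)
  obtain k0 where k0: "k0 \<in> K"
    using prob_space.not_empty[OF prob_measuresD(1)[OF \<gamma>[of 0]]] prob_measuresD(3)[OF \<gamma>[of 0]] by auto
  \<comment> \<open>The code \<open>s\<close> need not be continuous, so its image of
    \<open>K\<close> need not be closed and the limit law may charge further points of the closure.
    The uniformly continuous inverse extends to them, with values still in the closed set
    \<open>K\<close>.\<close>
  define C where "C = closure (s ` K)"
  have C: "closed C" "C \<noteq> {}" "\<And>x. x \<in> K \<Longrightarrow> s x \<in> C"
    using k0 closure_subset[of "s ` K"] by (auto simp: C_def)
  obtain h where h: "uniformly_continuous_on C h" "\<And>y. y \<in> s ` K \<Longrightarrow> h0 y = h y"
    using uniformly_continuous_on_extension_on_closure[OF uc] unfolding C_def by metis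
  have h_cont: "continuous_on C h" using h(1) by (rule uniformly_continuous_imp_continuous)
  have hs: "h (s x) = x" if "x \<in> K" for x using h(2)[of "s x"] h0[OF that] that by auto
  have hK: "h ` C \<subseteq> K"
    unfolding C_def using h_cont hs compact_imp_closed[OF K]
    by (intro image_closure_subset) (auto simp: C_def)
  have s_meas[measurable]: "s \<in> borel_measurable (\<gamma> n)" for n
    using measurable_cong_sets[OF prob_measuresD(2)[OF \<gamma>[of n]] refl] measurable_restrict_space1[OF s] by blast
  define \<nu> where "\<nu> n = distr (\<gamma> n) borel s" for n
  have \<nu>: "real_distribution (\<nu> n)" for n
    unfolding \<nu>_def real_distribution_def real_distribution_axioms_def
    using prob_measuresD(1)[OF \<gamma>] by (simp add: prob_space.prob_space_distr)
  have "tight \<nu>"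
    unfolding tight_def
  proof (intro conjI allI impI)
    fix \<epsilon> :: real assume "\<epsilon> > 0"
    \<comment> \<open>All codes lie between 0 and 3/2, so one half-open interval carries every
      \<open>\<nu> n\<close>.\<close>
    have "measure (\<nu> n) {-1<..2} = 1" for n
    proof -
      have "-1 < s x \<and> s x \<le> 2" for x using s_bd[of x] by auto
      then have "s -` {-1<..2} \<inter> space (\<gamma> n) = space (\<gamma> n)" by auto
      then show ?thesis
        unfolding \<nu>_def using prob_space.prob_space[OF prob_measuresD(1)[OF \<gamma>[of n]]]
        by (subst measure_distr) auto
    qed
    then show "\<exists>a b. a < b \<and> (\<forall>n. 1 - \<epsilon> < measure (\<nu> n) {a<..b})"
      using \<open>\<epsilon> > 0\<close> by (intro exI[of _ "-1"] exI[of _ 2]) auto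
  qed (rule \<nu>)
  then obtain r \<Lambda> where r: "strict_mono r" and \<Lambda>: "real_distribution \<Lambda>" and conv: "weak_conv_m (\<nu> \<circ> id \<circ> r) \<Lambda>"
    using tight_imp_convergent_subsubsequence[of \<nu> id] by (auto simp: strict_mono_def)
  interpret \<Lambda>: real_distribution \<Lambda> by fact
  have conv_int: "(\<lambda>n. \<integral>y. f y \<partial>\<nu> (r n)) \<longlonglongrightarrow> (\<integral>y. f y \<partial>\<Lambda>)"
    if "continuous_on UNIV f" "\<And>y. norm (f y) \<le> c" for f :: "real \<Rightarrow> real" and c
    using weak_conv_imp_integral_bdd_continuous_conv[of "\<nu> \<circ> id \<circ> r" \<Lambda> f c] conv \<nu> \<Lambda> that
    by (simp add: continuous_on_eq_continuous_at comp_def)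
  have C_full: "AE y in \<Lambda>. y \<in> C"
  proof -
    \<comment> \<open>A bounded continuous function vanishing exactly on \<open>C\<close>; its
      integral is 0 along the sequence, hence 0 in the limit.\<close>
    define f where "f y = min 1 (infdist y C)" for y
    have cont: "continuous_on UNIV f" unfolding f_def by (intro continuous_intros)
    then have [measurable]: "f \<in> borel_measurable borel" by (rule borel_measurable_continuous_onI)
    have bd: "norm (f y) \<le> 1" "f y \<ge> 0" for y by (auto simp: f_def infdist_nonneg)
    have "(\<integral>y. f y \<partial>\<nu> n) = 0" for n
    proof -
      have "(\<integral>y. f y \<partial>\<nu> n) = (\<integral>x. f (s x) \<partial>\<gamma> n)" unfolding \<nu>_def by (rule integral_distr) auto
      also have "\<dots> = (\<integral>x. 0 \<partial>\<gamma> n)"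
        using C(3) prob_measuresD(3)[OF \<gamma>[of n]]
        by (intro Bochner_Integration.integral_cong) (auto simp: f_def)
      finally show ?thesis by simp
    qed
    then have "(\<integral>y. f y \<partial>\<Lambda>) = 0"
      using conv_int[OF cont bd(1)] by (simp add: LIMSEQ_const_iff)
    moreover have "integrable \<Lambda> f"
      using bd(1) by (intro \<Lambda>.integrable_const_bound[where B=1]) auto
    ultimately have "AE y in \<Lambda>. f y = 0"
      using integral_nonneg_eq_0_iff_AE[of \<Lambda> f] bd(2) by auto
    then show ?thesis
    proof (rule eventually_mono)
      fix y assume "f y = 0"
      then have "infdist y C = 0" by (simp add: f_def min_def split: if_splits)
      then show "y \<in> C" using C(1,2) by (simp add: in_closed_iff_infdist_zero)
    qed
  qed
  \<comment> \<open>The default \<open>k0\<close> makes the inverse total and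
    \<open>K\<close>-valued; it is taken only on a null set of \<open>\<Lambda>\<close>.\<close>
  define h' where "h' y = (if y \<in> C then h y else k0)" for y
  have h'[measurable]: "h' \<in> measurable \<Lambda> (borel_on K)"
  proof (rule measurable_restrict_space2)
    show "h' \<in> space \<Lambda> \<rightarrow> K" using hK k0 by (auto simp: h'_def image_subset_iff)
    have "h' \<in> borel_measurable borel"
      unfolding h'_def using h_cont C(1)
      by (intro borel_measurable_continuous_on_if) auto
    then show "h' \<in> measurable \<Lambda> borel" by (simp add: measurable_cong_sets[OF \<Lambda>.events_eq_borel refl])
  qed
  define \<gamma>' where "\<gamma>' = distr \<Lambda> (borel_on K) h'"
  show ?thesis
  proof (rule that[OF r])
    show "\<gamma>' \<in> prob_measures K"
      unfolding \<gamma>'_def using \<Lambda>.prob_space_axioms h' by (rule distr_in_prob_measures)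
    fix f :: "'a \<Rightarrow> real" assume f: "continuous_on K f"
    obtain c where c: "\<And>x. x \<in> K \<Longrightarrow> norm (f x) \<le> c"
      using compact_imp_bounded[OF compact_continuous_image[OF f K]] by (auto simp: bounded_iff)
    then have "c \<ge> 0" using k0 norm_ge_zero order_trans by blast
    have "continuous_on C (\<lambda>y. f (h y))"
      using continuous_on_compose2[OF f h_cont hK] .
    \<comment> \<open>Weak convergence on the line needs a bounded function continuous everywhere,
      whereas \<open>f \<circ> h\<close> is only given on \<open>C\<close>.\<close>
    then obtain g where g: "continuous_on UNIV g" "\<And>y. y \<in> C \<Longrightarrow> g y = f (h y)" "\<And>y. norm (g y) \<le> c"
      using Tietze[of C "\<lambda>y. f (h y)" UNIV c] C(1) c \<open>c \<ge> 0\<close> hK by (auto simp: image_subset_iff)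
    have [measurable]: "g \<in> borel_measurable borel" using g(1) by (rule borel_measurable_continuous_onI)
    have [measurable]: "f \<in> borel_measurable (borel_on K)"
      using f by (rule borel_measurable_continuous_on_restrict)
    have "(\<integral>y. g y \<partial>\<nu> n) = (\<integral>x. f x \<partial>\<gamma> n)" for n
    proof -
      have "(\<integral>y. g y \<partial>\<nu> n) = (\<integral>x. g (s x) \<partial>\<gamma> n)" unfolding \<nu>_def by (rule integral_distr) auto
      also have "\<dots> = (\<integral>x. f x \<partial>\<gamma> n)"
        using prob_measuresD(3)[OF \<gamma>[of n]] C(3) g(2) hs
        by (intro Bochner_Integration.integral_cong) auto
      finally show ?thesis .
    qed
    moreover have "(\<integral>y. g y \<partial>\<Lambda>) = (\<integral>x. f x \<partial>\<gamma>')"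
    proof -
      have "(\<integral>x. f x \<partial>\<gamma>') = (\<integral>y. f (h' y) \<partial>\<Lambda>)" unfolding \<gamma>'_def by (rule integral_distr) auto
      also have "\<dots> = (\<integral>y. g y \<partial>\<Lambda>)"
      proof (rule integral_cong_AE)
        show "(\<lambda>y. f (h' y)) \<in> borel_measurable \<Lambda>" by measurable
        show "AE y in \<Lambda>. f (h' y) = g y"
          using C_full by (rule eventually_mono) (simp add: h'_def g(2))
      qed auto
      finally show ?thesis by simp
    qed
    ultimately show "(\<lambda>n. \<integral>x. f x \<partial>\<gamma> (r n)) \<longlonglongrightarrow> (\<integral>x. f x \<partial>\<gamma>')"
      using conv_int[OF g(1,3)] by simp
  qed
qed

section \<open>Marginals, couplings and the static minimizer\<close>

lemma compact_power_set:
  fixes \<Omega> :: "(real^'d) set"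
  assumes "compact \<Omega>"
  shows "compact (power_set \<Omega> :: (real^'d^'k) set)"
proof -
  obtain C where C: "\<And>x. x \<in> \<Omega> \<Longrightarrow> norm x \<le> C"
    using compact_imp_bounded[OF assms] by (auto simp: bounded_iff)
  have "norm x \<le> CARD('k) * C" if "x \<in> power_set \<Omega>" for x :: "real^'d^'k"
  proof -
    have "norm x \<le> (\<Sum>l\<in>UNIV. norm (x $ l))"
      unfolding norm_vec_def by (rule L2_set_le_sum) simp
    also have "\<dots> \<le> (\<Sum>l\<in>(UNIV :: 'k set). C)"
      using that C by (intro sum_mono) (auto simp: power_set_def)
    finally show ?thesis by simp
  qed
  then have "bounded (power_set \<Omega> :: (real^'d^'k) set)" by (auto simp: bounded_iff)
  moreover have "closed (power_set \<Omega> :: (real^'d^'k) set)"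
  proof -
    have "power_set \<Omega> = (\<Inter>l. (\<lambda>x :: real^'d^'k. x $ l) -` \<Omega>)" by (auto simp: power_set_def)
    then show ?thesis
      using compact_imp_closed[OF assms]
      by (auto intro!: closed_vimage continuous_intros)
  qed
  ultimately show ?thesis by (simp add: compact_eq_bounded_closed)
qed

lemma convex_power_set:
  "convex \<Omega> \<Longrightarrow> convex (power_set \<Omega> :: (real^'d^'k) set)"
  by (auto simp: power_set_def convex_def)

lemma borel_measurable_vec_lambda:
  fixes f :: "'k::finite \<Rightarrow> 'a \<Rightarrow> real^'d"
  assumes "\<And>l. f l \<in> borel_measurable M"
  shows "(\<lambda>x. \<chi> l. f l x) \<in> borel_measurable M"
proof -
  have ax: "(axis l :: real^'d \<Rightarrow> real^'d^'k) \<in> borel_measurable borel" for l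
  proof (rule borel_measurable_continuous_onI)
    have "continuous_on UNIV (\<lambda>x :: real^'d. if i = l then x else 0)" for i
      by (cases "i = l") auto
    then have "continuous_on UNIV (\<lambda>x :: real^'d. \<chi> i. if i = l then x else 0)"
      by (rule continuous_on_vec_lambda)
    then show "continuous_on UNIV (axis l :: real^'d \<Rightarrow> real^'d^'k)"
      by (simp add: axis_def[abs_def])
  qed
  have "(\<lambda>x. \<chi> l. f l x) = (\<lambda>x. \<Sum>l\<in>UNIV. axis l (f l x))"
    by (simp add: fun_eq_iff vec_eq_iff axis_def if_distrib cong: if_cong)
  also have "\<dots> \<in> borel_measurable M"
    using measurable_compose[OF assms ax] by (intro borel_measurable_sum) auto
  finally show ?thesis .
qed

lemma measurable_vec_nth_power_set:
  assumes "M \<in> prob_measures (power_set \<Omega> :: (real^'d^'k) set)"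
  shows "(\<lambda>x. x $ l) \<in> measurable M (borel_on \<Omega>)"
proof (rule measurable_restrict_space2)
  show "(\<lambda>x. x $ l) \<in> space M \<rightarrow> \<Omega>"
    using prob_measuresD(3)[OF assms] by (auto simp: power_set_def)
  show "(\<lambda>x. x $ l) \<in> borel_measurable M"
    by (rule borel_measurable_prob_measures[OF assms]) (intro continuous_intros)
qed

lemma marginal_in_prob_measures:
  "M \<in> prob_measures (power_set \<Omega>) \<Longrightarrow> marginal \<Omega> l M \<in> prob_measures \<Omega>"
  unfolding marginal_def
  by (intro distr_in_prob_measures measurable_vec_nth_power_set prob_measuresD(1))

text \<open>The independent coupling is a witness: the product of the \<open>\<mu> l\<close>,
  carried from functions to vectors.\<close>

lemma couplings_nonempty:
  fixes \<Omega> :: "(real^'d) set" and \<mu> :: "'k::finite \<Rightarrow> (real^'d) measure"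
  assumes \<mu>: "\<And>l. \<mu> l \<in> prob_measures \<Omega>"
  shows "couplings \<Omega> \<mu> \<noteq> {}"
proof -
  define M where "M = PiM UNIV \<mu>"
  define T :: "('k \<Rightarrow> real^'d) \<Rightarrow> real^'d^'k" where "T \<omega> = (\<chi> l. \<omega> l)" for \<omega>
  have M: "prob_space M"
    unfolding M_def using prob_measuresD(1)[OF \<mu>] by (intro prob_space_PiM)
  have comp: "(\<lambda>\<omega>. \<omega> l) \<in> measurable M (\<mu> l)" for l
    unfolding M_def by (rule measurable_component_singleton) simp
  have T: "T \<in> measurable M (borel_on (power_set \<Omega>))"
  proof (rule measurable_restrict_space2)
    show "T \<in> space M \<rightarrow> power_set \<Omega>"
      using measurable_space[OF comp] prob_measuresD(3)[OF \<mu>] by (auto simp: T_def power_set_def)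
    have "(\<lambda>x. x) \<in> borel_measurable (\<mu> l)" for l
      by (rule borel_measurable_prob_measures[OF \<mu>]) (intro continuous_intros)
    then show "T \<in> borel_measurable M"
      unfolding T_def[abs_def] by (intro borel_measurable_vec_lambda) (rule measurable_compose[OF comp])
  qed
  have P: "distr M (borel_on (power_set \<Omega>)) T \<in> prob_measures (power_set \<Omega>)"
    using M T by (rule distr_in_prob_measures)
  have "marginal \<Omega> l (distr M (borel_on (power_set \<Omega>)) T) = \<mu> l" for l
  proof -
    have "marginal \<Omega> l (distr M (borel_on (power_set \<Omega>)) T) = distr M (borel_on \<Omega>) ((\<lambda>x. x $ l) \<circ> T)"
      unfolding marginal_def using measurable_vec_nth_power_set[OF P, of l] T
      by (subst distr_distr) auto
    also have "\<dots> = distr M (\<mu> l) (\<lambda>\<omega>. \<omega> l)"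
      using prob_measuresD(2)[OF \<mu>[of l]] by (intro distr_cong) (auto simp: T_def)
    also have "\<dots> = \<mu> l"
      unfolding M_def using prob_measuresD(1)[OF \<mu>] by (intro distr_PiM_component) auto
    finally show ?thesis .
  qed
  with P show ?thesis by (auto simp: couplings_def)
qed

text \<open>Integrals of continuous functions of a single coordinate pass to the limit, and they
  determine the marginals.\<close>

lemma couplings_closed_limit:
  fixes \<Omega> :: "(real^'d) set" and \<mu> :: "'k::finite \<Rightarrow> (real^'d) measure"
  assumes \<Omega>: "compact \<Omega>" and \<gamma>: "\<And>n. \<gamma> n \<in> couplings \<Omega> \<mu>"
    and \<gamma>': "\<gamma>' \<in> prob_measures (power_set \<Omega>)"
    and lim: "\<And>f :: real^'d^'k \<Rightarrow> real. continuous_on (power_set \<Omega>) f \<Longrightarrow>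
      (\<lambda>n. \<integral>x. f x \<partial>\<gamma> n) \<longlonglongrightarrow> (\<integral>x. f x \<partial>\<gamma>')"
  shows "\<gamma>' \<in> couplings \<Omega> \<mu>"
proof -
  have \<gamma>_prob: "\<gamma> n \<in> prob_measures (power_set \<Omega>)" and marg: "marginal \<Omega> l (\<gamma> n) = \<mu> l" for n l
    using \<gamma>[of n] by (auto simp: couplings_def)
  have "marginal \<Omega> l \<gamma>' = \<mu> l" for l
  proof (rule prob_measures_eqI)
    show "marginal \<Omega> l \<gamma>' \<in> prob_measures \<Omega>" using \<gamma>' by (rule marginal_in_prob_measures)
    show "\<mu> l \<in> prob_measures \<Omega>" using marginal_in_prob_measures[OF \<gamma>_prob[of 0]] marg by metis
    show "closed \<Omega>" using \<Omega> by (rule compact_imp_closed)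
    fix f :: "real^'d \<Rightarrow> real" assume f: "continuous_on UNIV f"
    have [measurable]: "f \<in> borel_measurable (borel_on \<Omega>)"
      using continuous_on_subset[OF f subset_UNIV] by (rule borel_measurable_continuous_on_restrict)
    have int: "(\<integral>x. f x \<partial>marginal \<Omega> l Q) = (\<integral>x. f (x $ l) \<partial>Q)"
      if "Q \<in> prob_measures (power_set \<Omega>)" for Q :: "(real^'d^'k) measure"
      unfolding marginal_def using measurable_vec_nth_power_set[OF that, of l]
      by (rule integral_distr) measurable
    have "(\<lambda>n. \<integral>x. f (x $ l) \<partial>\<gamma> n) \<longlonglongrightarrow> (\<integral>x. f (x $ l) \<partial>\<gamma>')"
      by (rule lim) (intro continuous_on_compose2[OF f] continuous_intros, auto)
    moreover have "(\<integral>x. f (x $ l) \<partial>\<gamma> n) = (\<integral>x. f x \<partial>\<mu> l)" for n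
      using int[OF \<gamma>_prob[of n]] marg by simp
    ultimately have "(\<integral>x. f (x $ l) \<partial>\<gamma>') = (\<integral>x. f x \<partial>\<mu> l)"
      by (simp add: LIMSEQ_const_iff)
    then show "(\<integral>x. f x \<partial>marginal \<Omega> l \<gamma>') = (\<integral>x. f x \<partial>\<mu> l)"
      using int[OF \<gamma>'] by simp
  qed
  with \<gamma>' show ?thesis by (simp add: couplings_def)
qed

lemma static_minimizer_exists:
  fixes \<Omega> :: "(real^'d) set" and \<mu> :: "'k::finite \<Rightarrow> (real^'d) measure" and L :: "real^'d^'k \<Rightarrow> real"
  assumes \<Omega>: "compact \<Omega>" and \<mu>: "\<And>l. \<mu> l \<in> prob_measures \<Omega>" and L: "continuous_on UNIV L"
  shows "\<exists>\<gamma>. is_arg_min (static_cost L) (\<lambda>\<gamma>. \<gamma> \<in> couplings \<Omega> \<mu>) \<gamma>"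
proof -
  let ?K = "power_set \<Omega> :: (real^'d^'k) set"
  let ?C = "static_cost L ` couplings \<Omega> \<mu>"
  have K: "compact ?K" using \<Omega> by (rule compact_power_set)
  have LK: "continuous_on ?K L" using L continuous_on_subset by blast
  obtain c where c: "\<And>x. x \<in> ?K \<Longrightarrow> norm (L x) \<le> c"
    using compact_imp_bounded[OF compact_continuous_image[OF LK K]] by (auto simp: bounded_iff)
  have "- c \<le> static_cost L \<gamma>" if "\<gamma> \<in> couplings \<Omega> \<mu>" for \<gamma>
  proof -
    have \<gamma>: "\<gamma> \<in> prob_measures ?K" using that by (simp add: couplings_def)
    interpret prob_space \<gamma> using prob_measuresD(1)[OF \<gamma>] .
    show ?thesis
      unfolding static_cost_def using c prob_measuresD(3)[OF \<gamma>]
      by (intro integral_ge_const integrable_prob_measures[OF \<gamma> LK K] AE_I2) (fastforce simp: abs_le_iff)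
  qed
  then have bdd: "bdd_below ?C" by (auto simp: bdd_below_def)
  have ne: "?C \<noteq> {}" using couplings_nonempty[OF \<mu>] by simp
  have "\<exists>\<gamma>. \<gamma> \<in> couplings \<Omega> \<mu> \<and> static_cost L \<gamma> < Inf ?C + 1 / Suc n" for n
  proof -
    have "Inf ?C < Inf ?C + 1 / Suc n" by simp
    then show ?thesis using cInf_less_iff[OF ne bdd] by blast
  qed
  then obtain \<gamma> where \<gamma>: "\<And>n. \<gamma> n \<in> couplings \<Omega> \<mu>" "\<And>n. static_cost L (\<gamma> n) < Inf ?C + 1 / Suc n"
    by metis
  have "\<And>n. \<gamma> n \<in> prob_measures ?K" using \<gamma>(1) by (simp add: couplings_def)
  then obtain r \<gamma>' where r: "strict_mono (r :: nat \<Rightarrow> nat)" and \<gamma>': "\<gamma>' \<in> prob_measures ?K"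
    and lim: "\<And>f :: real^'d^'k \<Rightarrow> real. continuous_on ?K f \<Longrightarrow> (\<lambda>n. \<integral>x. f x \<partial>\<gamma> (r n)) \<longlonglongrightarrow> (\<integral>x. f x \<partial>\<gamma>')"
    using prob_measures_sequentially_compact[OF K, of \<gamma>] by blast
  have coup: "\<gamma>' \<in> couplings \<Omega> \<mu>"
    using \<Omega> \<gamma>(1) \<gamma>' lim by (rule couplings_closed_limit[where \<gamma>="\<lambda>n. \<gamma> (r n)"])
  have "static_cost L \<gamma>' \<le> Inf ?C"
  proof (rule LIMSEQ_le)
    show "(\<lambda>n. static_cost L (\<gamma> (r n))) \<longlonglongrightarrow> static_cost L \<gamma>'"
      unfolding static_cost_def by (rule lim[OF LK])
    show "(\<lambda>n. Inf ?C + 1 / Suc (r n)) \<longlonglongrightarrow> Inf ?C"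
      using tendsto_add[OF tendsto_const LIMSEQ_subseq_LIMSEQ[OF LIMSEQ_inverse_real_of_nat r], of "Inf ?C"]
      by (simp add: comp_def inverse_eq_divide)
  qed (use \<gamma>(2) in \<open>auto intro: less_imp_le\<close>)
  then have "static_cost L \<gamma>' \<le> static_cost L \<gamma>''" if "\<gamma>'' \<in> couplings \<Omega> \<mu>" for \<gamma>''
    using cInf_lower[OF imageI[OF that] bdd] by (rule order_trans)
  with coup show ?thesis by (intro exI[of _ \<gamma>']) (auto simp: is_arg_min_def not_less)
qed

section \<open>The lower bound on the dynamical cost\<close>

lemma nn_integral_cmult_le_nonmeasurable:
  fixes F :: "'a \<Rightarrow> ennreal"
  assumes c: "c < \<infinity>"
  shows "(\<integral>\<^sup>+x. c * F x \<partial>M) \<le> c * (\<integral>\<^sup>+x. F x \<partial>M)"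
proof (cases "c = 0")
  case False
  show ?thesis
    unfolding nn_integral_def[of M "\<lambda>x. c * F x"]
  proof (rule SUP_least)
    fix s assume "s \<in> {g. simple_function M g \<and> g \<le> (\<lambda>x. c * F x)}"
    then have s: "simple_function M s" "\<And>x. s x \<le> c * F x" by (auto simp: le_fun_def)
    have [measurable]: "s \<in> borel_measurable M" using s(1) by (rule borel_measurable_simple_function)
    have eq: "c * (s x / c) = s x" for x
      using False c by (simp add: ennreal_times_divide mult.commute[of c] mult_divide_eq_ennreal less_top[symmetric])
    have "integral\<^sup>S M s = (\<integral>\<^sup>+x. c * (s x / c) \<partial>M)"
      using s(1) by (simp add: eq nn_integral_eq_simple_integral)
    also have "\<dots> = c * (\<integral>\<^sup>+x. s x / c \<partial>M)" by (rule nn_integral_cmult) simp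
    also have "\<dots> \<le> c * (\<integral>\<^sup>+x. F x \<partial>M)"
    proof (intro mult_left_mono nn_integral_mono)
      fix x
      have "s x / c \<le> c * F x / c" using s(2) by (rule divide_right_mono_ennreal)
      also have "\<dots> = F x"
        using False c by (simp add: mult.commute[of c] mult_divide_eq_ennreal less_top[symmetric])
      finally show "s x / c \<le> F x" .
    qed simp
    finally show "integral\<^sup>S M s \<le> c * (\<integral>\<^sup>+x. F x \<partial>M)" .
  qed
qed simp

text \<open>A subtraction-free form of integrating \<open>P + f \<le> Q\<close> when
  \<open>P\<close> and \<open>Q\<close> may be infinite and non-measurable. Hypothesis and
  conclusion have the same shape, so the lemma can be iterated over space and time.\<close>

lemma nn_integral_le_shift_nonmeasurable:
  fixes P Q :: "'a \<Rightarrow> ennreal"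
  assumes f: "integrable M f"
    and le: "\<And>x. x \<in> space M \<Longrightarrow> P x + ennreal (f x) \<le> Q x + ennreal (- f x)"
  shows "(\<integral>\<^sup>+x. P x \<partial>M) + ennreal (\<integral>x. f x \<partial>M) \<le> (\<integral>\<^sup>+x. Q x \<partial>M) + ennreal (- (\<integral>x. f x \<partial>M))"
proof -
  have [measurable]: "f \<in> borel_measurable M" using f by simp
  have ineq: "(\<integral>\<^sup>+x. P x \<partial>M) + (\<integral>\<^sup>+x. ennreal (f x) \<partial>M) \<le> (\<integral>\<^sup>+x. Q x \<partial>M) + (\<integral>\<^sup>+x. ennreal (- f x) \<partial>M)"
    by (rule nn_integral_add_mono_nonmeasurable) (use le in auto)
  obtain p n where pn: "0 \<le> p" "0 \<le> n" "(\<integral>\<^sup>+x. ennreal (f x) \<partial>M) = ennreal p"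
      "(\<integral>\<^sup>+x. ennreal (- f x) \<partial>M) = ennreal n" "(\<integral>x. f x \<partial>M) = p - n"
    using f by (elim integrableE) metis
  have shift: "A + ennreal (p - n) \<le> B + ennreal (- (p - n))" if "A + ennreal p \<le> B + ennreal n" for A B :: ennreal
  proof (cases "A = top \<or> B = top")
    case True
    then show ?thesis using that by (auto simp: top_unique ennreal_add_eq_top)
  next
    case False
    then obtain a b where ab: "A = ennreal a" "B = ennreal b" "0 \<le> a" "0 \<le> b"
      by (metis ennreal_cases)
    have "a + p \<le> b + n" using that pn(1,2) ab by (simp add: ennreal_plus[symmetric] del: ennreal_plus)
    then show ?thesis
      using ab by (cases "p \<le> n") (auto simp: ennreal_neg ennreal_plus[symmetric] simp del: ennreal_plus)
  qed
  show ?thesis using ineq unfolding pn by (rule shift)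
qed

lemma ereal_le_enn2ereal_diff:
  assumes "A + ennreal c \<le> B + ennreal (- c)" "A < \<infinity>"
  shows "ereal c \<le> enn2ereal B - enn2ereal A"
proof (cases "B = top")
  case True
  then show ?thesis using assms(2) by (cases A) (auto simp: enn2ereal_ennreal)
next
  case False
  obtain a b where ab: "A = ennreal a" "B = ennreal b" "0 \<le> a" "0 \<le> b"
    using False assms(2) by (metis ennreal_cases infinity_ennreal_def less_irrefl)
  have "c \<le> b - a"
    using assms(1) ab by (cases "c \<ge> 0") (auto simp: ennreal_neg ennreal_plus[symmetric] simp del: ennreal_plus)
  then show ?thesis using ab by (simp add: enn2ereal_ennreal)
qed

lemma enn2ereal_diff_le_ereal:
  assumes "B + ennreal (- c) \<le> A + ennreal c" "A < \<infinity>"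
  shows "enn2ereal B - enn2ereal A \<le> ereal c"
proof -
  have "B < top" using assms by (auto simp: less_top[symmetric] top_unique)
  then obtain a b where ab: "A = ennreal a" "B = ennreal b" "0 \<le> a" "0 \<le> b"
    using assms(2) by (metis ennreal_cases infinity_ennreal_def less_irrefl)
  have "b - a \<le> c"
    using assms(1) ab by (cases "c \<ge> 0") (auto simp: ennreal_neg ennreal_plus[symmetric] simp del: ennreal_plus)
  then show ?thesis using ab by (simp add: enn2ereal_ennreal)
qed

section \<open>Time integrals and weakly continuous flows\<close>

lemma dynamical_cost_restrict:
  "dynamical_cost L (\<pi>, m) =
     enn2ereal (\<integral>\<^sup>+t. (\<integral>\<^sup>+x. ennreal (L (vm_RN_deriv (\<pi> t) (m t) x)) \<partial>\<pi> t) \<partial>restrict_space lborel {0..1}) -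
     enn2ereal (\<integral>\<^sup>+t. (\<integral>\<^sup>+x. ennreal (- L (vm_RN_deriv (\<pi> t) (m t) x)) \<partial>\<pi> t) \<partial>restrict_space lborel {0..1})"
  by (simp add: dynamical_cost_def nn_integral_restrict_space)

lemma set_integral_restrict:
  fixes f :: "real \<Rightarrow> 'a::{banach, second_countable_topology}"
  shows "(LINT t:{0..1}|lborel. f t) = (\<integral>t. f t \<partial>restrict_space lborel {0..1})"
  by (simp add: set_lebesgue_integral_def integral_restrict_space)

lemma prob_space_unit_interval: "prob_space (restrict_space lborel {0..1::real})"
  by (rule prob_spaceI) (simp add: emeasure_restrict_space space_restrict_space)

lemma space_unit_interval: "space (restrict_space lborel {0..1::real}) = {0..1}"
  by (simp add: space_restrict_space)

lemma topspace_weak_topology: "topspace (weak_topology S) \<subseteq> prob_measures S"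
  by (auto simp: weak_topology_def topology_generated_by_topspace)

lemma continuous_map_weak_integral:
  assumes "continuous_on S f" "bounded (f ` S)"
  shows "continuous_map (weak_topology S) euclideanreal (\<lambda>M. \<integral>x. f x \<partial>M)"
  unfolding continuous_map_def
proof (intro conjI allI impI)
  fix U :: "real set" assume U: "openin euclideanreal U"
  have "openin (weak_topology S) {M \<in> prob_measures S. (\<integral>x. f x \<partial>M) \<in> U}"
    unfolding weak_topology_def
    by (rule topology_generated_by_Basis) (use assms U in auto)
  moreover from openin_subset[OF this]
  have "{M \<in> topspace (weak_topology S). (\<integral>x. f x \<partial>M) \<in> U} = {M \<in> prob_measures S. (\<integral>x. f x \<partial>M) \<in> U}"
    using topspace_weak_topology by blast
  ultimately show "openin (weak_topology S) {M \<in> topspace (weak_topology S). (\<integral>x. f x \<partial>M) \<in> U}" by simp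
qed auto

lemma weak_flow_prob_measures:
  assumes "continuous_map (top_of_set {0..1}) (weak_topology S) \<pi>" "t \<in> {0..1::real}"
  shows "\<pi> t \<in> prob_measures S"
  using continuous_map_image_subset_topspace[OF assms(1)] assms(2) topspace_weak_topology by fastforce

lemma weak_flow_continuous:
  assumes \<pi>: "continuous_map (top_of_set {0..1}) (weak_topology S) \<pi>" and S: "compact S" and f: "continuous_on S f"
  shows "continuous_on {0..1::real} (\<lambda>t. \<integral>x. f x \<partial>\<pi> t :: real)"
  using continuous_map_compose[OF \<pi> continuous_map_weak_integral[OF f compact_imp_bounded[OF compact_continuous_image[OF f S]]]]
  by (simp add: comp_def)

text \<open>Half of \<open>e\<close> pays for changing the integrand, by uniform continuity on the
  compact cylinder, and half for changing the measure under a frozen integrand.\<close>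

lemma weak_flow_continuous_time_dependent:
  fixes g :: "real \<times> 'a::metric_space \<Rightarrow> real"
  assumes \<pi>: "continuous_map (top_of_set {0..1}) (weak_topology S) \<pi>" and S: "compact S"
    and g: "continuous_on ({0..1} \<times> S) g"
  shows "continuous_on {0..1::real} (\<lambda>t. \<integral>x. g (t, x) \<partial>\<pi> t)"
  unfolding continuous_on_iff
proof (intro ballI allI impI)
  fix s e :: real assume s: "s \<in> {0..1}" and e: "e > 0"
  have gt: "continuous_on S (\<lambda>x. g (t, x))" if "t \<in> {0..1}" for t
    using that by (intro continuous_on_compose2[OF g] continuous_intros) auto
  have "uniformly_continuous_on ({0..1} \<times> S) g"
    using g S by (intro compact_uniformly_continuous compact_Times) auto
  then obtain d1 where d1: "d1 > 0"
      "\<And>z z'. z \<in> {0..1} \<times> S \<Longrightarrow> z' \<in> {0..1} \<times> S \<Longrightarrow> dist z' z < d1 \<Longrightarrow> dist (g z') (g z) < e / 2"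
    unfolding uniformly_continuous_on_def using e by (metis half_gt_zero)
  obtain d2 where d2: "d2 > 0"
      "\<And>t. t \<in> {0..1} \<Longrightarrow> dist t s < d2 \<Longrightarrow> dist (\<integral>x. g (s, x) \<partial>\<pi> t) (\<integral>x. g (s, x) \<partial>\<pi> s) < e / 2"
    using weak_flow_continuous[OF \<pi> S gt[OF s], unfolded continuous_on_iff] s e by (metis half_gt_zero)
  have "dist (\<integral>x. g (t, x) \<partial>\<pi> t) (\<integral>x. g (s, x) \<partial>\<pi> s) < e" if t: "t \<in> {0..1}" "dist t s < min d1 d2" for t
  proof -
    have pt: "\<pi> t \<in> prob_measures S" by (rule weak_flow_prob_measures[OF \<pi> t(1)])
    interpret prob_space "\<pi> t" using prob_measuresD(1)[OF pt] .
    have i: "integrable (\<pi> t) (\<lambda>x. g (t, x))" "integrable (\<pi> t) (\<lambda>x. g (s, x))"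
      using integrable_prob_measures[OF pt gt S] t(1) s by auto
    have "norm (\<integral>x. g (t, x) - g (s, x) \<partial>\<pi> t) \<le> (\<integral>x. norm (g (t, x) - g (s, x)) \<partial>\<pi> t)"
      by (rule integral_norm_bound)
    also have "\<dots> \<le> (\<integral>x. e / 2 \<partial>\<pi> t)"
    proof (rule integral_mono)
      fix x assume "x \<in> space (\<pi> t)"
      then have "dist (g (t, x)) (g (s, x)) < e / 2"
        using t s prob_measuresD(3)[OF pt] by (intro d1(2)) (auto simp: dist_Pair_Pair)
      then show "norm (g (t, x) - g (s, x)) \<le> e / 2" by (simp add: dist_norm)
    qed (use i in auto)
    finally have "dist (\<integral>x. g (t, x) \<partial>\<pi> t) (\<integral>x. g (s, x) \<partial>\<pi> t) \<le> e / 2"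
      using i by (simp add: dist_norm prob_space)
    moreover have "dist (\<integral>x. g (s, x) \<partial>\<pi> t) (\<integral>x. g (s, x) \<partial>\<pi> s) < e / 2"
      using t by (intro d2(2)) auto
    ultimately show ?thesis using dist_triangle[of "\<integral>x. g (t, x) \<partial>\<pi> t" "\<integral>x. g (s, x) \<partial>\<pi> s" "\<integral>x. g (s, x) \<partial>\<pi> t"] by linarith
  qed
  then show "\<exists>d>0. \<forall>t\<in>{0..1}. dist t s < d \<longrightarrow> dist (\<integral>x. g (t, x) \<partial>\<pi> t) (\<integral>x. g (s, x) \<partial>\<pi> s) < e"
    using d1(1) d2(1) by (intro exI[of _ "min d1 d2"]) auto
qed

text \<open>The separately chosen densities carry no information about measurability in
  \<open>t\<close>. Approximating \<open>g\<close> by simple functions on the cylinder turns the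
  integral into a limit of combinations of values of \<open>m t\<close> on slices, and
  \<open>time_vector_measure\<close> makes these measurable in \<open>t\<close>.\<close>

lemma measurable_flux_integral:
  fixes S :: "'a::euclidean_space set"
  assumes \<pi>: "\<And>t. t \<in> {0..1} \<Longrightarrow> \<pi> t \<in> prob_measures S" and S: "compact S"
    and m: "time_vector_measure S m"
    and ac: "\<And>t. t \<in> {0..1} \<Longrightarrow> vm_absolutely_continuous (\<pi> t) (m t)"
    and g: "continuous_on ({0..1} \<times> S) g"
  shows "(\<lambda>t. \<integral>x. g (t, x) \<bullet> vm_RN_deriv (\<pi> t) (m t) x \<partial>\<pi> t) \<in> borel_measurable (restrict_space lborel {0..1})"
proof -
  let ?I = "restrict_space lborel {0..1::real}" and ?v = "\<lambda>t. vm_RN_deriv (\<pi> t) (m t)"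
  let ?M = "borel_on ({0..1} \<times> S) :: (real \<times> 'a) measure"
  have "compact ({0..1::real} \<times> S)" using S by (intro compact_Times) auto
  from compact_imp_bounded[OF compact_continuous_image[OF g this]]
  obtain C where C: "\<And>z. z \<in> {0..1} \<times> S \<Longrightarrow> norm (g z) \<le> C" by (auto simp: bounded_iff)
  have vm: "vector_measure (\<pi> t) (m t)" if "t \<in> {0..1}" for t
    using m that prob_measuresD(2)[OF \<pi>[OF that]] by (simp add: time_vector_measure_def vector_measure_def)
  have v: "integrable (\<pi> t) (?v t)" "\<And>A. A \<in> sets (\<pi> t) \<Longrightarrow> (LINT x:A|\<pi> t. ?v t x) = m t A" if "t \<in> {0..1}" for t
  proof -
    have fin: "finite_measure (\<pi> t)"
      using prob_measuresD(1)[OF \<pi>[OF that]] by (rule prob_space.axioms(1))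
    show "integrable (\<pi> t) (?v t)" by (rule integrable_vm_RN_deriv[OF fin vm[OF that] ac[OF that]])
    show "\<And>A. A \<in> sets (\<pi> t) \<Longrightarrow> (LINT x:A|\<pi> t. ?v t x) = m t A"
      by (rule set_integral_vm_RN_deriv[OF fin vm[OF that] ac[OF that]])
  qed
  have gM: "g \<in> borel_measurable ?M" using g by (rule borel_measurable_continuous_on_restrict)
  have "\<And>z. z \<in> space ?M \<Longrightarrow> norm (g z) \<le> C" using C by (simp add: space_restrict_space)
  from bounded_simple_approx[OF gM this] obtain s where
    s: "\<And>n. simple_function ?M (s n)" "\<And>z. z \<in> space ?M \<Longrightarrow> (\<lambda>n. s n z) \<longlonglongrightarrow> g z"
      "\<And>n z. z \<in> space ?M \<Longrightarrow> norm (s n z) \<le> 2 * C"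
    by blast
  define F where "F n = s n ` space ?M" for n
  define B where "B n c = s n -` {c} \<inter> space ?M" for n c
  have B: "B n c \<in> sets ?M" for n c
    unfolding B_def using s(1)[of n] by (rule simple_functionD)
  show ?thesis
  proof (rule borel_measurable_LIMSEQ_real)
    show "(\<lambda>t. \<Sum>c\<in>F n. c \<bullet> m t (Pair t -` B n c)) \<in> borel_measurable ?I" for n
    proof (intro borel_measurable_sum borel_measurable_inner borel_measurable_const)
      fix c
      have "set_integrable lborel {0..1} (\<lambda>t. m t (Pair t -` B n c))"
        using m B by (simp add: time_vector_measure_def)
      then have "integrable ?I (\<lambda>t. m t (Pair t -` B n c))"
        by (simp add: set_integrable_def integrable_restrict_space)
      then show "(\<lambda>t. m t (Pair t -` B n c)) \<in> borel_measurable ?I" by (rule borel_measurable_integrable)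
    qed
    fix t assume "t \<in> space ?I"
    then have t: "t \<in> {0..1}" by (simp add: space_unit_interval)
    have T: "Pair t \<in> measurable (\<pi> t) ?M"
    proof (rule measurable_restrict_space2)
      show "Pair t \<in> space (\<pi> t) \<rightarrow> {0..1} \<times> S" using t prob_measuresD(3)[OF \<pi>[OF t]] by auto
      show "Pair t \<in> borel_measurable (\<pi> t)"
        by (rule borel_measurable_prob_measures[OF \<pi>[OF t]]) (intro continuous_intros)
    qed
    have "B n c \<subseteq> {0..1} \<times> S" for n c
      using sets.sets_into_space[OF B] by (simp add: space_restrict_space)
    then have sub: "Pair t -` B n c \<inter> space (\<pi> t) = Pair t -` B n c" for n c
      using prob_measuresD(3)[OF \<pi>[OF t]] by blast
    have "(LINT w:Pair t -` B n c \<inter> space (\<pi> t)|\<pi> t. ?v t w) = m t (Pair t -` B n c)" for n c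
      using v(2)[OF t measurable_sets[OF T B]] by (simp only: sub)
    then show "(\<lambda>n. \<Sum>c\<in>F n. c \<bullet> m t (Pair t -` B n c)) \<longlonglongrightarrow> (\<integral>x. g (t, x) \<bullet> ?v t x \<partial>\<pi> t)"
      using integral_simple_approx_tendsto[OF s T v(1)[OF t]] by (simp only: F_def B_def)
  qed
qed

text \<open>
  The perspective function solves the Hamilton--Jacobi inequality
  \<open>\<partial>\<^sub>t \<eta> + \<nabla>\<eta> \<bullet> v \<le> L v\<close> whenever \<open>G\<close> has its tangents below \<open>L\<close>; the shift by \<open>\<epsilon>\<close> removes the
  singularity at time 0.
\<close>

lemma C1_on_cylinder_perspective:
  fixes G :: "'a::euclidean_space \<Rightarrow> real"
  assumes G: "\<And>x. (G has_derivative (\<lambda>h. D x \<bullet> h)) (at x)" and D: "continuous_on UNIV D" and e: "\<epsilon> > 0"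
  defines "y \<equiv> \<lambda>z :: real \<times> 'a. (1 / (fst z + \<epsilon>)) *\<^sub>R snd z"
  shows "C1_on_cylinder S (\<lambda>z. (fst z + \<epsilon>) * G (y z)) (\<lambda>z. G (y z) - D (y z) \<bullet> y z) (\<lambda>z. D (y z))"
proof -
  have contG: "continuous_on UNIV G"
    using G by (meson continuous_at_imp_continuous_on has_derivative_continuous)
  have pos: "fst z + \<epsilon> > 0" if "z \<in> {0..1} \<times> S" for z using that e by auto
  have y: "continuous_on ({0..1} \<times> S) y"
    unfolding y_def using pos by (intro continuous_intros) (auto simp: less_imp_neq[symmetric])
  have Dy: "continuous_on ({0..1} \<times> S) (\<lambda>z. D (y z))" and Gy: "continuous_on ({0..1} \<times> S) (\<lambda>z. G (y z))"
    by (rule continuous_on_compose2[OF D y], simp, rule continuous_on_compose2[OF contG y], simp)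
  have deriv: "((\<lambda>z. (fst z + \<epsilon>) * G (y z)) has_derivative
      (\<lambda>(s, h). s * (G (y z) - D (y z) \<bullet> y z) + D (y z) \<bullet> h)) (at z)" if z: "z \<in> {0..1} \<times> S" for z
  proof -
    let ?a = "fst z + \<epsilon>"
    have a: "?a > 0" using pos[OF z] .
    have dy: "(y has_derivative (\<lambda>w. (1 / ?a) *\<^sub>R snd w - (fst w / ?a) *\<^sub>R y z)) (at z)"
      unfolding y_def using a
      by (auto intro!: derivative_eq_intros simp: fun_eq_iff power2_eq_square divide_simps)
    have "((\<lambda>z. G (y z)) has_derivative (\<lambda>w. D (y z) \<bullet> ((1 / ?a) *\<^sub>R snd w - (fst w / ?a) *\<^sub>R y z))) (at z)"
      by (rule has_derivative_compose[OF dy G])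
    then have "((\<lambda>z. (fst z + \<epsilon>) * G (y z)) has_derivative
       (\<lambda>w. ?a * (D (y z) \<bullet> ((1 / ?a) *\<^sub>R snd w - (fst w / ?a) *\<^sub>R y z)) + fst w * G (y z))) (at z)"
      by (auto intro!: derivative_eq_intros)
    moreover have "?a * (D (y z) \<bullet> ((1 / ?a) *\<^sub>R snd w - (fst w / ?a) *\<^sub>R y z)) + fst w * G (y z)
        = (case w of (s, h) \<Rightarrow> s * (G (y z) - D (y z) \<bullet> y z) + D (y z) \<bullet> h)" for w
    proof -
      have "?a * (D (y z) \<bullet> ((1 / ?a) *\<^sub>R snd w - (fst w / ?a) *\<^sub>R y z)) = D (y z) \<bullet> snd w - fst w * (D (y z) \<bullet> y z)"
        using a by (simp only: inner_diff_right right_diff_distrib inner_scaleR_right) simp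
      then show ?thesis by (cases w) (simp add: right_diff_distrib)
    qed
    ultimately show ?thesis by (simp add: fun_eq_iff)
  qed
  show ?thesis
    unfolding C1_on_cylinder_def
  proof (intro conjI ballI)
    show "continuous_on ({0..1} \<times> S) (\<lambda>z. G (y z) - D (y z) \<bullet> y z)"
      by (intro continuous_on_diff continuous_on_inner Gy Dy y)
  qed (rule Dy, rule has_derivative_at_withinI[OF deriv])
qed

lemma ennreal_parts_mono:
  "a \<le> b \<Longrightarrow> ennreal (- b) + ennreal a \<le> ennreal b + ennreal (- a)"
  by (cases "0 \<le> a"; cases "0 \<le> b") (auto simp: ennreal_neg intro: ennreal_leI)

text \<open>Rests on \<open>norm v \<le> 1 + norm v powr r\<close>. It serves two quantities of at
  most linear growth in the velocity: the negative part of the cost and the flux term.\<close>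

lemma nn_integral_finite_of_moment:
  fixes v :: "'t \<Rightarrow> 'a \<Rightarrow> 'b::euclidean_space"
  assumes I: "prob_space I" and \<pi>: "\<And>t. t \<in> space I \<Longrightarrow> prob_space (\<pi> t)"
    and v: "\<And>t. t \<in> space I \<Longrightarrow> v t \<in> borel_measurable (\<pi> t)" and r: "r > 1"
    and fin: "(\<integral>\<^sup>+t. (\<integral>\<^sup>+x. ennreal (norm (v t x) powr r) \<partial>\<pi> t) \<partial>I) < \<infinity>"
    and f: "\<And>t. t \<in> space I \<Longrightarrow> f t \<le> ennreal C + ennreal C * (\<integral>\<^sup>+x. ennreal (norm (v t x)) \<partial>\<pi> t)"
  shows "(\<integral>\<^sup>+t. f t \<partial>I) < \<infinity>"
proof -
  let ?R = "\<lambda>t. \<integral>\<^sup>+x. ennreal (norm (v t x) powr r) \<partial>\<pi> t"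
  interpret I: prob_space I by fact
  have le: "f t + 0 \<le> ennreal C * ?R t + (ennreal C + ennreal C)" if t: "t \<in> space I" for t
  proof -
    interpret prob_space "\<pi> t" using \<pi>[OF t] .
    note [measurable] = v[OF t]
    have "ennreal (norm (v t x)) \<le> 1 + ennreal (norm (v t x) powr r)" for x
    proof -
      have "norm (v t x) \<le> 1 + norm (v t x) powr r"
      proof (cases "norm (v t x) \<le> 1")
        case False
        then have "norm (v t x) powr 1 \<le> norm (v t x) powr r" using r by (intro powr_mono) auto
        then show ?thesis using False by simp
      qed (simp add: add_increasing2)
      then have "ennreal (norm (v t x)) \<le> ennreal (1 + norm (v t x) powr r)" by (rule ennreal_leI)
      then show ?thesis by simp
    qed
    then have "(\<integral>\<^sup>+x. ennreal (norm (v t x)) \<partial>\<pi> t) \<le> (\<integral>\<^sup>+x. 1 + ennreal (norm (v t x) powr r) \<partial>\<pi> t)"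
      by (intro nn_integral_mono)
    also have "\<dots> = 1 + ?R t" by (subst nn_integral_add) (auto simp: emeasure_space_1)
    finally have "ennreal C * (\<integral>\<^sup>+x. ennreal (norm (v t x)) \<partial>\<pi> t) \<le> ennreal C * (1 + ?R t)"
      by (rule mult_left_mono) simp
    with f[OF t] have "f t \<le> ennreal C + ennreal C * (1 + ?R t)"
      by (meson add_left_mono order_trans)
    then show ?thesis by (simp add: distrib_left add_ac)
  qed
  have "(\<integral>\<^sup>+t. f t \<partial>I) + (\<integral>\<^sup>+t. 0 \<partial>I) \<le> (\<integral>\<^sup>+t. ennreal C * ?R t \<partial>I) + (\<integral>\<^sup>+t. ennreal C + ennreal C \<partial>I)"
    by (rule nn_integral_add_mono_nonmeasurable) (use le in auto)
  also have "\<dots> \<le> ennreal C * (\<integral>\<^sup>+t. ?R t \<partial>I) + (ennreal C + ennreal C)"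
    by (intro add_mono nn_integral_cmult_le_nonmeasurable) (auto simp: I.emeasure_space_1)
  also have "\<dots> < \<infinity>" using fin by (auto simp: ennreal_mult_less_top)
  finally show ?thesis by simp
qed

text \<open>Weak duality: integrated along the flow, the left side of \<open>sub\<close> becomes the
  boundary terms of the continuity equation. The cost may be infinite, but its negative part is
  finite, so the bound survives the subtraction in its definition.\<close>

lemma dynamical_cost_ge_test_function:
  fixes S :: "'a::euclidean_space set" and \<eta> :: "real \<times> 'a \<Rightarrow> real"
  assumes S: "compact S" and L: "convex_on UNIV L"
    and \<pi>: "continuous_map (top_of_set {0..1}) (weak_topology S) \<pi>"
    and m: "time_vector_measure S m"
    and ac: "\<And>t. t \<in> {0..1} \<Longrightarrow> vm_absolutely_continuous (\<pi> t) (m t)"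
    and r: "r > 1" and fin: "(\<integral>\<^sup>+t\<in>{0..1}. (\<integral>\<^sup>+x. ennreal (norm (vm_RN_deriv (\<pi> t) (m t) x) powr r) \<partial>\<pi> t) \<partial>lborel) < \<infinity>"
    and ce: "continuity_equation S \<pi> m"
    and \<eta>: "C1_on_cylinder S \<eta> \<eta>t \<eta>x"
    and sub: "\<And>z v. z \<in> {0..1} \<times> S \<Longrightarrow> \<eta>t z + \<eta>x z \<bullet> v \<le> L v"
  shows "ereal ((\<integral>x. \<eta> (1, x) \<partial>\<pi> 1) - (\<integral>x. \<eta> (0, x) \<partial>\<pi> 0)) \<le> dynamical_cost L (\<pi>, m)"
proof -
  define I where "I = restrict_space lborel {0..1::real}"
  interpret I: prob_space I unfolding I_def by (rule prob_space_unit_interval)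
  have sI: "space I = {0..1}" by (simp add: I_def space_unit_interval)
  define v where "v t = vm_RN_deriv (\<pi> t) (m t)" for t
  define F where "F t = (\<integral>\<^sup>+x. ennreal (L (v t x)) \<partial>\<pi> t)" for t
  define H where "H t = (\<integral>\<^sup>+x. ennreal (- L (v t x)) \<partial>\<pi> t)" for t
  define a where "a t = (\<integral>x. \<eta>t (t, x) \<partial>\<pi> t)" for t
  define b where "b t = (\<integral>x. \<eta>x (t, x) \<bullet> v t x \<partial>\<pi> t)" for t
  have \<eta>t: "continuous_on ({0..1} \<times> S) \<eta>t" and \<eta>x: "continuous_on ({0..1} \<times> S) \<eta>x"
    using \<eta> by (auto simp: C1_on_cylinder_def)
  have cyl: "compact ({0..1::real} \<times> S)" using S by (intro compact_Times) auto
  have \<pi>_prob: "\<pi> t \<in> prob_measures S" if "t \<in> {0..1}" for t by (rule weak_flow_prob_measures[OF \<pi> that])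
  have v: "integrable (\<pi> t) (v t)" if t: "t \<in> {0..1}" for t
    unfolding v_def
  proof (rule integrable_vm_RN_deriv)
    show "finite_measure (\<pi> t)"
      using prob_measuresD(1)[OF \<pi>_prob[OF t]] by (rule prob_space.axioms(1))
    show "vector_measure (\<pi> t) (m t)"
      using m t prob_measuresD(2)[OF \<pi>_prob[OF t]] by (simp add: time_vector_measure_def vector_measure_def)
  qed (rule ac[OF t])
  have fin': "(\<integral>\<^sup>+t. (\<integral>\<^sup>+x. ennreal (norm (v t x) powr r) \<partial>\<pi> t) \<partial>I) < \<infinity>"
    using fin by (simp add: I_def v_def nn_integral_restrict_space)
  have moment: "(\<integral>\<^sup>+t. f t \<partial>I) < \<infinity>"
    if "\<And>t. t \<in> {0..1} \<Longrightarrow> f t \<le> ennreal C + ennreal C * (\<integral>\<^sup>+x. ennreal (norm (v t x)) \<partial>\<pi> t)" for f C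
    by (rule nn_integral_finite_of_moment[OF I.prob_space_axioms _ _ r fin', of f C])
       (use prob_measuresD(1)[OF \<pi>_prob] v that in \<open>auto simp: sI\<close>)
  have L_meas[measurable]: "L \<in> borel_measurable borel"
    using convex_on_continuous[OF open_UNIV L] by (rule borel_measurable_continuous_onI)
  have "\<exists>p q. \<forall>x. p \<bullet> x + q \<le> L x"
    using convex_affine_minorant[OF L, of "L 0 - 1" 0] by (metis diff_less_eq less_add_one)
  then obtain p q where pq: "\<And>x. p \<bullet> x + q \<le> L x" by blast
  \<comment> \<open>One constant for both coefficients of an affine minorant, so that
    \<open>- L v\<close> is at most \<open>M + M * norm v\<close>.\<close>
  define M where "M = max \<bar>q\<bar> (norm p)"
  have H_fin: "(\<integral>\<^sup>+t. H t \<partial>I) < \<infinity>"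
  proof (rule moment)
    fix t :: real assume t: "t \<in> {0..1}"
    interpret prob_space "\<pi> t" using prob_measuresD(1)[OF \<pi>_prob[OF t]] .
    note [measurable] = borel_measurable_integrable[OF v[OF t]]
    have "ennreal (- L (v t x)) \<le> ennreal M + ennreal M * ennreal (norm (v t x))" for x
    proof -
      have "- L (v t x) \<le> \<bar>q\<bar> + norm p * norm (v t x)"
        using pq[of "v t x"] Cauchy_Schwarz_ineq2[of p "v t x"] by linarith
      also have "\<dots> \<le> M + M * norm (v t x)"
        by (intro add_mono mult_right_mono) (auto simp: M_def)
      finally have "ennreal (- L (v t x)) \<le> ennreal (M + M * norm (v t x))" by (rule ennreal_leI)
      also have "\<dots> = ennreal M + ennreal M * ennreal (norm (v t x))"
        by (subst ennreal_plus) (auto simp: M_def ennreal_mult)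
      finally show ?thesis .
    qed
    then have "H t \<le> (\<integral>\<^sup>+x. ennreal M + ennreal M * ennreal (norm (v t x)) \<partial>\<pi> t)"
      unfolding H_def by (intro nn_integral_mono)
    also have "\<dots> = ennreal M + ennreal M * (\<integral>\<^sup>+x. ennreal (norm (v t x)) \<partial>\<pi> t)"
      by (subst nn_integral_add) (auto simp: emeasure_space_1 nn_integral_cmult)
    finally show "H t \<le> ennreal M + ennreal M * (\<integral>\<^sup>+x. ennreal (norm (v t x)) \<partial>\<pi> t)" .
  qed
  have a_int: "integrable I a"
  proof -
    have "set_integrable lborel {0..1} a"
      unfolding a_def by (intro borel_integrable_atLeastAtMost' weak_flow_continuous_time_dependent[OF \<pi> S \<eta>t])
    then show ?thesis by (simp add: I_def set_integrable_def integrable_restrict_space)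
  qed
  obtain C where C: "\<And>z. z \<in> {0..1} \<times> S \<Longrightarrow> norm (\<eta>x z) \<le> C"
    using compact_imp_bounded[OF compact_continuous_image[OF \<eta>x cyl]] by (auto simp: bounded_iff)
  have flux: "integrable (\<pi> t) (\<lambda>x. \<eta>x (t, x) \<bullet> v t x)" "\<And>x. x \<in> S \<Longrightarrow> norm (\<eta>x (t, x) \<bullet> v t x) \<le> C * norm (v t x)"
    if t: "t \<in> {0..1}" for t
  proof -
    show bd: "norm (\<eta>x (t, x) \<bullet> v t x) \<le> C * norm (v t x)" if "x \<in> S" for x
    proof -
      have "norm (\<eta>x (t, x) \<bullet> v t x) \<le> norm (\<eta>x (t, x)) * norm (v t x)"
        using Cauchy_Schwarz_ineq2 by simp
      also have "\<dots> \<le> C * norm (v t x)" using C[of "(t, x)"] t that by (intro mult_right_mono) auto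
      finally show ?thesis .
    qed
    have "(\<lambda>x. \<eta>x (t, x)) \<in> borel_measurable (\<pi> t)"
      using t by (intro borel_measurable_prob_measures[OF \<pi>_prob[OF t]] continuous_on_compose2[OF \<eta>x] continuous_intros) auto
    then have meas: "(\<lambda>x. \<eta>x (t, x) \<bullet> v t x) \<in> borel_measurable (\<pi> t)"
      using v[OF t] by measurable
    have "integrable (\<pi> t) (\<lambda>x. C * norm (v t x))" using v[OF t] by auto
    then show "integrable (\<pi> t) (\<lambda>x. \<eta>x (t, x) \<bullet> v t x)"
      by (rule Bochner_Integration.integrable_bound[OF _ meas])
         (use bd prob_measuresD(3)[OF \<pi>_prob[OF t]] in \<open>auto intro!: AE_I2 order_trans[OF _ abs_ge_self]\<close>)
  qed
  have b_int: "integrable I b"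
  proof (rule integrableI_bounded)
    show "b \<in> borel_measurable I"
      unfolding b_def v_def I_def by (rule measurable_flux_integral[OF \<pi>_prob S m ac \<eta>x])
    show "(\<integral>\<^sup>+t. ennreal (norm (b t)) \<partial>I) < \<infinity>"
    proof (rule moment)
      fix t :: real assume t: "t \<in> {0..1}"
      note [measurable] = borel_measurable_integrable[OF v[OF t]]
      have sp: "space (\<pi> t) = S" using prob_measuresD(3)[OF \<pi>_prob[OF t]] .
      have "ennreal (norm (b t)) \<le> (\<integral>\<^sup>+x. ennreal (norm (\<eta>x (t, x) \<bullet> v t x)) \<partial>\<pi> t)"
        unfolding b_def by (rule integral_norm_bound_ennreal[OF flux(1)[OF t]])
      also have "\<dots> \<le> (\<integral>\<^sup>+x. ennreal \<bar>C\<bar> * ennreal (norm (v t x)) \<partial>\<pi> t)"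
      proof (rule nn_integral_mono)
        fix x assume "x \<in> space (\<pi> t)"
        then have "norm (\<eta>x (t, x) \<bullet> v t x) \<le> C * norm (v t x)" using flux(2)[OF t] sp by simp
        also have "\<dots> \<le> \<bar>C\<bar> * norm (v t x)" by (intro mult_right_mono) auto
        finally show "ennreal (norm (\<eta>x (t, x) \<bullet> v t x)) \<le> ennreal \<bar>C\<bar> * ennreal (norm (v t x))"
          by (subst ennreal_mult[symmetric]) (auto intro: ennreal_leI)
      qed
      also have "\<dots> = ennreal \<bar>C\<bar> * (\<integral>\<^sup>+x. ennreal (norm (v t x)) \<partial>\<pi> t)" by (rule nn_integral_cmult) simp
      finally show "ennreal (norm (b t)) \<le> ennreal \<bar>C\<bar> + ennreal \<bar>C\<bar> * (\<integral>\<^sup>+x. ennreal (norm (v t x)) \<partial>\<pi> t)"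
        by (rule order_trans) simp
    qed
  qed
  have le: "H t + ennreal (a t + b t) \<le> F t + ennreal (- (a t + b t))" if "t \<in> space I" for t
  proof -
    have t: "t \<in> {0..1}" using that sI by simp
    have sp: "space (\<pi> t) = S" using prob_measuresD(3)[OF \<pi>_prob[OF t]] .
    have i: "integrable (\<pi> t) (\<lambda>x. \<eta>t (t, x))"
      using t by (intro integrable_prob_measures[OF \<pi>_prob[OF t] _ S] continuous_on_compose2[OF \<eta>t] continuous_intros) auto
    have ab: "a t + b t = (\<integral>x. \<eta>t (t, x) + \<eta>x (t, x) \<bullet> v t x \<partial>\<pi> t)"
      unfolding a_def b_def using i flux(1)[OF t] by simp
    show ?thesis
      unfolding ab F_def H_def
    proof (rule nn_integral_le_shift_nonmeasurable)
      show "integrable (\<pi> t) (\<lambda>x. \<eta>t (t, x) + \<eta>x (t, x) \<bullet> v t x)" using i flux(1)[OF t] by simp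
      fix x assume "x \<in> space (\<pi> t)"
      then have "\<eta>t (t, x) + \<eta>x (t, x) \<bullet> v t x \<le> L (v t x)" using t sp by (intro sub) auto
      then show "ennreal (- L (v t x)) + ennreal (\<eta>t (t, x) + \<eta>x (t, x) \<bullet> v t x)
          \<le> ennreal (L (v t x)) + ennreal (- (\<eta>t (t, x) + \<eta>x (t, x) \<bullet> v t x))"
        by (rule ennreal_parts_mono)
    qed
  qed
  have "ereal (\<integral>t. a t + b t \<partial>I) \<le> enn2ereal (\<integral>\<^sup>+t. F t \<partial>I) - enn2ereal (\<integral>\<^sup>+t. H t \<partial>I)"
    by (intro ereal_le_enn2ereal_diff nn_integral_le_shift_nonmeasurable H_fin le
        Bochner_Integration.integrable_add a_int b_int)
  moreover have "(\<integral>t. a t + b t \<partial>I) = (\<integral>x. \<eta> (1, x) \<partial>\<pi> 1) - (\<integral>x. \<eta> (0, x) \<partial>\<pi> 0)"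
  proof -
    have "(LINT t:{0..1}|lborel. a t) + (LINT t:{0..1}|lborel. b t) = (\<integral>x. \<eta> (1, x) \<partial>\<pi> 1) - (\<integral>x. \<eta> (0, x) \<partial>\<pi> 0)"
      unfolding a_def b_def v_def
      using ce[unfolded continuity_equation_def, rule_format, OF \<eta>] .
    then show ?thesis using a_int b_int by (simp add: set_integral_restrict I_def)
  qed
  ultimately show ?thesis
    by (simp add: dynamical_cost_restrict F_def H_def v_def I_def)
qed

lemma dynamical_cost_lower_bound:
  fixes S :: "'a::euclidean_space set"
  assumes S: "compact S" and L: "convex_on UNIV L"
    and \<pi>: "continuous_map (top_of_set {0..1}) (weak_topology S) \<pi>"
    and m: "time_vector_measure S m"
    and ac: "\<And>t. t \<in> {0..1} \<Longrightarrow> vm_absolutely_continuous (\<pi> t) (m t)"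
    and r: "r > 1" and fin: "(\<integral>\<^sup>+t\<in>{0..1}. (\<integral>\<^sup>+x. ennreal (norm (vm_RN_deriv (\<pi> t) (m t) x) powr r) \<partial>\<pi> t) \<partial>lborel) < \<infinity>"
    and ce: "continuity_equation S \<pi> m"
    and start: "AE x in \<pi> 0. \<forall>c. L (c *\<^sub>R x) = L 0"
  shows "ereal (static_cost L (\<pi> 1)) \<le> dynamical_cost L (\<pi>, m)"
proof -
  have p0: "\<pi> 0 \<in> prob_measures S" and p1: "\<pi> 1 \<in> prob_measures S"
    by (auto intro!: weak_flow_prob_measures[OF \<pi>])
  interpret P0: prob_space "\<pi> 0" using prob_measuresD(1)[OF p0] .
  interpret P1: prob_space "\<pi> 1" using prob_measuresD(1)[OF p1] .
  have L_cont: "continuous_on UNIV L" using convex_on_continuous[OF open_UNIV L] .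
  \<comment> \<open>At time 1 the minorant \<open>G\<close> is evaluated at
    \<open>x / (1 + \<epsilon>)\<close>. All these points lie in this compact set, which does not
    depend on \<open>\<epsilon>\<close>.\<close>
  define K where "K = (\<lambda>(s, x). s *\<^sub>R x) ` ({0..1::real} \<times> S)"
  have K: "compact K"
    unfolding K_def using S
    by (intro compact_continuous_image compact_Times) (auto simp: case_prod_beta intro!: continuous_intros)
  \<comment> \<open>What remains of \<open>\<eta> (1, x)\<close> once \<open>G\<close> is replaced
    by its lower bound \<open>L - \<epsilon>\<close>; unlike \<open>G\<close> it depends on
    \<open>\<epsilon>\<close> explicitly, so the limit can be taken.\<close>
  define \<Phi> where "\<Phi> \<epsilon> x = (1 + \<epsilon>) * (L ((1 / (1 + \<epsilon>)) *\<^sub>R x) - \<epsilon>)" for \<epsilon> x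
  have \<Phi>_int: "integrable (\<pi> 1) (\<Phi> \<epsilon>)" for \<epsilon>
    unfolding \<Phi>_def
    by (intro integrable_prob_measures[OF p1 _ S] continuous_intros continuous_on_compose2[OF L_cont]) auto
  have step: "ereal ((\<integral>x. \<Phi> \<epsilon> x \<partial>\<pi> 1) - \<epsilon> * L 0) \<le> dynamical_cost L (\<pi>, m)" if e: "\<epsilon> > 0" for \<epsilon>
  proof -
    obtain G D where G: "\<And>x. (G has_derivative (\<lambda>h. D x \<bullet> h)) (at x)" and D: "continuous_on UNIV D"
      and tangent: "\<And>y v. G y + D y \<bullet> (v - y) \<le> L v" and G_ge: "\<And>x. x \<in> K \<Longrightarrow> L x - \<epsilon> \<le> G x"
      by (rule convex_C1_minorant[OF L K e]) (rule that)
    have contG: "continuous_on UNIV G"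
      using G by (meson continuous_at_imp_continuous_on has_derivative_continuous)
    define y where "y z = (1 / (fst z + \<epsilon>)) *\<^sub>R snd z" for z :: "real \<times> 'a"
    define \<eta> where "\<eta> z = (fst z + \<epsilon>) * G (y z)" for z
    have C1: "C1_on_cylinder S \<eta> (\<lambda>z. G (y z) - D (y z) \<bullet> y z) (\<lambda>z. D (y z))"
      unfolding \<eta>_def y_def by (rule C1_on_cylinder_perspective[OF G D e])
    have cost: "ereal ((\<integral>x. \<eta> (1, x) \<partial>\<pi> 1) - (\<integral>x. \<eta> (0, x) \<partial>\<pi> 0)) \<le> dynamical_cost L (\<pi>, m)"
    proof (rule dynamical_cost_ge_test_function[OF S L \<pi> m ac r fin ce C1])
      show "G (y z) - D (y z) \<bullet> y z + D (y z) \<bullet> v \<le> L v" for z v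
        using tangent[of "y z" v] by (simp add: inner_diff_right)
    qed
    have \<eta>_int: "integrable (\<pi> s) (\<lambda>x. \<eta> (s, x))" if "s \<in> {0, 1}" for s
    proof -
      have "\<pi> s \<in> prob_measures S" "s + \<epsilon> \<noteq> 0" using that p0 p1 e by auto
      then show ?thesis
        unfolding \<eta>_def y_def
        by (intro integrable_prob_measures[OF _ _ S] continuous_intros continuous_on_compose2[OF contG]) auto
    qed
    have "(\<integral>x. \<Phi> \<epsilon> x \<partial>\<pi> 1) \<le> (\<integral>x. \<eta> (1, x) \<partial>\<pi> 1)"
    proof (rule integral_mono[OF \<Phi>_int])
      fix x assume "x \<in> space (\<pi> 1)"
      then have "(1 / (1 + \<epsilon>), x) \<in> {0..1} \<times> S" using e prob_measuresD(3)[OF p1] by auto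
      then have "(1 / (1 + \<epsilon>)) *\<^sub>R x \<in> K" unfolding K_def by (rule rev_image_eqI) simp
      from G_ge[OF this] show "\<Phi> \<epsilon> x \<le> \<eta> (1, x)"
        unfolding \<Phi>_def \<eta>_def y_def using e by (simp add: mult_left_mono)
    qed (use \<eta>_int in simp)
    \<comment> \<open>The tangent at \<open>y\<close> taken at \<open>v = y\<close> gives
      \<open>G \<le> L\<close>, and \<open>L (x / \<epsilon>) = L 0\<close> for almost every
      starting point. The initial term is thus at most \<open>\<epsilon> * L 0\<close>, which
      vanishes in the limit.\<close>
    moreover have "(\<integral>x. \<eta> (0, x) \<partial>\<pi> 0) \<le> (\<integral>x. \<epsilon> * L 0 \<partial>\<pi> 0)"
    proof (rule integral_mono_AE)
      show "AE x in \<pi> 0. \<eta> (0, x) \<le> \<epsilon> * L 0"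
        using start
      proof (rule eventually_mono)
        fix x assume x: "\<forall>c. L (c *\<^sub>R x) = L 0"
        have "G (y (0, x)) \<le> L (y (0, x))" using tangent[of "y (0, x)" "y (0, x)"] by simp
        also have "\<dots> = L 0" using x by (simp add: y_def)
        finally show "\<eta> (0, x) \<le> \<epsilon> * L 0" using e by (simp add: \<eta>_def mult_left_mono)
      qed
    qed (use \<eta>_int in auto)
    ultimately have "(\<integral>x. \<Phi> \<epsilon> x \<partial>\<pi> 1) - \<epsilon> * L 0 \<le> (\<integral>x. \<eta> (1, x) \<partial>\<pi> 1) - (\<integral>x. \<eta> (0, x) \<partial>\<pi> 0)"
      using P0.prob_space by simp
    then have "ereal ((\<integral>x. \<Phi> \<epsilon> x \<partial>\<pi> 1) - \<epsilon> * L 0) \<le> ereal ((\<integral>x. \<eta> (1, x) \<partial>\<pi> 1) - (\<integral>x. \<eta> (0, x) \<partial>\<pi> 0))"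
      by simp
    then show ?thesis using cost by (rule order_trans)
  qed
  define e where "e n = 1 / real (Suc n)" for n
  have e: "e n > 0" "e n \<le> 1" for n by (auto simp: e_def)
  have e0: "e \<longlonglongrightarrow> 0" unfolding e_def using LIMSEQ_inverse_real_of_nat by (simp add: inverse_eq_divide)
  obtain C where C: "\<And>x. x \<in> K \<Longrightarrow> norm (L x) \<le> C"
    using compact_imp_bounded[OF compact_continuous_image[OF continuous_on_subset[OF L_cont subset_UNIV] K]]
    by (auto simp: bounded_iff)
  have "(\<lambda>n. \<integral>x. \<Phi> (e n) x \<partial>\<pi> 1) \<longlonglongrightarrow> (\<integral>x. L x \<partial>\<pi> 1)"
  proof (rule integral_dominated_convergence[where w="\<lambda>_. 2 * (C + 1)"])
    show "L \<in> borel_measurable (\<pi> 1)"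
      by (rule borel_measurable_prob_measures[OF p1 continuous_on_subset[OF L_cont subset_UNIV]])
    show "\<Phi> (e n) \<in> borel_measurable (\<pi> 1)" for n using \<Phi>_int by simp
    show "AE x in \<pi> 1. (\<lambda>n. \<Phi> (e n) x) \<longlonglongrightarrow> L x"
    proof (rule AE_I2)
      fix x :: 'a
      have "(\<lambda>n. (1 / (1 + e n)) *\<^sub>R x) \<longlonglongrightarrow> (1 / (1 + 0)) *\<^sub>R x"
        by (rule tendsto_scaleR[OF tendsto_divide[OF tendsto_const tendsto_add[OF tendsto_const e0]] tendsto_const]) simp
      then have "(\<lambda>n. L ((1 / (1 + e n)) *\<^sub>R x)) \<longlonglongrightarrow> L x"
        using L_cont by (intro isCont_tendsto_compose[of x L]) (simp_all add: continuous_on_eq_continuous_at)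
      then have "(\<lambda>n. (1 + e n) * (L ((1 / (1 + e n)) *\<^sub>R x) - e n)) \<longlonglongrightarrow> (1 + 0) * (L x - 0)"
        by (rule tendsto_mult[OF tendsto_add[OF tendsto_const e0] tendsto_diff[OF _ e0]])
      then show "(\<lambda>n. \<Phi> (e n) x) \<longlonglongrightarrow> L x" by (simp add: \<Phi>_def)
    qed
    \<comment> \<open>The factors are bounded by \<open>1 + e n \<le> 2\<close> and
      \<open>\<bar>L\<bar> + e n \<le> C + 1\<close>.\<close>
    show "AE x in \<pi> 1. norm (\<Phi> (e n) x) \<le> 2 * (C + 1)" for n
    proof (rule AE_I2)
      fix x assume "x \<in> space (\<pi> 1)"
      then have "(1 / (1 + e n), x) \<in> {0..1} \<times> S" using e(1)[of n] prob_measuresD(3)[OF p1] by auto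
      then have "(1 / (1 + e n)) *\<^sub>R x \<in> K" unfolding K_def by (rule rev_image_eqI) simp
      from C[OF this] have "\<bar>L ((1 / (1 + e n)) *\<^sub>R x) - e n\<bar> \<le> C + 1"
        using e[of n] unfolding real_norm_def by linarith
      then have "\<bar>1 + e n\<bar> * \<bar>L ((1 / (1 + e n)) *\<^sub>R x) - e n\<bar> \<le> 2 * (C + 1)"
        using e[of n] by (intro mult_mono) auto
      then show "norm (\<Phi> (e n) x) \<le> 2 * (C + 1)"
        by (simp only: \<Phi>_def real_norm_def abs_mult)
    qed
  qed auto
  then have "(\<lambda>n. (\<integral>x. \<Phi> (e n) x \<partial>\<pi> 1) - e n * L 0) \<longlonglongrightarrow> (\<integral>x. L x \<partial>\<pi> 1) - 0 * L 0"
    by (rule tendsto_diff[OF _ tendsto_mult[OF e0 tendsto_const]])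
  then have "(\<lambda>n. ereal ((\<integral>x. \<Phi> (e n) x \<partial>\<pi> 1) - e n * L 0)) \<longlonglongrightarrow> ereal (static_cost L (\<pi> 1))"
    by (simp add: static_cost_def)
  then show ?thesis
    by (rule LIMSEQ_le_const2) (use step[OF e(1)] in auto)
qed

section \<open>Displacement interpolation\<close>

lemma vector_measure_integral:
  fixes f :: "'w \<Rightarrow> 'v::euclidean_space"
  assumes T: "T \<in> measurable N M" and f: "integrable N f"
  shows "vector_measure M (\<lambda>A. LINT w:T -` A \<inter> space N|N. f w)"
  unfolding vector_measure_def
proof (intro allI impI)
  fix A :: "nat \<Rightarrow> 'a set" assume A: "range A \<subseteq> sets M" "disjoint_family A"
  have [measurable]: "f \<in> borel_measurable N" using f by simp
  have TA[measurable]: "T -` A i \<inter> space N \<in> sets N" for i using A(1) by (intro measurable_sets[OF T]) auto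
  have TU: "T -` (\<Union>i. A i) \<inter> space N = (\<Union>i. T -` A i \<inter> space N)" by auto
  have TUm[measurable]: "T -` (\<Union>i. A i) \<inter> space N \<in> sets N" unfolding TU by measurable
  let ?s = "\<lambda>n w. \<Sum>i<n. indicator (T -` A i \<inter> space N) w *\<^sub>R f w"
  have uniq: "i = j" if "T w \<in> A i" "T w \<in> A j" for w i j
    using A(2) that unfolding disjoint_family_on_def by blast
  have val: "?s n w = (if \<exists>i<n. T w \<in> A i then f w else 0)" if w: "w \<in> space N" for n w
  proof (cases "\<exists>i<n. T w \<in> A i")
    case True
    then obtain j where j: "j < n" "T w \<in> A j" by auto
    have "?s n w = (\<Sum>i<n. if i = j then f w else 0)"
    proof (rule sum.cong[OF refl])
      fix i assume "i \<in> {..<n}"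
      have "T w \<in> A i \<longleftrightarrow> i = j" using uniq[of w i j] j(2) by blast
      then show "indicator (T -` A i \<inter> space N) w *\<^sub>R f w = (if i = j then f w else 0)"
        using w by (simp add: indicator_def)
    qed
    then show ?thesis using j True by simp
  qed (auto intro!: sum.neutral split: split_indicator)
  have "(\<lambda>n. \<integral>w. ?s n w \<partial>N) \<longlonglongrightarrow> (\<integral>w. indicator (T -` (\<Union>i. A i) \<inter> space N) w *\<^sub>R f w \<partial>N)"
  proof (rule integral_dominated_convergence[where w="\<lambda>w. norm (f w)"])
    show "AE w in N. (\<lambda>n. ?s n w) \<longlonglongrightarrow> indicator (T -` (\<Union>i. A i) \<inter> space N) w *\<^sub>R f w"
    proof (rule AE_I2)
      fix w assume w: "w \<in> space N"
      show "(\<lambda>n. ?s n w) \<longlonglongrightarrow> indicator (T -` (\<Union>i. A i) \<inter> space N) w *\<^sub>R f w"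
      proof (cases "\<exists>j. T w \<in> A j")
        case True
        then obtain j where j: "T w \<in> A j" by auto
        then have "?s n w = f w" if "n \<ge> Suc j" for n using val[OF w, of n] that by (auto simp: Suc_le_eq)
        then have "eventually (\<lambda>n. ?s n w = f w) sequentially" unfolding eventually_sequentially by blast
        then have "(\<lambda>n. ?s n w) \<longlonglongrightarrow> f w" by (rule tendsto_eventually)
        then show ?thesis using w j by (auto simp: indicator_def)
      next
        case False
        then show ?thesis using val[OF w] w by (simp add: indicator_def)
      qed
    qed
    show "AE w in N. norm (?s n w) \<le> norm (f w)" for n
      using val by (intro AE_I2) auto
    show "?s n \<in> borel_measurable N" for n by measurable
  qed (use f in auto)
  moreover have "(\<integral>w. ?s n w \<partial>N) = (\<Sum>i<n. LINT w:T -` A i \<inter> space N|N. f w)" for n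
    unfolding set_lebesgue_integral_def
    by (rule Bochner_Integration.integral_sum) (rule integrable_mult_indicator[OF TA f])
  ultimately show "(\<lambda>i. LINT w:T -` A i \<inter> space N|N. f w) sums (LINT w:T -` (\<Union>i. A i) \<inter> space N|N. f w)"
    by (simp add: sums_def set_lebesgue_integral_def)
qed

lemma vector_measure_cong:
  assumes "\<And>A. A \<in> sets M \<Longrightarrow> m A = m' A" and "vector_measure M m'"
  shows "vector_measure M m"
  unfolding vector_measure_def
proof (intro allI impI)
  fix A :: "nat \<Rightarrow> 'a set" assume A: "range A \<subseteq> sets M" "disjoint_family A"
  then have "(\<lambda>i. m' (A i)) sums m' (\<Union>i. A i)" using assms(2) by (simp add: vector_measure_def)
  moreover have "m (A i) = m' (A i)" "m (\<Union>i. A i) = m' (\<Union>i. A i)" for i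
    using A(1) by (auto intro!: assms(1))
  ultimately show "(\<lambda>i. m (A i)) sums m (\<Union>i. A i)" by simp
qed

lemma AE_le_of_set_integral_le:
  fixes f g :: "'a \<Rightarrow> real"
  assumes f: "integrable M f" and g: "integrable M g"
    and le: "\<And>A. A \<in> sets M \<Longrightarrow> (LINT x:A|M. f x) \<le> (LINT x:A|M. g x)"
  shows "AE x in M. f x \<le> g x"
proof -
  define A where "A = {x \<in> space M. g x < f x}"
  have A: "A \<in> sets M" unfolding A_def using f g by measurable
  have int: "integrable M (\<lambda>x. indicator A x *\<^sub>R f x)" "integrable M (\<lambda>x. indicator A x *\<^sub>R g x)"
    by (rule integrable_mult_indicator[OF A f], rule integrable_mult_indicator[OF A g])
  define h where "h x = indicator A x *\<^sub>R f x - indicator A x *\<^sub>R g x" for x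
  have h: "integrable M h" unfolding h_def using int by (rule Bochner_Integration.integrable_diff)
  have nn: "h x \<ge> 0" for x by (auto simp: h_def A_def split: split_indicator)
  have "(\<integral>x. h x \<partial>M) \<le> 0"
    using le[OF A] int by (simp add: h_def set_lebesgue_integral_def)
  then have "(\<integral>x. h x \<partial>M) = 0" using integral_nonneg_AE[of h M] nn by (simp add: order_antisym)
  then have "AE x in M. h x = 0"
    using integral_nonneg_eq_0_iff_AE[OF h] nn by simp
  then show ?thesis
  proof (rule AE_mp, intro AE_I2 impI)
    fix x assume "x \<in> space M" "h x = 0"
    then show "f x \<le> g x" by (cases "g x < f x") (auto simp: h_def A_def)
  qed
qed

section \<open>Straight-line interpolation between two random points\<close>

text \<open>The endpoints are kept as abstract random variables; they become the two coordinates of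
  the product of \<open>p\<close> and \<open>\<gamma>\<close>. Convexity of \<open>S\<close> keeps
  every segment inside \<open>S\<close>.\<close>

locale displacement = prob_space P for P :: "'w measure" +
  fixes S :: "'a::euclidean_space set" and U V :: "'w \<Rightarrow> 'a"
  assumes S: "compact S" "convex S"
    and U: "U \<in> measurable P (borel_on S)" and V: "V \<in> measurable P (borel_on S)"
begin

definition X :: "real \<Rightarrow> 'w \<Rightarrow> 'a" where "X t w = (1 - t) *\<^sub>R U w + t *\<^sub>R V w"

definition W :: "'w \<Rightarrow> 'a" where "W w = V w - U w"

definition \<pi> :: "real \<Rightarrow> 'a measure" where "\<pi> t = distr P (borel_on S) (X t)"

text \<open>The image under \<open>X t\<close> of the vector measure with density \<open>W\<close>.
  Since \<open>\<pi> t\<close> is the image of \<open>P\<close> under the same map, absolute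
  continuity is automatic.\<close>

definition flux :: "real \<Rightarrow> 'a set \<Rightarrow> 'a" where "flux t A = (LINT w:X t -` A \<inter> space P|P. W w)"

abbreviation I :: "real measure" where "I \<equiv> restrict_space lborel {0..1}"

abbreviation cyl :: "(real \<times> 'a) measure" where "cyl \<equiv> borel_on ({0..1} \<times> S)"

lemma space_UV: "w \<in> space P \<Longrightarrow> U w \<in> S" "w \<in> space P \<Longrightarrow> V w \<in> S"
  using measurable_space[OF U] measurable_space[OF V] by (auto simp: space_restrict_space)

lemma borel_UV[measurable]: "U \<in> borel_measurable P" "V \<in> borel_measurable P"
  using U V by (auto simp: measurable_restrict_space2_iff)

lemma borel_W[measurable]: "W \<in> borel_measurable P"
  unfolding W_def by measurable

lemma X_in: "t \<in> {0..1} \<Longrightarrow> w \<in> space P \<Longrightarrow> X t w \<in> S"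
  unfolding X_def using S(2) space_UV by (intro convexD) auto

lemma X_endpoints: "X 0 = U" "X 1 = V"
  by (simp_all add: X_def fun_eq_iff)

lemma X_measurable:
  assumes "t \<in> {0..1}"
  shows "X t \<in> measurable P (borel_on S)"
proof (rule measurable_restrict_space2)
  show "X t \<in> space P \<rightarrow> S" using X_in[OF assms] by auto
  show "X t \<in> borel_measurable P" unfolding X_def by measurable
qed

lemma W_bounded: obtains D where "D \<ge> 0" "\<And>w. w \<in> space P \<Longrightarrow> norm (W w) \<le> D"
proof -
  obtain C where C: "\<And>x. x \<in> S \<Longrightarrow> norm x \<le> C"
    using compact_imp_bounded[OF S(1)] by (auto simp: bounded_iff)
  have "norm (W w) \<le> \<bar>C\<bar> + \<bar>C\<bar>" if "w \<in> space P" for w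
    unfolding W_def using C[OF space_UV(1)[OF that]] C[OF space_UV(2)[OF that]]
      norm_triangle_ineq4[of "V w" "U w"] by linarith
  then show ?thesis by (intro that[of "\<bar>C\<bar> + \<bar>C\<bar>"]) auto
qed

lemma integrable_continuous_W:
  fixes f :: "'a \<Rightarrow> 'b::euclidean_space"
  assumes f: "continuous_on UNIV f"
  shows "integrable P (\<lambda>w. f (W w))"
proof -
  obtain D where D: "\<And>w. w \<in> space P \<Longrightarrow> norm (W w) \<le> D" using W_bounded by metis
  obtain C where C: "\<And>x. x \<in> cball 0 D \<Longrightarrow> norm (f x) \<le> C"
    using compact_imp_bounded[OF compact_continuous_image[OF continuous_on_subset[OF f subset_UNIV] compact_cball[of 0 D]]]
    by (auto simp: bounded_iff simp del: mem_cball mem_cball_0)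
  show ?thesis
  proof (rule integrable_const_bound[where B=C])
    show "AE w in P. norm (f (W w)) \<le> C" using C D by (intro AE_I2) auto
    show "(\<lambda>w. f (W w)) \<in> borel_measurable P"
      using borel_measurable_continuous_onI[OF f] by measurable
  qed
qed

lemma integrable_W: "integrable P W"
  using integrable_continuous_W[of "\<lambda>x. x"] by simp

lemma \<pi>_prob: "t \<in> {0..1} \<Longrightarrow> \<pi> t \<in> prob_measures S"
  unfolding \<pi>_def by (intro distr_in_prob_measures prob_space_axioms X_measurable)

lemma sets_\<pi>: "sets (\<pi> t) = sets (borel_on S)" by (simp add: \<pi>_def)

lemma integral_\<pi>:
  fixes f :: "'a \<Rightarrow> 'b::euclidean_space"
  assumes "t \<in> {0..1}" "f \<in> borel_measurable (borel_on S)"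
  shows "(\<integral>x. f x \<partial>\<pi> t) = (\<integral>w. f (X t w) \<partial>P)"
  unfolding \<pi>_def using X_measurable[OF assms(1)] assms(2) by (rule integral_distr)

text \<open>Subbasic sets suffice, so the claim reduces to continuity in time of the integrals of
  \<open>f (X t w)\<close>, by dominated convergence along the continuous paths.\<close>

lemma \<pi>_continuous: "continuous_map (top_of_set {0..1}) (weak_topology S) \<pi>"
  unfolding weak_topology_def
proof (rule continuous_on_generated_topo)
  fix Q :: "'a measure set"
  assume "Q \<in> {{M \<in> prob_measures S. (\<integral>x. f x \<partial>M) \<in> G} | (f :: 'a \<Rightarrow> real) G.
      continuous_on S f \<and> bounded (f ` S) \<and> open G}"
  then obtain f :: "'a \<Rightarrow> real" and G where Q: "Q = {M \<in> prob_measures S. (\<integral>x. f x \<partial>M) \<in> G}"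
    and f: "continuous_on S f" and bd: "bounded (f ` S)" and G: "open G" by blast
  obtain C where C: "\<And>x. x \<in> S \<Longrightarrow> norm (f x) \<le> C" using bd by (auto simp: bounded_iff)
  have fm[measurable]: "f \<in> borel_measurable (borel_on S)" using f by (rule borel_measurable_continuous_on_restrict)
  have cont: "continuous_on {0..1} (\<lambda>t. \<integral>w. f (X t w) \<partial>P)"
    unfolding continuous_on_sequentially
  proof (intro allI impI ballI)
    fix x and a :: real assume a: "a \<in> {0..1}" and x: "(\<forall>n. x n \<in> {0..1}) \<and> x \<longlonglongrightarrow> a"
    show "((\<lambda>t. \<integral>w. f (X t w) \<partial>P) \<circ> x) \<longlonglongrightarrow> (\<integral>w. f (X a w) \<partial>P)"
      unfolding comp_def
    proof (rule integral_dominated_convergence[where w="\<lambda>_. C"])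
      show "(\<lambda>w. f (X a w)) \<in> borel_measurable P" "\<And>n. (\<lambda>w. f (X (x n) w)) \<in> borel_measurable P"
        using x a by (auto intro!: measurable_compose[OF X_measurable fm])
      show "AE w in P. (\<lambda>n. f (X (x n) w)) \<longlonglongrightarrow> f (X a w)"
      proof (rule AE_I2)
        fix w assume w: "w \<in> space P"
        have "(\<lambda>n. X (x n) w) \<longlonglongrightarrow> X a w"
          unfolding X_def using x by (intro tendsto_intros) auto
        then show "(\<lambda>n. f (X (x n) w)) \<longlonglongrightarrow> f (X a w)"
          by (rule continuous_on_tendsto_compose[OF f]) (use X_in w a x in auto)
      qed
      show "AE w in P. norm (f (X (x n) w)) \<le> C" for n using C X_in x by (intro AE_I2) auto
    qed auto
  qed
  have "\<pi> -` Q \<inter> topspace (top_of_set {0..1}) = {t \<in> {0..1}. (\<integral>w. f (X t w) \<partial>P) \<in> G}"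
    using \<pi>_prob by (auto simp: Q integral_\<pi>[OF _ fm])
  moreover have "openin (top_of_set {0..1}) ({0..1} \<inter> (\<lambda>t. \<integral>w. f (X t w) \<partial>P) -` G)"
    using cont G continuous_on_open_gen[of "\<lambda>t. \<integral>w. f (X t w) \<partial>P" "{0..1}" UNIV] by auto
  ultimately show "openin (top_of_set {0..1}) (\<pi> -` Q \<inter> topspace (top_of_set {0..1}))"
    by (simp add: Int_def vimage_def)
next
  let ?B = "{{M \<in> prob_measures S. (\<integral>x. f x \<partial>M) \<in> G} | (f :: 'a \<Rightarrow> real) G.
      continuous_on S f \<and> bounded (f ` S) \<and> open G}"
  \<comment> \<open>The whole space is itself subbasic: take the zero function and the open set
    \<open>UNIV\<close>.\<close>
  have "prob_measures S \<in> ?B"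
    by (rule CollectI, rule exI[of _ "\<lambda>_. 0"], rule exI[of _ UNIV]) (auto simp: bounded_iff)
  then have "prob_measures S \<subseteq> \<Union> ?B" by (rule Union_upper)
  moreover have "\<pi> ` topspace (top_of_set {0..1}) \<subseteq> prob_measures S" using \<pi>_prob by auto
  ultimately show "\<pi> ` topspace (top_of_set {0..1}) \<subseteq> \<Union> ?B" by (rule order_trans[rotated])
qed

lemma path_measurable: "(\<lambda>z. (fst z, X (fst z) (snd z))) \<in> measurable (I \<Otimes>\<^sub>M P) cyl"
proof (rule measurable_restrict_space2)
  show "(\<lambda>z. (fst z, X (fst z) (snd z))) \<in> space (I \<Otimes>\<^sub>M P) \<rightarrow> {0..1} \<times> S"
    using X_in by (auto simp: space_pair_measure space_unit_interval)
  have [measurable]: "fst \<in> borel_measurable (I \<Otimes>\<^sub>M P)"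
    by (rule measurable_compose[OF measurable_fst]) (simp add: measurable_restrict_space1)
  show "(\<lambda>z. (fst z, X (fst z) (snd z))) \<in> borel_measurable (I \<Otimes>\<^sub>M P)"
    unfolding X_def by measurable
qed

lemma pair_prob: "pair_prob_space I P"
  unfolding pair_prob_space_def pair_sigma_finite_def
  using prob_space_unit_interval prob_space_axioms
  by (auto intro: prob_space_imp_sigma_finite)

lemma integrable_W_snd: "integrable (I \<Otimes>\<^sub>M P) (\<lambda>z. W (snd z))"
proof -
  interpret pair_prob_space I P by (rule pair_prob)
  obtain D where D: "\<And>w. w \<in> space P \<Longrightarrow> norm (W w) \<le> D" using W_bounded by metis
  show ?thesis
    by (rule P.integrable_const_bound[where B=D]) (use D in \<open>auto intro!: AE_I2 simp: space_pair_measure\<close>)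
qed

lemma flux_slice:
  assumes t: "t \<in> {0..1}" and B: "B \<in> sets cyl"
  shows "flux t (Pair t -` B) = (\<integral>w. indicator ((\<lambda>z. (fst z, X (fst z) (snd z))) -` B \<inter> space (I \<Otimes>\<^sub>M P)) (t, w) *\<^sub>R W w \<partial>P)"
  unfolding flux_def set_lebesgue_integral_def
  using t by (intro Bochner_Integration.integral_cong) (auto simp: space_pair_measure space_unit_interval split: split_indicator)

text \<open>The measure \<open>dm dt\<close> is the image, under
  \<open>(t, w) \<mapsto> (t, X t w)\<close>, of the vector measure with density \<open>W\<close> on
  the product of time and \<open>P\<close>. Fubini gives integrability of the slices and identifies
  their time integral with this image.\<close>

lemma flux_time_vector_measure: "time_vector_measure S flux"
proof -
  interpret PP: pair_prob_space I P by (rule pair_prob)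
  let ?T = "\<lambda>z. (fst z, X (fst z) (snd z))"
  have int: "integrable (I \<Otimes>\<^sub>M P) (\<lambda>z. indicator (?T -` B \<inter> space (I \<Otimes>\<^sub>M P)) z *\<^sub>R W (snd z))" if "B \<in> sets cyl" for B
    using measurable_sets[OF path_measurable that] integrable_W_snd by (rule integrable_mult_indicator)
  have slice: "integrable I (\<lambda>t. flux t (Pair t -` B))" if "B \<in> sets cyl" for B
    using PP.integrable_fst'[OF int[OF that]]
    by (rule Bochner_Integration.integrable_cong[THEN iffD2, OF refl, rotated])
       (simp add: flux_slice[OF _ that] space_unit_interval)
  show ?thesis
    unfolding time_vector_measure_def
  proof (intro conjI ballI)
    show "vector_measure (borel_on S) (flux t)" if "t \<in> {0..1}" for t
      unfolding flux_def[abs_def] using X_measurable[OF that] integrable_W by (rule vector_measure_integral)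
    show "set_integrable lborel {0..1} (\<lambda>t. flux t (Pair t -` B))" if "B \<in> sets cyl" for B
      using slice[OF that] by (simp add: set_integrable_def integrable_restrict_space)
    show "vector_measure cyl (\<lambda>B. LINT t:{0..1}|lborel. flux t (Pair t -` B))"
    proof (rule vector_measure_cong)
      show "vector_measure cyl (\<lambda>B. LINT z:?T -` B \<inter> space (I \<Otimes>\<^sub>M P)|I \<Otimes>\<^sub>M P. W (snd z))"
        using path_measurable integrable_W_snd by (rule vector_measure_integral)
      fix B assume B: "B \<in> sets cyl"
      have "(LINT t:{0..1}|lborel. flux t (Pair t -` B)) = (\<integral>t. flux t (Pair t -` B) \<partial>I)"
        by (rule set_integral_restrict)
      also have "\<dots> = (\<integral>t. (\<integral>w. indicator (?T -` B \<inter> space (I \<Otimes>\<^sub>M P)) (t, w) *\<^sub>R W w \<partial>P) \<partial>I)"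
        by (intro Bochner_Integration.integral_cong) (simp_all add: flux_slice[OF _ B] space_unit_interval)
      also have "\<dots> = (LINT z:?T -` B \<inter> space (I \<Otimes>\<^sub>M P)|I \<Otimes>\<^sub>M P. W (snd z))"
        unfolding set_lebesgue_integral_def
        using PP.integral_fst'[OF int[OF B]] by simp
      finally show "(LINT t:{0..1}|lborel. flux t (Pair t -` B)) = (LINT z:?T -` B \<inter> space (I \<Otimes>\<^sub>M P)|I \<Otimes>\<^sub>M P. W (snd z))" .
    qed
  qed
qed

lemma preimage_null:
  assumes t: "t \<in> {0..1}" and A: "A \<in> null_sets (\<pi> t)"
  shows "X t -` A \<inter> space P \<in> null_sets P"
proof -
  have "A \<in> sets (borel_on S)" using A sets_\<pi> by auto
  moreover have "emeasure (\<pi> t) A = 0" using A by auto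
  ultimately show ?thesis
    using X_measurable[OF t] by (auto simp: \<pi>_def emeasure_distr null_sets_def)
qed

lemma integral_null_preimage:
  fixes f :: "'w \<Rightarrow> 'v::euclidean_space"
  assumes t: "t \<in> {0..1}" and A: "A \<in> null_sets (\<pi> t)"
  shows "(LINT w:X t -` A \<inter> space P|P. f w) = 0"
  unfolding set_lebesgue_integral_def
  using AE_not_in[OF preimage_null[OF assms]]
  by (intro integral_eq_zero_AE) (auto elim!: eventually_mono)

lemma flux_absolutely_continuous: "t \<in> {0..1} \<Longrightarrow> vm_absolutely_continuous (\<pi> t) (flux t)"
  unfolding vm_absolutely_continuous_def flux_def by (auto intro: integral_null_preimage)

lemma vector_measure_integral_\<pi>:
  fixes f :: "'w \<Rightarrow> 'v::euclidean_space"
  assumes "t \<in> {0..1}" "integrable P f"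
  shows "vector_measure (\<pi> t) (\<lambda>A. LINT w:X t -` A \<inter> space P|P. f w)"
  using vector_measure_integral[OF X_measurable[OF assms(1)] assms(2)]
  by (simp add: vector_measure_def sets_\<pi>)

abbreviation v :: "real \<Rightarrow> 'a \<Rightarrow> 'a" where "v t \<equiv> vm_RN_deriv (\<pi> t) (flux t)"

lemma
  assumes t: "t \<in> {0..1}"
  shows v_integrable: "integrable (\<pi> t) (v t)"
    and v_set_integral: "A \<in> sets (\<pi> t) \<Longrightarrow> (LINT x:A|\<pi> t. v t x) = flux t A"
proof -
  have fin: "finite_measure (\<pi> t)" using prob_measuresD(1)[OF \<pi>_prob[OF t]] by (rule prob_space.axioms(1))
  have vm: "vector_measure (\<pi> t) (flux t)"
    unfolding flux_def[abs_def] by (rule vector_measure_integral_\<pi>[OF t integrable_W])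
  show "integrable (\<pi> t) (v t)" "A \<in> sets (\<pi> t) \<Longrightarrow> (LINT x:A|\<pi> t. v t x) = flux t A"
    using vm_RN_deriv[OF fin vm flux_absolutely_continuous[OF t]] by auto
qed

text \<open>Both sides are limits of sums over the same level sets of simple functions approximating
  \<open>g\<close>, and on such sets \<open>v t\<close> and \<open>W\<close> have equal integrals.
  The identity \<open>T1\<close> only makes the left side an instance of the approximation
  lemma.\<close>

lemma integral_inner_v:
  assumes t: "t \<in> {0..1}" and g: "continuous_on S g"
  shows "(\<integral>x. g x \<bullet> v t x \<partial>\<pi> t) = (\<integral>w. g (X t w) \<bullet> W w \<partial>P)"
proof -
  have gm: "g \<in> borel_measurable (borel_on S)" using g by (rule borel_measurable_continuous_on_restrict)
  obtain C where C: "\<And>x. x \<in> S \<Longrightarrow> norm (g x) \<le> C"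
    using compact_imp_bounded[OF compact_continuous_image[OF g S(1)]] by (auto simp: bounded_iff)
  have bd: "norm (g x) \<le> C" if "x \<in> space (borel_on S)" for x using C that by (simp add: space_restrict_space)
  define T1 where "T1 = (\<lambda>x :: 'a. x)"
  have T1: "T1 \<in> measurable (\<pi> t) (borel_on S)"
    unfolding T1_def using sets_\<pi> by (intro measurable_ident_sets) simp
  obtain s where
    s: "\<And>n. simple_function (borel_on S) (s n)" "\<And>x. x \<in> space (borel_on S) \<Longrightarrow> (\<lambda>n. s n x) \<longlonglongrightarrow> g x"
      "\<And>n x. x \<in> space (borel_on S) \<Longrightarrow> norm (s n x) \<le> 2 * C"
    using bounded_simple_approx[OF gm bd] by blast
  have B: "s n -` {c} \<inter> space (borel_on S) \<in> sets (\<pi> t)" for n c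
    unfolding sets_\<pi> using s(1)[of n] by (rule simple_functionD)
  have "s n -` {c} \<inter> space (borel_on S) \<inter> space (\<pi> t) = s n -` {c} \<inter> space (borel_on S)" for n c
    by (auto simp: \<pi>_def)
  then have eq: "(LINT x:T1 -` (s n -` {c} \<inter> space (borel_on S)) \<inter> space (\<pi> t)|\<pi> t. v t x)
      = (LINT w:X t -` (s n -` {c} \<inter> space (borel_on S)) \<inter> space P|P. W w)" for n c
    using v_set_integral[OF t B[of n c]] by (simp add: T1_def flux_def)
  have "(\<integral>x. g (T1 x) \<bullet> v t x \<partial>\<pi> t) = (\<integral>w. g (X t w) \<bullet> W w \<partial>P)"
    using integral_simple_approx_tendsto[OF s T1 v_integrable[OF t]]
      integral_simple_approx_tendsto[OF s X_measurable[OF t] integrable_W]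
    unfolding eq by (rule LIMSEQ_unique)
  then show ?thesis by (simp add: T1_def)
qed

lemma
  fixes f :: "real \<times> 'a \<Rightarrow> 'b::euclidean_space"
  assumes f: "continuous_on ({0..1} \<times> S) f"
  shows measurable_along_path: "(\<lambda>z. f (fst z, X (fst z) (snd z))) \<in> borel_measurable (I \<Otimes>\<^sub>M P)"
    and bounded_along_path: "\<exists>C. \<forall>z\<in>space (I \<Otimes>\<^sub>M P). norm (f (fst z, X (fst z) (snd z))) \<le> C"
proof -
  show "(\<lambda>z. f (fst z, X (fst z) (snd z))) \<in> borel_measurable (I \<Otimes>\<^sub>M P)"
    using measurable_compose[OF path_measurable borel_measurable_continuous_on_restrict[OF f]] by simp
  have "compact ({0..1::real} \<times> S)" using S(1) by (intro compact_Times) auto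
  from compact_imp_bounded[OF compact_continuous_image[OF f this]]
  obtain C where "\<And>z. z \<in> {0..1} \<times> S \<Longrightarrow> norm (f z) \<le> C" by (auto simp: bounded_iff)
  then show "\<exists>C. \<forall>z\<in>space (I \<Otimes>\<^sub>M P). norm (f (fst z, X (fst z) (snd z))) \<le> C"
    using X_in by (intro exI[of _ C]) (auto simp: space_pair_measure space_unit_interval)
qed

text \<open>Along each segment this is the fundamental theorem of calculus for
  \<open>\<eta> (t, X t w)\<close>; Fubini exchanges the average over \<open>w\<close> with the time
  integral.\<close>

lemma continuity_equation_flux: "continuity_equation S \<pi> flux"
  unfolding continuity_equation_def
proof (intro allI impI)
  fix \<eta> \<eta>t :: "real \<times> 'a \<Rightarrow> real" and \<eta>x :: "real \<times> 'a \<Rightarrow> 'a"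
  assume C1: "C1_on_cylinder S \<eta> \<eta>t \<eta>x"
  interpret PP: pair_prob_space I P by (rule pair_prob)
  have \<eta>t: "continuous_on ({0..1} \<times> S) \<eta>t" and \<eta>x: "continuous_on ({0..1} \<times> S) \<eta>x"
    and d\<eta>: "\<And>z. z \<in> {0..1} \<times> S \<Longrightarrow> (\<eta> has_derivative (\<lambda>(s, y). s * \<eta>t z + \<eta>x z \<bullet> y)) (at z within {0..1} \<times> S)"
    using C1 by (auto simp: C1_on_cylinder_def)
  have \<eta>: "continuous_on ({0..1} \<times> S) \<eta>"
    unfolding continuous_on_eq_continuous_within using has_derivative_continuous[OF d\<eta>] by blast
  obtain D where D: "D \<ge> 0" "\<And>w. w \<in> space P \<Longrightarrow> norm (W w) \<le> D" using W_bounded by metis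
  have i1: "integrable (I \<Otimes>\<^sub>M P) (\<lambda>z. \<eta>t (fst z, X (fst z) (snd z)))"
  proof -
    obtain C where "\<forall>z\<in>space (I \<Otimes>\<^sub>M P). norm (\<eta>t (fst z, X (fst z) (snd z))) \<le> C"
      using bounded_along_path[OF \<eta>t] by blast
    then show ?thesis
      using measurable_along_path[OF \<eta>t] by (intro PP.P.integrable_const_bound[where B=C] AE_I2) auto
  qed
  have i2: "integrable (I \<Otimes>\<^sub>M P) (\<lambda>z. \<eta>x (fst z, X (fst z) (snd z)) \<bullet> W (snd z))"
  proof -
    obtain C where C: "\<And>z. z\<in>space (I \<Otimes>\<^sub>M P) \<Longrightarrow> norm (\<eta>x (fst z, X (fst z) (snd z))) \<le> C"
      using bounded_along_path[OF \<eta>x] by blast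
    note [measurable] = measurable_along_path[OF \<eta>x]
    show ?thesis
    proof (rule PP.P.integrable_const_bound[where B="C * D"])
      show "AE z in I \<Otimes>\<^sub>M P. norm (\<eta>x (fst z, X (fst z) (snd z)) \<bullet> W (snd z)) \<le> C * D"
      proof (rule AE_I2)
        fix z assume z: "z \<in> space (I \<Otimes>\<^sub>M P)"
        have "norm (\<eta>x (fst z, X (fst z) (snd z)) \<bullet> W (snd z)) \<le> norm (\<eta>x (fst z, X (fst z) (snd z))) * norm (W (snd z))"
          using Cauchy_Schwarz_ineq2 by simp
        also have "\<dots> \<le> C * D"
          using C[OF z] D(2)[of "snd z"] z by (intro mult_mono order_trans[OF norm_ge_zero C[OF z]]) (auto simp: space_pair_measure)
        finally show "norm (\<eta>x (fst z, X (fst z) (snd z)) \<bullet> W (snd z)) \<le> C * D" .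
      qed
    qed measurable
  qed
  let ?h = "\<lambda>t w. \<eta>t (t, X t w) + \<eta>x (t, X t w) \<bullet> W w"
  have slice: "continuous_on S (\<lambda>x. f (t, x))" if "t \<in> {0..1}" "continuous_on ({0..1} \<times> S) f"
    for t :: real and f :: "real \<times> 'a \<Rightarrow> 'b::topological_space"
    using that(1) by (intro continuous_on_compose2[OF that(2)] continuous_intros) auto
  have e1: "(\<integral>x. \<eta>t (t, x) \<partial>\<pi> t) = (\<integral>w. \<eta>t (t, X t w) \<partial>P)"
    and e2: "(\<integral>x. \<eta>x (t, x) \<bullet> v t x \<partial>\<pi> t) = (\<integral>w. \<eta>x (t, X t w) \<bullet> W w \<partial>P)" if "t \<in> {0..1}" for t
  proof -
    show "(\<integral>x. \<eta>t (t, x) \<partial>\<pi> t) = (\<integral>w. \<eta>t (t, X t w) \<partial>P)"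
      by (rule integral_\<pi>[OF that borel_measurable_continuous_on_restrict[OF slice[OF that \<eta>t]]])
    show "(\<integral>x. \<eta>x (t, x) \<bullet> v t x \<partial>\<pi> t) = (\<integral>w. \<eta>x (t, X t w) \<bullet> W w \<partial>P)"
      by (rule integral_inner_v[OF that slice[OF that \<eta>x]])
  qed
  have ftc: "(\<integral>t. ?h t w \<partial>I) = \<eta> (1, V w) - \<eta> (0, U w)" if w: "w \<in> space P" for w
  proof -
    have path: "(\<lambda>\<tau>. (\<tau>, X \<tau> w)) ` {0..1} \<subseteq> {0..1} \<times> S" using X_in w by auto
    have pc: "continuous_on {0..1} (\<lambda>\<tau>. (\<tau>, X \<tau> w))" unfolding X_def by (intro continuous_intros)
    have deriv: "((\<lambda>\<tau>. \<eta> (\<tau>, X \<tau> w)) has_vector_derivative ?h t w) (at t within {0..1})" if t: "t \<in> {0..1}" for t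
    proof -
      have "((\<lambda>\<tau>. X \<tau> w) has_derivative (\<lambda>s. s *\<^sub>R W w)) (at t within {0..1})"
        unfolding X_def W_def by (auto intro!: derivative_eq_intros simp: fun_eq_iff algebra_simps)
      then have p: "((\<lambda>\<tau>. (\<tau>, X \<tau> w)) has_derivative (\<lambda>s. (s, s *\<^sub>R W w))) (at t within {0..1})"
        by (intro has_derivative_Pair has_derivative_ident)
      \<comment> \<open>The derivative of \<open>\<eta>\<close> exists only within the cylinder. The
        segment stays inside, so restricting to its image is enough for the chain rule.\<close>
      have "(\<eta> has_derivative (\<lambda>(s, y). s * \<eta>t (t, X t w) + \<eta>x (t, X t w) \<bullet> y)) (at (t, X t w) within (\<lambda>\<tau>. (\<tau>, X \<tau> w)) ` {0..1})"
        using has_derivative_subset[OF d\<eta>[of "(t, X t w)"] path] X_in[OF t w] t by simp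
      from has_derivative_in_compose[OF p this]
      show ?thesis unfolding has_vector_derivative_def
        by (simp add: distrib_left)
    qed
    have "continuous_on {0..1} (\<lambda>t. ?h t w)"
      by (intro continuous_intros continuous_on_compose2[OF \<eta>t pc path] continuous_on_compose2[OF \<eta>x pc path])
    from integral_FTC_atLeastAtMost[OF zero_le_one _ this, of "\<lambda>\<tau>. \<eta> (\<tau>, X \<tau> w)"] deriv
    show ?thesis by (simp add: integral_restrict_space X_endpoints)
  qed
  have sum_int: "integrable (I \<Otimes>\<^sub>M P) (\<lambda>(t, w). ?h t w)"
    using Bochner_Integration.integrable_add[OF i1 i2] by (simp add: case_prod_unfold)
  have int1: "integrable I (\<lambda>t. \<integral>w. \<eta>t (t, X t w) \<partial>P)" and int2: "integrable I (\<lambda>t. \<integral>w. \<eta>x (t, X t w) \<bullet> W w \<partial>P)"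
    using PP.integrable_fst'[OF i1] PP.integrable_fst'[OF i2] by simp_all
  have "(LINT t:{0..1}|lborel. (\<integral>x. \<eta>t (t, x) \<partial>\<pi> t)) + (LINT t:{0..1}|lborel. (\<integral>x. \<eta>x (t, x) \<bullet> v t x \<partial>\<pi> t))
      = (\<integral>t. (\<integral>w. \<eta>t (t, X t w) \<partial>P) \<partial>I) + (\<integral>t. (\<integral>w. \<eta>x (t, X t w) \<bullet> W w \<partial>P) \<partial>I)"
    unfolding set_integral_restrict
    by (intro arg_cong2[of _ _ _ _ "(+)"] Bochner_Integration.integral_cong) (simp_all add: e1 e2 space_unit_interval)
  also have "\<dots> = (\<integral>z. \<eta>t (fst z, X (fst z) (snd z)) \<partial>(I \<Otimes>\<^sub>M P)) + (\<integral>z. \<eta>x (fst z, X (fst z) (snd z)) \<bullet> W (snd z) \<partial>(I \<Otimes>\<^sub>M P))"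
    using PP.integral_fst'[OF i1] PP.integral_fst'[OF i2] by simp
  also have "\<dots> = (\<integral>(t, w). ?h t w \<partial>(I \<Otimes>\<^sub>M P))"
    using Bochner_Integration.integral_add[OF i1 i2] by (simp add: case_prod_unfold)
  also have "\<dots> = (\<integral>w. (\<integral>t. ?h t w \<partial>I) \<partial>P)"
    using PP.integral_snd[OF sum_int] by simp
  also have "\<dots> = (\<integral>w. \<eta> (1, X 1 w) - \<eta> (0, X 0 w) \<partial>P)"
    by (intro Bochner_Integration.integral_cong) (simp_all add: ftc X_endpoints)
  also have "\<dots> = (\<integral>w. \<eta> (1, X 1 w) \<partial>P) - (\<integral>w. \<eta> (0, X 0 w) \<partial>P)"
  proof (rule Bochner_Integration.integral_diff)
    have "integrable P (\<lambda>w. \<eta> (t, X t w))" if t: "t \<in> {0..1}" for t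
      using integrable_prob_measures[OF \<pi>_prob[OF t] slice[OF t \<eta>] S(1)]
      unfolding \<pi>_def
      by (subst (asm) integrable_distr_eq[OF X_measurable[OF t] borel_measurable_continuous_on_restrict[OF slice[OF t \<eta>]]])
    then show "integrable P (\<lambda>w. \<eta> (1, X 1 w))" "integrable P (\<lambda>w. \<eta> (0, X 0 w))" by auto
  qed
  also have "\<dots> = (\<integral>x. \<eta> (1, x) \<partial>\<pi> 1) - (\<integral>x. \<eta> (0, x) \<partial>\<pi> 0)"
    using integral_\<pi>[OF _ borel_measurable_continuous_on_restrict[OF slice[OF _ \<eta>]]] by simp
  finally show "(LINT t:{0..1}|lborel. (\<integral>x. \<eta>t (t, x) \<partial>\<pi> t)) + (LINT t:{0..1}|lborel. (\<integral>x. \<eta>x (t, x) \<bullet> v t x \<partial>\<pi> t))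
      = (\<integral>x. \<eta> (1, x) \<partial>\<pi> 1) - (\<integral>x. \<eta> (0, x) \<partial>\<pi> 0)" .
qed

text \<open>
  Conditional Jensen inequality: \<open>v t\<close> is the conditional expectation of the displacement \<open>W\<close> given
  its position at time \<open>t\<close>, and \<open>L\<close> is a supremum of countably many affine functions.
\<close>

lemma convex_v_le:
  assumes t: "t \<in> {0..1}" and L: "convex_on UNIV L" and l: "integrable (\<pi> t) l"
    and le: "\<And>A. A \<in> sets (\<pi> t) \<Longrightarrow> (LINT w:X t -` A \<inter> space P|P. L (W w)) \<le> (LINT x:A|\<pi> t. l x)"
  shows "AE x in \<pi> t. L (v t x) \<le> l x"
proof -
  obtain F where F: "countable F" "\<And>a b x. (a, b) \<in> F \<Longrightarrow> a \<bullet> x + b \<le> L x"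
    "\<And>x u. \<forall>(a, b)\<in>F. a \<bullet> x + b \<le> u \<Longrightarrow> L x \<le> u"
    by (rule convex_countable_minorants[OF L]) (rule that)
  interpret \<pi>: prob_space "\<pi> t" using prob_measuresD(1)[OF \<pi>_prob[OF t]] .
  have iL: "integrable P (\<lambda>w. L (W w))"
    using convex_on_continuous[OF open_UNIV L] by (rule integrable_continuous_W)
  have "AE x in \<pi> t. \<forall>p\<in>F. fst p \<bullet> v t x + snd p \<le> l x"
    unfolding AE_ball_countable[OF F(1)]
  proof
    fix p assume p: "p \<in> F"
    show "AE x in \<pi> t. fst p \<bullet> v t x + snd p \<le> l x"
    proof (rule AE_le_of_set_integral_le[OF _ l])
      show "integrable (\<pi> t) (\<lambda>x. fst p \<bullet> v t x + snd p)" using v_integrable[OF t] by auto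
      fix A assume A: "A \<in> sets (\<pi> t)"
      have pre[measurable]: "X t -` A \<inter> space P \<in> sets P"
        using A sets_\<pi> by (intro measurable_sets[OF X_measurable[OF t]]) simp
      have iv: "integrable (\<pi> t) (\<lambda>x. indicator A x *\<^sub>R v t x)"
        using A v_integrable[OF t] by (rule integrable_mult_indicator)
      have iW: "integrable P (\<lambda>w. indicator (X t -` A \<inter> space P) w *\<^sub>R W w)"
        using pre integrable_W by (rule integrable_mult_indicator)
      \<comment> \<open>An affine function of \<open>v t\<close> integrated over \<open>A\<close>
        equals the same affine function of \<open>W\<close> integrated over the preimage of
        \<open>A\<close>: the linear part by the definition of \<open>flux\<close>, the constant
        because \<open>\<pi> t\<close> is the law of \<open>X t\<close>. There it is dominated by
        \<open>L (W w)\<close>.\<close>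
      have "(LINT x:A|\<pi> t. fst p \<bullet> v t x + snd p) = (\<integral>x. fst p \<bullet> (indicator A x *\<^sub>R v t x) + indicator A x * snd p \<partial>\<pi> t)"
        unfolding set_lebesgue_integral_def
        by (intro Bochner_Integration.integral_cong) (auto split: split_indicator)
      also have "\<dots> = (\<integral>x. fst p \<bullet> (indicator A x *\<^sub>R v t x) \<partial>\<pi> t) + (\<integral>x. indicator A x * snd p \<partial>\<pi> t)"
        using iv A by (intro Bochner_Integration.integral_add integrable_inner_right) (auto simp: \<pi>.emeasure_eq_measure)
      also have "(\<integral>x. fst p \<bullet> (indicator A x *\<^sub>R v t x) \<partial>\<pi> t) = fst p \<bullet> (\<integral>x. indicator A x *\<^sub>R v t x \<partial>\<pi> t)"
        by (intro integral_inner_right) (rule iv)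
      also have "(\<integral>x. indicator A x *\<^sub>R v t x \<partial>\<pi> t) = flux t A"
        using v_set_integral[OF t A] by (simp add: set_lebesgue_integral_def)
      also have "(\<integral>x. indicator A x * snd p \<partial>\<pi> t) = measure (\<pi> t) A * snd p"
        using A by simp
      also have "measure (\<pi> t) A = measure P (X t -` A \<inter> space P)"
        using A sets_\<pi> X_measurable[OF t] by (simp add: \<pi>_def measure_distr)
      also have "fst p \<bullet> flux t A = (\<integral>w. fst p \<bullet> (indicator (X t -` A \<inter> space P) w *\<^sub>R W w) \<partial>P)"
        unfolding flux_def set_lebesgue_integral_def by (rule integral_inner_right[symmetric]) (rule iW)
      also have "measure P (X t -` A \<inter> space P) * snd p = (\<integral>w. indicator (X t -` A \<inter> space P) w * snd p \<partial>P)"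
        by simp
      also have "(\<integral>w. fst p \<bullet> (indicator (X t -` A \<inter> space P) w *\<^sub>R W w) \<partial>P) + (\<integral>w. indicator (X t -` A \<inter> space P) w * snd p \<partial>P)
          = (\<integral>w. fst p \<bullet> (indicator (X t -` A \<inter> space P) w *\<^sub>R W w) + indicator (X t -` A \<inter> space P) w * snd p \<partial>P)"
        using iW by (intro Bochner_Integration.integral_add[symmetric] integrable_inner_right) (auto simp: emeasure_eq_measure)
      also have "\<dots> \<le> (LINT w:X t -` A \<inter> space P|P. L (W w))"
        unfolding set_lebesgue_integral_def
      proof (rule integral_mono)
        show "integrable P (\<lambda>w. fst p \<bullet> (indicator (X t -` A \<inter> space P) w *\<^sub>R W w) + indicator (X t -` A \<inter> space P) w * snd p)"
          using iW by (intro Bochner_Integration.integrable_add integrable_inner_right) (auto simp: emeasure_eq_measure)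
        show "integrable P (\<lambda>w. indicator (X t -` A \<inter> space P) w *\<^sub>R L (W w))"
          using pre iL by (rule integrable_mult_indicator)
      qed (use F(2)[of "fst p" "snd p"] p in \<open>auto split: split_indicator\<close>)
      also have "\<dots> \<le> (LINT x:A|\<pi> t. l x)" by (rule le[OF A])
      finally show "(LINT x:A|\<pi> t. fst p \<bullet> v t x + snd p) \<le> (LINT x:A|\<pi> t. l x)" .
    qed
  qed
  then show ?thesis by (rule eventually_mono) (rule F(3), simp add: case_prod_unfold)
qed

text \<open>The conditional Jensen inequality for the convex function \<open>norm\<close>, with the
  constant bound of \<open>W\<close> as right-hand side; the bound is uniform in time.\<close>

lemma v_bounded: obtains D where "\<And>t. t \<in> {0..1} \<Longrightarrow> AE x in \<pi> t. norm (v t x) \<le> D"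
proof -
  obtain D where D: "D \<ge> 0" "\<And>w. w \<in> space P \<Longrightarrow> norm (W w) \<le> D" using W_bounded by metis
  have "AE x in \<pi> t. norm (v t x) \<le> D" if t: "t \<in> {0..1}" for t
  proof (rule convex_v_le[OF t])
    interpret \<pi>: prob_space "\<pi> t" using prob_measuresD(1)[OF \<pi>_prob[OF t]] .
    show "convex_on UNIV (norm :: 'a \<Rightarrow> real)" using convex_on_dist[of UNIV "0 :: 'a"] by simp
    show "integrable (\<pi> t) (\<lambda>x. D)" by simp
    fix A assume A: "A \<in> sets (\<pi> t)"
    have pre[measurable]: "X t -` A \<inter> space P \<in> sets P"
      using A sets_\<pi> by (intro measurable_sets[OF X_measurable[OF t]]) simp
    have "(LINT w:X t -` A \<inter> space P|P. norm (W w)) \<le> (\<integral>w. indicator (X t -` A \<inter> space P) w * D \<partial>P)"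
      unfolding set_lebesgue_integral_def
    proof (rule integral_mono)
      show "integrable P (\<lambda>w. indicat_real (X t -` A \<inter> space P) w *\<^sub>R norm (W w))"
        using pre integrable_norm[OF integrable_W] by (rule integrable_mult_indicator)
      show "integrable P (\<lambda>w. indicat_real (X t -` A \<inter> space P) w * D)"
        by (auto simp: emeasure_eq_measure)
    qed (use D in \<open>auto split: split_indicator\<close>)
    also have "\<dots> = measure P (X t -` A \<inter> space P) * D" by simp
    also have "measure P (X t -` A \<inter> space P) = measure (\<pi> t) A"
      using A sets_\<pi> X_measurable[OF t] by (simp add: \<pi>_def measure_distr)
    also have "measure (\<pi> t) A * D = (LINT x:A|\<pi> t. D)"
      using A by (simp add: set_lebesgue_integral_def)
    finally show "(LINT w:X t -` A \<inter> space P|P. norm (W w)) \<le> (LINT x:A|\<pi> t. D)" .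
  qed
  then show ?thesis by (rule that)
qed

lemma nn_integral_bound_unit_interval:
  assumes "\<And>t. t \<in> {0..1} \<Longrightarrow> f t \<le> (C :: ennreal)" "C < \<infinity>"
  shows "(\<integral>\<^sup>+t. f t \<partial>I) < \<infinity>"
proof -
  interpret I: prob_space I by (rule prob_space_unit_interval)
  have "(\<integral>\<^sup>+t. f t \<partial>I) \<le> (\<integral>\<^sup>+t. C \<partial>I)"
    using assms(1) by (intro nn_integral_mono) (simp add: space_unit_interval)
  also have "\<dots> < \<infinity>" using assms(2) I.emeasure_space_1 by simp
  finally show ?thesis .
qed

lemma nn_integral_AE_bound:
  assumes t: "t \<in> {0..1}" and "AE x in \<pi> t. f x \<le> C"
  shows "(\<integral>\<^sup>+x. ennreal (f x) \<partial>\<pi> t) \<le> ennreal C"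
proof -
  interpret \<pi>: prob_space "\<pi> t" using prob_measuresD(1)[OF \<pi>_prob[OF t]] .
  have "(\<integral>\<^sup>+x. ennreal (f x) \<partial>\<pi> t) \<le> (\<integral>\<^sup>+x. ennreal C \<partial>\<pi> t)"
    using assms(2) by (intro nn_integral_mono_AE) (auto elim!: eventually_mono intro: ennreal_leI)
  then show ?thesis by (simp add: \<pi>.emeasure_space_1)
qed

text \<open>A bounded velocity has finite moments of every order; 2 is picked as the exponent above
  1.\<close>

lemma moment_finite:
  "(\<integral>\<^sup>+t\<in>{0..1}. (\<integral>\<^sup>+x. ennreal (norm (v t x) powr 2) \<partial>\<pi> t) \<partial>lborel) < \<infinity>"
proof -
  obtain D where D: "\<And>t. t \<in> {0..1} \<Longrightarrow> AE x in \<pi> t. norm (v t x) \<le> D" using v_bounded by metis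
  have "(\<integral>\<^sup>+x. ennreal (norm (v t x) powr 2) \<partial>\<pi> t) \<le> ennreal (D powr 2)" if t: "t \<in> {0..1}" for t
    by (rule nn_integral_AE_bound[OF t], rule eventually_mono[OF D[OF t]]) (rule powr_mono2, simp_all)
  moreover have "ennreal (D powr 2) < \<infinity>" by (simp del: powr_numeral)
  ultimately have "(\<integral>\<^sup>+t. (\<integral>\<^sup>+x. ennreal (norm (v t x) powr 2) \<partial>\<pi> t) \<partial>I) < \<infinity>"
    by (rule nn_integral_bound_unit_interval)
  then show ?thesis by (simp add: nn_integral_restrict_space)
qed

lemma dynamical_cost_le:
  assumes L: "convex_on UNIV L"
  shows "dynamical_cost L (\<pi>, flux) \<le> ereal (\<integral>w. L (W w) \<partial>P)"
proof -
  let ?c = "\<integral>w. L (W w) \<partial>P"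
  let ?F = "\<lambda>t. \<integral>\<^sup>+x. ennreal (L (v t x)) \<partial>\<pi> t" and ?H = "\<lambda>t. \<integral>\<^sup>+x. ennreal (- L (v t x)) \<partial>\<pi> t"
  have L_cont: "continuous_on UNIV L" using convex_on_continuous[OF open_UNIV L] .
  have Lm[measurable]: "L \<in> borel_measurable borel" using L_cont by (rule borel_measurable_continuous_onI)
  have iL: "integrable P (\<lambda>w. L (W w))" using L_cont by (rule integrable_continuous_W)
  interpret I: prob_space I by (rule prob_space_unit_interval)
  obtain D where D: "\<And>t. t \<in> {0..1} \<Longrightarrow> AE x in \<pi> t. norm (v t x) \<le> D" using v_bounded by metis
  obtain C where C: "\<And>x. x \<in> cball 0 D \<Longrightarrow> norm (L x) \<le> C"
    using compact_imp_bounded[OF compact_continuous_image[OF continuous_on_subset[OF L_cont subset_UNIV] compact_cball[of 0 D]]]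
    by (auto simp: bounded_iff simp del: mem_cball mem_cball_0)
  have H_fin: "(\<integral>\<^sup>+t. ?H t \<partial>I) < \<infinity>"
  proof (rule nn_integral_bound_unit_interval)
    fix t :: real assume t: "t \<in> {0..1}"
    show "?H t \<le> ennreal C"
      by (rule nn_integral_AE_bound[OF t], rule eventually_mono[OF D[OF t]]) (use C in fastforce)
  qed simp
  \<comment> \<open>Says that the cost rate at time \<open>t\<close> is at most \<open>?c\<close>,
    written for the shift lemma with the constant \<open>- ?c\<close> as integrable
    function.\<close>
  have le: "?F t + ennreal (- ?c) \<le> ?H t + ennreal (- (- ?c))" if "t \<in> space I" for t
  proof -
    have t: "t \<in> {0..1}" using that by (simp add: space_unit_interval)
    have fin: "finite_measure (\<pi> t)" using prob_measuresD(1)[OF \<pi>_prob[OF t]] by (rule prob_space.axioms(1))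
    have ac: "vm_absolutely_continuous (\<pi> t) (\<lambda>A. LINT w:X t -` A \<inter> space P|P. L (W w))"
      by (auto simp: vm_absolutely_continuous_def intro: integral_null_preimage[OF t])
    \<comment> \<open>Here \<open>l\<close> is the conditional expectation of \<open>L (W w)\<close>
      given the position \<open>X t w\<close>, obtained as the density of an image measure.\<close>
    obtain l where l: "integrable (\<pi> t) l"
      "\<And>A. A \<in> sets (\<pi> t) \<Longrightarrow> (LINT w:X t -` A \<inter> space P|P. L (W w)) = (LINT x:A|\<pi> t. l x)"
      using vector_Radon_Nikodym[OF fin vector_measure_integral_\<pi>[OF t iL] ac] by blast
    have AE_le: "AE x in \<pi> t. L (v t x) \<le> l x"
      by (rule convex_v_le[OF t L l(1)]) (simp add: l(2))
    \<comment> \<open>Jensen holds only almost everywhere, while the shift lemma wants a pointwise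
      inequality. The maximum repairs \<open>l\<close> on a null set.\<close>
    define l' where "l' x = max (l x) (L (v t x))" for x
    note [measurable] = borel_measurable_integrable[OF l(1)] borel_measurable_integrable[OF v_integrable[OF t]]
    have AE_eq: "AE x in \<pi> t. l x = l' x" using AE_le by (rule eventually_mono) (simp add: l'_def)
    have m': "l' \<in> borel_measurable (\<pi> t)" unfolding l'_def[abs_def] by measurable
    have i': "integrable (\<pi> t) l'"
      using integrable_cong_AE_imp[OF l(1) m' AE_eq] .
    have "(\<integral>x. l' x \<partial>\<pi> t) = (\<integral>x. l x \<partial>\<pi> t)"
      using AE_eq m' by (intro integral_cong_AE) auto
    also have "\<dots> = (LINT x:space (\<pi> t)|\<pi> t. l x)"
      unfolding set_lebesgue_integral_def by (intro Bochner_Integration.integral_cong) auto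
    also have "\<dots> = (LINT w:X t -` space (\<pi> t) \<inter> space P|P. L (W w))" by (simp add: l(2))
    also have "X t -` space (\<pi> t) \<inter> space P = space P"
      using measurable_space[OF X_measurable[OF t]] by (auto simp: \<pi>_def)
    also have "(LINT w:space P|P. L (W w)) = ?c"
      unfolding set_lebesgue_integral_def by (intro Bochner_Integration.integral_cong) auto
    finally have c: "(\<integral>x. - l' x \<partial>\<pi> t) = - ?c" by simp
    have "?F t + ennreal (\<integral>x. - l' x \<partial>\<pi> t) \<le> ?H t + ennreal (- (\<integral>x. - l' x \<partial>\<pi> t))"
    proof (rule nn_integral_le_shift_nonmeasurable)
      show "integrable (\<pi> t) (\<lambda>x. - l' x)" using i' by simp
      show "ennreal (L (v t x)) + ennreal (- l' x) \<le> ennreal (- L (v t x)) + ennreal (- (- l' x))" for x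
        using ennreal_parts_mono[of "- l' x" "- L (v t x)"] by (simp add: l'_def)
    qed
    then show ?thesis unfolding c .
  qed
  have "(\<integral>\<^sup>+t. ?F t \<partial>I) + ennreal (\<integral>t. - ?c \<partial>I) \<le> (\<integral>\<^sup>+t. ?H t \<partial>I) + ennreal (- (\<integral>t. - ?c \<partial>I))"
    by (rule nn_integral_le_shift_nonmeasurable) (use le in auto)
  moreover have "(\<integral>t. - ?c \<partial>I) = - ?c"
    using I.prob_space by (simp add: space_unit_interval)
  ultimately have "(\<integral>\<^sup>+t. ?F t \<partial>I) + ennreal (- ?c) \<le> (\<integral>\<^sup>+t. ?H t \<partial>I) + ennreal ?c"
    by (simp only: minus_minus)
  then show ?thesis unfolding dynamical_cost_restrict using H_fin by (rule enn2ereal_diff_le_ereal)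
qed

end

section \<open>Equality of the static and the dynamical problem\<close>

lemma snd_distr_pair:
  assumes "prob_space M" "prob_space N"
  shows "distr (M \<Otimes>\<^sub>M N) N snd = N"
proof (rule measure_eqI)
  interpret M: prob_space M by fact
  interpret N: prob_space N by fact
  fix A assume "A \<in> sets (distr (M \<Otimes>\<^sub>M N) N snd)"
  then have A: "A \<in> sets N" by simp
  have "snd -` A \<inter> space (M \<Otimes>\<^sub>M N) = space M \<times> A"
    using sets.sets_into_space[OF A] by (auto simp: space_pair_measure)
  then show "emeasure (distr (M \<Otimes>\<^sub>M N) N snd) A = emeasure N A"
    using A by (simp add: emeasure_distr N.emeasure_pair_measure_Times M.emeasure_space_1)
qed simp

lemma displacement_flow_exists:
  fixes S :: "'a::euclidean_space set"
  assumes S: "compact S" "convex S" and p: "p \<in> prob_measures S" and \<gamma>: "\<gamma> \<in> prob_measures S"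
    and L: "convex_on UNIV L" and shift: "AE x0 in p. \<forall>x\<in>S. L (x - x0) = L x"
  obtains \<pi> m where "continuous_map (top_of_set {0..1}) (weak_topology S) \<pi>"
    "time_vector_measure S m" "\<forall>t\<in>{0..1}. vm_absolutely_continuous (\<pi> t) (m t)"
    "(\<integral>\<^sup>+t\<in>{0..1}. (\<integral>\<^sup>+x. ennreal (norm (vm_RN_deriv (\<pi> t) (m t) x) powr 2) \<partial>\<pi> t) \<partial>lborel) < \<infinity>"
    "continuity_equation S \<pi> m" "\<pi> 0 = p" "\<pi> 1 = \<gamma>"
    "dynamical_cost L (\<pi>, m) \<le> ereal (static_cost L \<gamma>)"
proof -
  interpret p: prob_space p using prob_measuresD(1)[OF p] .
  interpret \<gamma>: prob_space \<gamma> using prob_measuresD(1)[OF \<gamma>] .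
  interpret PP: pair_prob_space p \<gamma> ..
  have sets_p: "sets p = sets (borel_on S)" and sets_\<gamma>: "sets \<gamma> = sets (borel_on S)"
    using prob_measuresD(2)[OF p] prob_measuresD(2)[OF \<gamma>] by auto
  have fst: "fst \<in> measurable (p \<Otimes>\<^sub>M \<gamma>) (borel_on S)"
    using measurable_fst[of p \<gamma>] measurable_cong_sets[OF refl sets_p] by blast
  have snd: "snd \<in> measurable (p \<Otimes>\<^sub>M \<gamma>) (borel_on S)"
    using measurable_snd[of p \<gamma>] measurable_cong_sets[OF refl sets_\<gamma>] by blast
  \<comment> \<open>Start and end are independent, so that Fubini can fix the starting point
    \<open>x0\<close>.\<close>
  interpret D: displacement "p \<Otimes>\<^sub>M \<gamma>" S fst snd
    by unfold_locales (use S fst snd in auto)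
  have L_cont: "continuous_on UNIV L" using convex_on_continuous[OF open_UNIV L] .
  have "D.\<pi> 0 = distr (p \<Otimes>\<^sub>M \<gamma>) p fst"
    unfolding D.\<pi>_def D.X_endpoints using sets_p by (intro distr_cong) auto
  then have \<pi>0: "D.\<pi> 0 = p" by (simp add: \<gamma>.distr_pair_fst)
  have "D.\<pi> 1 = distr (p \<Otimes>\<^sub>M \<gamma>) \<gamma> snd"
    unfolding D.\<pi>_def D.X_endpoints using sets_\<gamma> by (intro distr_cong) auto
  then have \<pi>1: "D.\<pi> 1 = \<gamma>" by (simp add: snd_distr_pair p.prob_space_axioms \<gamma>.prob_space_axioms)
  have "(\<integral>w. L (D.W w) \<partial>(p \<Otimes>\<^sub>M \<gamma>)) = (\<integral>x0. (\<integral>x. L (D.W (x0, x)) \<partial>\<gamma>) \<partial>p)"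
    by (rule PP.integral_fst'[OF D.integrable_continuous_W[OF L_cont], symmetric])
  \<comment> \<open>For almost every \<open>x0\<close>, translation by \<open>x0\<close> does not
    affect \<open>L\<close> on \<open>S\<close>, so the inner integral does not depend on
    \<open>x0\<close>.\<close>
  also have "\<dots> = (\<integral>x0. static_cost L \<gamma> \<partial>p)"
  proof (rule integral_cong_AE)
    show "(\<lambda>x0. \<integral>x. L (D.W (x0, x)) \<partial>\<gamma>) \<in> borel_measurable p"
      using PP.integrable_fst'[OF D.integrable_continuous_W[OF L_cont]] by (rule borel_measurable_integrable)
    show "AE x0 in p. (\<integral>x. L (D.W (x0, x)) \<partial>\<gamma>) = static_cost L \<gamma>"
      using shift
    proof (rule eventually_mono)
      fix x0 assume x0: "\<forall>x\<in>S. L (x - x0) = L x"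
      show "(\<integral>x. L (D.W (x0, x)) \<partial>\<gamma>) = static_cost L \<gamma>"
        unfolding static_cost_def D.W_def using x0 prob_measuresD(3)[OF \<gamma>]
        by (intro Bochner_Integration.integral_cong) auto
    qed
  qed simp
  also have "\<dots> = static_cost L \<gamma>" using p.prob_space by simp
  finally have "(\<integral>w. L (D.W w) \<partial>(p \<Otimes>\<^sub>M \<gamma>)) = static_cost L \<gamma>" .
  then have "dynamical_cost L (D.\<pi>, D.flux) \<le> ereal (static_cost L \<gamma>)"
    using D.dynamical_cost_le[OF L] by simp
  then show ?thesis
    by (intro that[OF D.\<pi>_continuous D.flux_time_vector_measure _ D.moment_finite D.continuity_equation_flux \<pi>0 \<pi>1]
        ballI D.flux_absolutely_continuous)
qed

text \<open>Final marginals of flows are couplings of no larger cost (\<open>lower\<close>), and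
  every coupling is the final marginal of a flow of no larger cost (\<open>upper\<close>). With a
  static minimizer at hand, these two facts sandwich both values and transfer minimizers in either
  direction.\<close>

lemma static_dynamical_equivalence:
  fixes \<Omega> :: "(real^'d) set"
    and \<mu> :: "'k::finite \<Rightarrow> (real^'d) measure"
    and L :: "real^'d^'k \<Rightarrow> real"
    and p :: "(real^'d^'k) measure"
  assumes \<Omega>: "compact \<Omega>" "convex \<Omega>" and \<mu>: "\<And>l. \<mu> l \<in> prob_measures \<Omega>"
    and L: "convex_on UNIV L" and p: "p \<in> prob_measures (power_set \<Omega>)"
    and start: "AE x0 in p. (\<forall>c. L (c *\<^sub>R x0) = L 0) \<and> (\<forall>x\<in>power_set \<Omega>. L (x - x0) = L x)"
  shows "(INF \<gamma>\<in>couplings \<Omega> \<mu>. ereal (static_cost L \<gamma>)) = (INF f\<in>flows \<Omega> p \<mu>. dynamical_cost L f)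
       \<and> (\<exists>\<gamma>. is_arg_min (static_cost L) (\<lambda>\<gamma>. \<gamma> \<in> couplings \<Omega> \<mu>) \<gamma>)
       \<and> (\<exists>f. is_arg_min (dynamical_cost L) (\<lambda>f. f \<in> flows \<Omega> p \<mu>) f)
       \<and> (\<forall>\<gamma>. is_arg_min (static_cost L) (\<lambda>\<gamma>. \<gamma> \<in> couplings \<Omega> \<mu>) \<gamma> \<longrightarrow>
            (\<exists>\<pi> m. is_arg_min (dynamical_cost L) (\<lambda>f. f \<in> flows \<Omega> p \<mu>) (\<pi>, m) \<and> \<pi> 1 = \<gamma>))
       \<and> (\<forall>\<pi> m. is_arg_min (dynamical_cost L) (\<lambda>f. f \<in> flows \<Omega> p \<mu>) (\<pi>, m) \<longrightarrow>
            is_arg_min (static_cost L) (\<lambda>\<gamma>. \<gamma> \<in> couplings \<Omega> \<mu>) (\<pi> 1))"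
proof -
  let ?K = "power_set \<Omega> :: (real^'d^'k) set"
  have K: "compact ?K" "convex ?K" using \<Omega> by (simp_all add: compact_power_set convex_power_set)
  have start_scale: "AE x0 in p. \<forall>c. L (c *\<^sub>R x0) = L 0" using start by (rule eventually_mono) blast
  have start_shift: "AE x0 in p. \<forall>x\<in>?K. L (x - x0) = L x" using start by (rule eventually_mono) blast
  have lower: "\<pi> 1 \<in> couplings \<Omega> \<mu> \<and> ereal (static_cost L (\<pi> 1)) \<le> dynamical_cost L (\<pi>, m)"
    if f: "(\<pi>, m) \<in> flows \<Omega> p \<mu>" for \<pi> m
  proof
    have \<pi>: "continuous_map (top_of_set {0..1}) (weak_topology ?K) \<pi>" using f by (simp add: flows_def)
    show "\<pi> 1 \<in> couplings \<Omega> \<mu>"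
      using f weak_flow_prob_measures[OF \<pi>, of 1] by (simp add: flows_def couplings_def)
    obtain r where r: "r > 1"
      "(\<integral>\<^sup>+t\<in>{0..1}. (\<integral>\<^sup>+x. ennreal (norm (vm_RN_deriv (\<pi> t) (m t) x) powr r) \<partial>\<pi> t) \<partial>lborel) < \<infinity>"
      using f by (auto simp: flows_def)
    show "ereal (static_cost L (\<pi> 1)) \<le> dynamical_cost L (\<pi>, m)"
      by (rule dynamical_cost_lower_bound[OF K(1) L \<pi> _ _ r])
         (use f start_scale in \<open>auto simp: flows_def\<close>)
  qed
  have upper: "\<exists>\<pi> m. (\<pi>, m) \<in> flows \<Omega> p \<mu> \<and> \<pi> 1 = \<gamma> \<and> dynamical_cost L (\<pi>, m) \<le> ereal (static_cost L \<gamma>)"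
    if \<gamma>: "\<gamma> \<in> couplings \<Omega> \<mu>" for \<gamma>
  proof -
    have "\<gamma> \<in> prob_measures ?K" using \<gamma> by (simp add: couplings_def)
    then obtain \<pi> m where fl: "continuous_map (top_of_set {0..1}) (weak_topology ?K) \<pi>"
      "time_vector_measure ?K m" "\<forall>t\<in>{0..1}. vm_absolutely_continuous (\<pi> t) (m t)"
      "(\<integral>\<^sup>+t\<in>{0..1}. (\<integral>\<^sup>+x. ennreal (norm (vm_RN_deriv (\<pi> t) (m t) x) powr 2) \<partial>\<pi> t) \<partial>lborel) < \<infinity>"
      "continuity_equation ?K \<pi> m" "\<pi> 0 = p" "\<pi> 1 = \<gamma>"
      "dynamical_cost L (\<pi>, m) \<le> ereal (static_cost L \<gamma>)"
      using displacement_flow_exists[OF K p _ L start_shift] by blast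
    have "(\<pi>, m) \<in> flows \<Omega> p \<mu>"
      unfolding flows_def mem_Collect_eq case_prod_conv
    proof (intro conjI)
      show "\<exists>r>1. (\<integral>\<^sup>+t\<in>{0..1}. (\<integral>\<^sup>+x. ennreal (norm (vm_RN_deriv (\<pi> t) (m t) x) powr r) \<partial>\<pi> t) \<partial>lborel) < \<infinity>"
        using fl(4) one_less_numeral_iff semiring_norm(76) by blast
      show "\<forall>l. marginal \<Omega> l (\<pi> 1) = \<mu> l" using \<gamma> fl(7) by (simp add: couplings_def)
    qed (use fl in blast)+
    with fl(7,8) show ?thesis by blast
  qed
  have opt_flow: "is_arg_min (dynamical_cost L) (\<lambda>f. f \<in> flows \<Omega> p \<mu>) (\<pi>, m)"
    if \<gamma>: "is_arg_min (static_cost L) (\<lambda>\<gamma>. \<gamma> \<in> couplings \<Omega> \<mu>) \<gamma>" and f: "(\<pi>, m) \<in> flows \<Omega> p \<mu>"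
      and le: "dynamical_cost L (\<pi>, m) \<le> ereal (static_cost L \<gamma>)" for \<gamma> \<pi> m
  proof -
    have "dynamical_cost L (\<pi>, m) \<le> dynamical_cost L (\<pi>', m')" if "(\<pi>', m') \<in> flows \<Omega> p \<mu>" for \<pi>' m'
    proof -
      note le
      also have "ereal (static_cost L \<gamma>) \<le> ereal (static_cost L (\<pi>' 1))"
        using lower[OF that] \<gamma> by (auto simp: is_arg_min_def not_less)
      also have "\<dots> \<le> dynamical_cost L (\<pi>', m')" using lower[OF that] by simp
      finally show ?thesis .
    qed
    with f show ?thesis by (auto simp: is_arg_min_def not_less)
  qed
  obtain \<gamma>0 where \<gamma>0: "is_arg_min (static_cost L) (\<lambda>\<gamma>. \<gamma> \<in> couplings \<Omega> \<mu>) \<gamma>0"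
    using static_minimizer_exists[where \<mu>=\<mu>, OF \<Omega>(1) \<mu> convex_on_continuous[OF open_UNIV L]] by blast
  then have \<gamma>0_in: "\<gamma>0 \<in> couplings \<Omega> \<mu>" and \<gamma>0_min: "\<And>\<gamma>. \<gamma> \<in> couplings \<Omega> \<mu> \<Longrightarrow> static_cost L \<gamma>0 \<le> static_cost L \<gamma>"
    by (auto simp: is_arg_min_def not_less)
  obtain \<pi>0 m0 where f0: "(\<pi>0, m0) \<in> flows \<Omega> p \<mu>" "\<pi>0 1 = \<gamma>0" "dynamical_cost L (\<pi>0, m0) \<le> ereal (static_cost L \<gamma>0)"
    using upper[OF \<gamma>0_in] by blast
  have f0_min: "is_arg_min (dynamical_cost L) (\<lambda>f. f \<in> flows \<Omega> p \<mu>) (\<pi>0, m0)"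
    by (rule opt_flow[OF \<gamma>0 f0(1,3)])
  have cost0: "dynamical_cost L (\<pi>0, m0) = ereal (static_cost L \<gamma>0)"
    using f0 lower[OF f0(1)] by (simp add: antisym)
  have "(INF \<gamma>\<in>couplings \<Omega> \<mu>. ereal (static_cost L \<gamma>)) = ereal (static_cost L \<gamma>0)"
    by (rule INF_eqI) (use \<gamma>0_in \<gamma>0_min in auto)
  moreover have "(INF f\<in>flows \<Omega> p \<mu>. dynamical_cost L f) = dynamical_cost L (\<pi>0, m0)"
    using f0_min f0(1) by (intro INF_eqI) (auto simp: is_arg_min_def not_less)
  moreover have "\<exists>\<pi> m. is_arg_min (dynamical_cost L) (\<lambda>f. f \<in> flows \<Omega> p \<mu>) (\<pi>, m) \<and> \<pi> 1 = \<gamma>"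
    if \<gamma>: "is_arg_min (static_cost L) (\<lambda>\<gamma>. \<gamma> \<in> couplings \<Omega> \<mu>) \<gamma>" for \<gamma>
  proof -
    have "\<gamma> \<in> couplings \<Omega> \<mu>" using \<gamma> by (simp add: is_arg_min_def)
    then obtain \<pi> m where "(\<pi>, m) \<in> flows \<Omega> p \<mu>" "\<pi> 1 = \<gamma>" "dynamical_cost L (\<pi>, m) \<le> ereal (static_cost L \<gamma>)"
      using upper by blast
    with opt_flow[OF \<gamma>] show ?thesis by blast
  qed
  moreover have "is_arg_min (static_cost L) (\<lambda>\<gamma>. \<gamma> \<in> couplings \<Omega> \<mu>) (\<pi> 1)"
    if f: "is_arg_min (dynamical_cost L) (\<lambda>f. f \<in> flows \<Omega> p \<mu>) (\<pi>, m)" for \<pi> m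
  proof -
    have fl: "(\<pi>, m) \<in> flows \<Omega> p \<mu>" using f by (simp add: is_arg_min_def)
    have "ereal (static_cost L (\<pi> 1)) \<le> dynamical_cost L (\<pi>, m)" using lower[OF fl] by simp
    also have "\<dots> \<le> dynamical_cost L (\<pi>0, m0)" using f f0(1) by (auto simp: is_arg_min_def not_less)
    finally have "static_cost L (\<pi> 1) \<le> static_cost L \<gamma>0" by (simp add: cost0)
    then have "static_cost L (\<pi> 1) \<le> static_cost L \<gamma>" if "\<gamma> \<in> couplings \<Omega> \<mu>" for \<gamma>
      using \<gamma>0_min[OF that] by (rule order_trans)
    then show ?thesis using lower[OF fl] by (simp add: is_arg_min_def not_less)
  qed
  ultimately show ?thesis using \<gamma>0 f0_min cost0 by auto
qed

section \<open>Orthogonal projections and supports of measures\<close>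

lemma orth_proj_eqI:
  assumes E: "subspace E" and y: "y \<in> E" "x - y \<in> E\<^sup>\<bottom>"
  shows "orth_proj E x = y"
  unfolding orth_proj_def
proof (rule the_equality)
  fix z assume z: "z \<in> E \<and> x - z \<in> E\<^sup>\<bottom>"
  have "y - z \<in> E" using E y(1) z by (simp add: subspace_diff)
  moreover have "(x - z) - (x - y) \<in> E\<^sup>\<bottom>" using z y(2) by (intro subspace_diff[OF subspace_orthogonal_comp, of "x - z" E "x - y"]) auto
  ultimately have "y - z \<in> E \<inter> E\<^sup>\<bottom>" by simp
  then show "z = y" using orthogonal_Int_0[OF E] by simp
qed (use y in simp)

lemma orth_proj:
  assumes E: "subspace E"
  shows "orth_proj E x \<in> E" "x - orth_proj E x \<in> E\<^sup>\<bottom>"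
proof -
  have "x \<in> E + E\<^sup>\<bottom>" using subspace_sum_orthogonal_comp[OF E] by simp
  then obtain y z where "y \<in> E" "z \<in> E\<^sup>\<bottom>" "x = y + z" by (auto elim: set_plus_elim)
  then have "y \<in> E" "x - y \<in> E\<^sup>\<bottom>" by auto
  with orth_proj_eqI[OF E this] show "orth_proj E x \<in> E" "x - orth_proj E x \<in> E\<^sup>\<bottom>" by auto
qed

lemma orth_proj_combination:
  assumes E: "subspace E"
  shows "orth_proj E (a *\<^sub>R x + b *\<^sub>R y) = a *\<^sub>R orth_proj E x + b *\<^sub>R orth_proj E y"
proof (rule orth_proj_eqI[OF E])
  show "a *\<^sub>R orth_proj E x + b *\<^sub>R orth_proj E y \<in> E"
    using orth_proj(1)[OF E] E by (intro subspace_add subspace_scale)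
  have "a *\<^sub>R (x - orth_proj E x) + b *\<^sub>R (y - orth_proj E y) \<in> E\<^sup>\<bottom>"
    using orth_proj(2)[OF E] by (intro subspace_add subspace_scale subspace_orthogonal_comp)
  then show "a *\<^sub>R x + b *\<^sub>R y - (a *\<^sub>R orth_proj E x + b *\<^sub>R orth_proj E y) \<in> E\<^sup>\<bottom>"
    by (simp add: algebra_simps)
qed

lemma orth_proj_orthogonal: "subspace E \<Longrightarrow> x \<in> E\<^sup>\<bottom> \<Longrightarrow> orth_proj E x = 0"
  by (rule orth_proj_eqI) (auto simp: subspace_0)

lemma convex_on_orth_proj:
  assumes E: "subspace E" and "convex_on E f"
  shows "convex_on UNIV (\<lambda>x. f (orth_proj E x))"
  using assms(2) orth_proj(1)[OF E] by (simp add: convex_on_def orth_proj_combination[OF E])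

text \<open>A point of \<open>S\<close> outside the support has a neighbourhood of measure zero,
  hence one from a countable base; so the exceptional points are covered by countably many null
  sets.\<close>

lemma AE_in_measure_support:
  fixes S :: "'a::second_countable_topology set"
  assumes M: "M \<in> prob_measures S"
  shows "AE x in M. x \<in> measure_support S M"
proof -
  obtain B :: "'a set set" where B: "countable B" "topological_basis B"
    using ex_countable_basis by blast
  define N where "N = {U \<in> B. emeasure M (U \<inter> S) = 0}"
  have "(\<Union>U\<in>N. U \<inter> S) \<in> null_sets M"
  proof (rule null_sets_UN')
    show "countable N" using B(1) by (auto simp: N_def)
    fix U assume U: "U \<in> N"
    then have "open U" using topological_basis_open[OF B(2)] by (auto simp: N_def)
    then have "U \<inter> S \<in> sets M"
      by (auto simp: prob_measuresD(2)[OF M] sets_restrict_space)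
    then show "U \<inter> S \<in> null_sets M" using U by (auto simp: N_def)
  qed
  then have "AE x in M. x \<notin> (\<Union>U\<in>N. U \<inter> S)" by (rule AE_not_in)
  moreover have "AE x in M. x \<in> S" using AE_space[of M] by (simp add: prob_measuresD(3)[OF M])
  ultimately show ?thesis
  proof eventually_elim
    fix x assume x: "x \<notin> (\<Union>U\<in>N. U \<inter> S)" "x \<in> S"
    have "0 < emeasure M (U \<inter> S)" if U: "open U" "x \<in> U" for U
    proof -
      obtain V where V: "V \<in> B" "x \<in> V" "V \<subseteq> U" using topological_basisE[OF B(2) U] by auto
      have "emeasure M (V \<inter> S) \<noteq> 0" using x V by (auto simp: N_def)
      moreover have "emeasure M (V \<inter> S) \<le> emeasure M (U \<inter> S)"
        using V U by (intro emeasure_mono) (auto simp: prob_measuresD(2)[OF M] sets_restrict_space)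
      ultimately show ?thesis by (metis le_zero_eq not_gr_zero)
    qed
    with x(2) show "x \<in> measure_support S M" by (simp add: measure_support_def)
  qed
qed

theorem corollary2p4:
  fixes \<Omega> :: "(real^'d) set"
    and \<mu> :: "'k::finite \<Rightarrow> (real^'d) measure"
    and L :: "real^'d^'k \<Rightarrow> real"
    and p :: "(real^'d^'k) measure"
  assumes "compact \<Omega>" and "convex \<Omega>"
    and "\<And>l. \<mu> l \<in> prob_measures \<Omega>"
    and "(0 \<in> power_set \<Omega> \<and> p = return (borel_on (power_set \<Omega>)) 0 \<and> convex_on UNIV L)
       \<or> (convex_on UNIV L \<and>
          (\<forall>x \<in> power_set \<Omega>. \<forall>\<xi>. L (\<chi> l. x $ l - \<xi>) = L x) \<and>
          (\<exists>\<nu> \<in> prob_measures \<Omega>. p = distr \<nu> (borel_on (power_set \<Omega>)) (\<lambda>\<xi>. \<chi> l. \<xi>)))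
       \<or> (\<exists>E Lt. subspace E \<and> convex_on E Lt \<and> (\<forall>x. L x = Lt (orth_proj E x)) \<and>
          p \<in> prob_measures (power_set \<Omega>) \<and> measure_support (power_set \<Omega>) p \<subseteq> E\<^sup>\<bottom>)"
  shows "(INF \<gamma>\<in>couplings \<Omega> \<mu>. ereal (static_cost L \<gamma>)) = (INF f\<in>flows \<Omega> p \<mu>. dynamical_cost L f)
       \<and> (\<exists>\<gamma>. is_arg_min (static_cost L) (\<lambda>\<gamma>. \<gamma> \<in> couplings \<Omega> \<mu>) \<gamma>)
       \<and> (\<exists>f. is_arg_min (dynamical_cost L) (\<lambda>f. f \<in> flows \<Omega> p \<mu>) f)
       \<and> (\<forall>\<gamma>. is_arg_min (static_cost L) (\<lambda>\<gamma>. \<gamma> \<in> couplings \<Omega> \<mu>) \<gamma> \<longrightarrow>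
            (\<exists>\<pi> m. is_arg_min (dynamical_cost L) (\<lambda>f. f \<in> flows \<Omega> p \<mu>) (\<pi>, m) \<and> \<pi> 1 = \<gamma>))
       \<and> (\<forall>\<pi> m. is_arg_min (dynamical_cost L) (\<lambda>f. f \<in> flows \<Omega> p \<mu>) (\<pi>, m) \<longrightarrow>
            is_arg_min (static_cost L) (\<lambda>\<gamma>. \<gamma> \<in> couplings \<Omega> \<mu>) (\<pi> 1))"
proof -
  let ?K = "power_set \<Omega> :: (real^'d^'k) set"
  \<comment> \<open>The tuple in the hypothesis \<open>0 \<in> power_set \<Omega>\<close> has an index type of its own, hence the detour through \<open>\<Omega>\<close>.\<close>
  consider (origin) "0 \<in> \<Omega>" "p = return (borel_on ?K) 0" "convex_on UNIV L"
    | (diagonal) \<nu> where "convex_on UNIV L" "\<forall>x\<in>?K. \<forall>\<xi>. L (\<chi> l. x $ l - \<xi>) = L x"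
        "\<nu> \<in> prob_measures \<Omega>" "p = distr \<nu> (borel_on ?K) (\<lambda>\<xi>. \<chi> l. \<xi>)"
    | (projection) E Lt where "subspace E" "convex_on E Lt" "\<forall>x. L x = Lt (orth_proj E x)"
        "p \<in> prob_measures ?K" "measure_support ?K p \<subseteq> E\<^sup>\<bottom>"
    using assms(4) by (elim disjE conjE exE bexE) (auto simp: power_set_def)
  then have "convex_on UNIV L \<and> p \<in> prob_measures ?K \<and>
      (AE x0 in p. (\<forall>c. L (c *\<^sub>R x0) = L 0) \<and> (\<forall>x\<in>?K. L (x - x0) = L x))"
  proof cases
    case origin
    note p = origin(2) and L = origin(3)
    have 0: "0 \<in> ?K" using origin(1) by (simp add: power_set_def)
    have "p \<in> prob_measures ?K"
      using 0 by (simp add: p prob_measures_def prob_space_return space_restrict_space)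
    moreover have "AE x0 in p. x0 = 0"
    proof -
      have "{x0 \<in> space (borel_on ?K). x0 = 0} = ?K \<inter> {0}" by (auto simp: space_restrict_space)
      also have "\<dots> \<in> sets (borel_on ?K)" unfolding sets_restrict_space by (rule imageI) simp
      finally have "Measurable.pred (borel_on ?K) (\<lambda>x0. x0 = 0)" by (simp add: pred_def)
      with 0 show ?thesis unfolding p by (subst AE_return) (simp_all add: space_restrict_space)
    qed
    then have "AE x0 in p. (\<forall>c. L (c *\<^sub>R x0) = L 0) \<and> (\<forall>x\<in>?K. L (x - x0) = L x)"
      by (rule eventually_mono) simp
    ultimately show ?thesis using L by blast
  next
    case diagonal
    note L = diagonal(1) and inv = diagonal(2) and \<nu> = diagonal(3) and p = diagonal(4)
    have diag: "(\<lambda>\<xi>. \<chi> l. \<xi>) \<in> measurable \<nu> (borel_on ?K)"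
    proof (rule measurable_restrict_space2)
      show "(\<lambda>\<xi>. \<chi> l. \<xi>) \<in> space \<nu> \<rightarrow> ?K"
        using prob_measuresD(3)[OF \<nu>] by (auto simp: power_set_def)
      show "(\<lambda>\<xi>. (\<chi> l. \<xi>) :: real^'d^'k) \<in> borel_measurable \<nu>"
        by (rule borel_measurable_vec_lambda, rule borel_measurable_prob_measures[OF \<nu>]) (rule continuous_on_id)
    qed
    have pK: "p \<in> prob_measures ?K"
      unfolding p using prob_measuresD(1)[OF \<nu>] diag by (rule distr_in_prob_measures)
    \<comment> \<open>The law of \<open>(\<xi>, ..., \<xi>)\<close> is carried by the diagonal,
      which is closed and therefore measurable.\<close>
    have "closed {x :: real^'d^'k. \<forall>l l'. x $ l = x $ l'}"
      by (intro closed_Collect_all closed_Collect_eq continuous_intros)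
    then have "{x \<in> ?K. \<forall>l l'. x $ l = x $ l'} \<in> sets (borel_on ?K)"
      by (auto simp: sets_restrict_space intro!: image_eqI[of _ _ "{x. \<forall>l l'. x $ l = x $ l'}"])
    then have "AE x0 in p. \<forall>l l'. x0 $ l = x0 $ l'"
      unfolding p by (subst AE_distr_iff[OF diag]) (auto simp: space_restrict_space)
    moreover have "AE x0 in p. x0 \<in> ?K" using AE_space[of p] by (simp add: prob_measuresD(3)[OF pK])
    ultimately have "AE x0 in p. (\<forall>c. L (c *\<^sub>R x0) = L 0) \<and> (\<forall>x\<in>?K. L (x - x0) = L x)"
    proof eventually_elim
      fix x0 :: "real^'d^'k" assume x0: "\<forall>l l'. x0 $ l = x0 $ l'" "x0 \<in> ?K"
      define \<xi> where "\<xi> = x0 $ undefined"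
      have nth: "x0 $ l = \<xi>" for l using x0(1) by (simp add: \<xi>_def)
      \<comment> \<open>Translation invariance is assumed only at points of \<open>?K\<close>, and
        \<open>c *\<^sub>R x0\<close> may lie outside. So \<open>x0\<close> itself is translated, by
        \<open>\<xi> - c *\<^sub>R \<xi>\<close>; the case \<open>c = 0\<close> then identifies
        \<open>L x0\<close> with \<open>L 0\<close>.\<close>
      have scale: "L (c *\<^sub>R x0) = L x0" for c
      proof -
        have "(\<chi> l. x0 $ l - (\<xi> - c *\<^sub>R \<xi>)) = c *\<^sub>R x0" by (simp add: vec_eq_iff nth)
        then show ?thesis using inv x0(2) by metis
      qed
      have "L (c *\<^sub>R x0) = L 0" for c using scale[of c] scale[of 0] by simp
      moreover have "L (x - x0) = L x" if "x \<in> ?K" for x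
      proof -
        have "(\<chi> l. x $ l - \<xi>) = x - x0" by (simp add: vec_eq_iff nth)
        then show ?thesis using inv that by metis
      qed
      ultimately show "(\<forall>c. L (c *\<^sub>R x0) = L 0) \<and> (\<forall>x\<in>?K. L (x - x0) = L x)" by blast
    qed
    with L pK show ?thesis by blast
  next
    case projection
    note E = projection(1) and Lt = projection(2) and L_eq = projection(3)
      and p = projection(4) and supp = projection(5)
    have "L = (\<lambda>x. Lt (orth_proj E x))" using L_eq by auto
    then have "convex_on UNIV L" using convex_on_orth_proj[OF E Lt] by simp
    moreover have "AE x0 in p. (\<forall>c. L (c *\<^sub>R x0) = L 0) \<and> (\<forall>x\<in>?K. L (x - x0) = L x)"
      using AE_in_measure_support[OF p]
    proof (rule eventually_mono)
      fix x0 assume "x0 \<in> measure_support ?K p"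
      then have "orth_proj E x0 = 0" using supp by (intro orth_proj_orthogonal[OF E]) auto
      then have "orth_proj E (a *\<^sub>R x + b *\<^sub>R x0) = a *\<^sub>R orth_proj E x" for a b x
        by (simp add: orth_proj_combination[OF E])
      \<comment> \<open>The coefficient \<open>a = 0\<close> gives the multiples of
        \<open>x0\<close>; \<open>a = 1\<close> with \<open>b = - 1\<close> gives the translation by
        \<open>x0\<close>.\<close>
      from this[of 0 0] this[of 1 _ "- 1"]
      show "(\<forall>c. L (c *\<^sub>R x0) = L 0) \<and> (\<forall>x\<in>?K. L (x - x0) = L x)"
        using L_eq orth_proj_orthogonal[OF E subspace_0[OF subspace_orthogonal_comp]] by simp
    qed
    ultimately show ?thesis using p by blast
  qed
  then show ?thesis
    by (elim conjE) (rule static_dynamical_equivalence[OF assms(1-3)])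
qed

end
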